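(* Let $S$ be special and fix $y\in\mathbb R^3$ with $S^*(y)=4D$. Then for every $x\in\mathcal C(S)$, \[ \#\{x'\in\mathcal C(S,x):\ 0<x'y^t\le T\}\sim \kappa\, T\qquad (T\to\infty), \] where $\kappa>0$ depends only on the genus of $S$ (in particular not on $x$, nor on the class of $S$ within its genus).
   Context: $S$ is a symmetric $3\times3$ integer matrix with $D=\det S>0$; $S(x)=xSx^t$, and $S^*=(\det S)S^{-1}$ with $S^*(y)=yS^*y^t$. Primitive: gcd of entries is $1$; isotropic: $S(x)=0$ for some primitive $x\in\mathbb Z^3$. $-\Omega>0$ is the gcd of the entries of $S^*$; $\Delta=D/\Omega^2\in\mathbb Z_{>0}$; $N=\gcd(\Omega,\Delta)>0$. $S$ is special if it is primitive, isotropic, $D>0$ and $N$, $|\Omega|/N$, $\Delta/N$ are square-free. $\mathcal C(S)$ is the set of primitive $x\in\mathbb Z^3$ with $S(x)=0$; $O(S)=\{A\in\mathrm{GL}_3(\mathbb Z):A^tSA=S\}$; the orbit of $x$ is $\mathcal C(S,x)=\{xA^t: A\in O(S)\}$. The genus of $S$ is the set of $S'$ such that for each prime $p$ and $p=\infty$ there is $A\in\mathrm{GL}_3(\mathbb Z_p)$ ($\mathbb Z_\infty=\mathbb R$) with $A^tSA=S'$. *)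

theory Defs
  imports "HOL-Analysis.Analysis" "HOL-Library.Landau_Symbols" "HOL-Computational_Algebra.Squarefree" "HOL-Number_Theory.Cong"
begin

type_synonym imat3 = "int^3^3"
type_synonym ivec3 = "int^3"

definition qf :: "'a::comm_ring_1^3^3 \<Rightarrow> 'a^3 \<Rightarrow> 'a" where
  "qf S x = (\<Sum>i\<in>UNIV. \<Sum>j\<in>UNIV. x$i * S$i$j * x$j)"

(* adjugate S^* (= det S * S^{-1} when det S \<noteq> 0), cofactor formula for 3x3, indices mod 3 *)
definition adj3 :: "'a::comm_ring_1^3^3 \<Rightarrow> 'a^3^3" where
  "adj3 A = (\<chi> i j. A$(j+1)$(i+1) * A$(j+2)$(i+2) - A$(j+1)$(i+2) * A$(j+2)$(i+1))"

definition sym_mat :: "imat3 \<Rightarrow> bool" where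
  "sym_mat S \<longleftrightarrow> transpose S = S"

definition primitive_mat :: "imat3 \<Rightarrow> bool" where
  "primitive_mat S \<longleftrightarrow> Gcd {S$i$j | i j. True} = 1"

definition primitive_vec :: "ivec3 \<Rightarrow> bool" where
  "primitive_vec x \<longleftrightarrow> Gcd {x$i | i. True} = 1"

definition isotropic :: "imat3 \<Rightarrow> bool" where
  "isotropic S \<longleftrightarrow> (\<exists>x. primitive_vec x \<and> qf S x = 0)"

definition Omega :: "imat3 \<Rightarrow> int" where
  "Omega S = - Gcd {adj3 S $i$j | i j. True}"

definition Delta :: "imat3 \<Rightarrow> int" where
  "Delta S = det S div (Omega S)^2"

definition NN :: "imat3 \<Rightarrow> int" where
  "NN S = gcd (Omega S) (Delta S)"

definition special :: "imat3 \<Rightarrow> bool" where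
  "special S \<longleftrightarrow> sym_mat S \<and> primitive_mat S \<and> isotropic S \<and> det S > 0 \<and>
     squarefree (NN S) \<and> squarefree (\<bar>Omega S\<bar> div NN S) \<and> squarefree (Delta S div NN S)"

definition cone :: "imat3 \<Rightarrow> ivec3 set" where
  "cone S = {x. primitive_vec x \<and> qf S x = 0}"

definition GL3Z :: "imat3 set" where
  "GL3Z = {A. \<exists>B. A ** B = mat 1 \<and> B ** A = mat 1}"

definition OS :: "imat3 \<Rightarrow> imat3 set" where
  "OS S = {A \<in> GL3Z. transpose A ** S ** A = S}"

(* C(S,x) = { x A^t : A \<in> O(S) }; as column vectors x A^t is A *v x *)
definition orbit :: "imat3 \<Rightarrow> ivec3 \<Rightarrow> ivec3 set" where
  "orbit S x = {A *v x | A. A \<in> OS S}"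

definition real_vec :: "ivec3 \<Rightarrow> real^3" where
  "real_vec x = (\<chi> i. of_int (x$i))"

definition real_mat :: "imat3 \<Rightarrow> real^3^3" where
  "real_mat S = (\<chi> i j. of_int (S$i$j))"

definition pair :: "ivec3 \<Rightarrow> real^3 \<Rightarrow> real" where
  "pair x y = (\<Sum>i\<in>UNIV. of_int (x$i) * y$i)"

(* Z_p as the inverse limit of Z/p^k: a matrix over Z_p is a compatible family
   of integer matrices A k (meaning A k mod p^k).
   A \<in> GL_3(Z_p) iff det (A 1) is a unit mod p; A^t S A = S' iff it holds mod p^k for all k. *)
definition padic_equiv :: "nat \<Rightarrow> imat3 \<Rightarrow> imat3 \<Rightarrow> bool" where
  "padic_equiv p S S' \<longleftrightarrow> (\<exists>A :: nat \<Rightarrow> imat3.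
      (\<forall>k i j. [A (Suc k) $i$j = A k $i$j] (mod (int p)^k)) \<and>
      \<not> (int p dvd det (A 1)) \<and>
      (\<forall>k i j. [(transpose (A k) ** S ** A k) $i$j = S'$i$j] (mod (int p)^k)))"

definition real_equiv :: "imat3 \<Rightarrow> imat3 \<Rightarrow> bool" where
  "real_equiv S S' \<longleftrightarrow> (\<exists>A :: real^3^3. invertible A \<and>
      transpose A ** real_mat S ** A = real_mat S')"

definition genus :: "imat3 \<Rightarrow> imat3 set" where
  "genus S = {S'. (\<forall>p. prime p \<longrightarrow> padic_equiv p S S') \<and> real_equiv S S'}"

end

theory Submission
  imports Defs
begin

text \<open>
  A pointed special form \<open>(S', x)\<close> is integrally equivalent to \<open>- a y\<^sup>2 + 2 m x z + d z\<^sup>2\<close> pointed at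
  \<open>e\<^sub>1\<close>, and the square-freeness conditions force \<open>m\<close> and \<open>a\<close> to depend only on the genus, while \<open>d\<close>
  varies within a genus only by \<open>d \<mapsto> w\<^sup>2 d\<close>, \<open>w\<close> a local unit, up to equivalence. Hence a primitive isotropic vector
  lies in the orbit of \<open>e\<^sub>1\<close> as soon as it does so modulo \<open>2 m\<^sup>2\<close>. The cone is parametrized by coprime
  pairs \<open>\<plusminus>(u, v)\<close> via \<open>(a u\<^sup>2 - d v\<^sup>2, 2 m u v, 2 m v\<^sup>2) / g\<close> where \<open>g\<close> divides \<open>2 m a\<close>, so the orbit is
  given by congruence conditions on \<open>(u, v)\<close>, and pairing with \<open>y\<close> becomes a definite binary form of
  discriminant \<open>-16 m\<^sup>2 a\<close> divided by \<open>g\<close>. Counting primitive lattice points in ellipses gives the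
  asymptotics, and the substitution \<open>(u, v) \<mapsto> (u, w\<^sup>-\<^sup>1 v)\<close> of residue classes shows that
  \<open>d\<close> and \<open>w\<^sup>2 d\<close> yield the same constant.
\<close>

subsection \<open>Matrices and congruences\<close>

text \<open>Base changes fixing e1 move d by 2 m r and by - a t^2 with m dividing a t
  (\<open>nf_shift\<close>). So the corner matters modulo 2 m, not m; this is why the prime 2 needs
  its own case analysis and why t occurs at all, as away from 2 a unit square suffices. Pairings
  with e1 carry a factor m, whose cancellation costs another m: hence the modulus 2 m^2. The forms
  with d and w^2 d need not be integrally equivalent, so their orbits are not matched point by point
  but only as counts. Modulo 2 m^2 the matrix diag (1, w, w^2) is, up to a scalar, an isometry
  between them that fixes e1, and it carries admissible residue classes of (u, v) to admissible ones
  with the same content g. Classes with the same content have the same weight, because the binary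
  form A u^2 + B u v + C v^2 obtained from y has 4 A C - B^2 equal to 4 times the adjugate form at
  y, that is 16 D, whatever y and d are. This is where the normalization of y enters.\<close>

lemma numerals_mod3: "(4::3) = 1" "(5::3) = 2" "(6::3) = 3" by simp_all

lemmas mat3_simps = vec_eq_iff matrix_matrix_mult_def matrix_vector_mult_def forall_3 sum_3 transpose_def
  mat_def det_3 numerals_mod3

lemma adj3_mult: "adj3 (A ** B) = adj3 B ** adj3 (A::'a::comm_ring_1^3^3)"
  by (simp add: adj3_def mat3_simps algebra_simps)

lemma mult_adj3: "A ** adj3 A = mat (det (A::'a::comm_ring_1^3^3))"
  by (simp add: adj3_def mat3_simps algebra_simps)

lemma adj3_mult_self: "adj3 A ** A = mat (det (A::'a::comm_ring_1^3^3))"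
  by (simp add: adj3_def mat3_simps algebra_simps)

lemma adj3_transpose: "adj3 (transpose A) = transpose (adj3 (A::'a::comm_ring_1^3^3))"
  by (simp add: adj3_def mat3_simps algebra_simps)

lemma det_mat_3: "det (mat k :: 'a::comm_ring_1^3^3) = k ^ 3"
  by (simp add: det_3 mat_def power3_eq_cube)

lemma qf_mult: "qf S (A *v x) = qf (transpose A ** S ** A) (x::'a::comm_ring_1^3)"
  by (simp add: qf_def matrix_vector_mult_def matrix_matrix_mult_def transpose_def sum_3 algebra_simps)

definition mcong :: "int \<Rightarrow> imat3 \<Rightarrow> imat3 \<Rightarrow> bool" where
  "mcong q A B \<longleftrightarrow> (\<forall>i j. [A$i$j = B$i$j] (mod q))"

definition vcong :: "int \<Rightarrow> ivec3 \<Rightarrow> ivec3 \<Rightarrow> bool" where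
  "vcong q x y \<longleftrightarrow> (\<forall>i. [x$i = y$i] (mod q))"

lemma mcong_refl [simp]: "mcong q A A" by (simp add: mcong_def)
lemma mcong_sym: "mcong q A B \<Longrightarrow> mcong q B A" by (simp add: mcong_def cong_sym_eq)
lemma mcong_trans [trans]: "mcong q A B \<Longrightarrow> mcong q B C \<Longrightarrow> mcong q A C"
  unfolding mcong_def by (meson cong_trans)
lemma mcong_mult: "mcong q A A' \<Longrightarrow> mcong q B B' \<Longrightarrow> mcong q (A ** B) (A' ** B')"
  unfolding mcong_def matrix_matrix_mult_def by (auto intro!: cong_sum cong_mult)
lemma mcong_transpose: "mcong q A B \<Longrightarrow> mcong q (transpose A) (transpose B)"
  by (simp add: mcong_def transpose_def)
lemma mcong_dvd: "mcong q A B \<Longrightarrow> r dvd q \<Longrightarrow> mcong r A B"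
  unfolding mcong_def by (meson cong_dvd_modulus)
lemma mcong_det: "mcong q A B \<Longrightarrow> [det A = det B] (mod q)"
  unfolding mcong_def det_3 by (intro cong_add cong_diff cong_mult) auto
lemma mcong_adj: "mcong q A B \<Longrightarrow> mcong q (adj3 A) (adj3 B)"
  unfolding mcong_def adj3_def by (auto intro!: cong_diff cong_mult)

lemma vcong_refl [simp]: "vcong q x x" by (simp add: vcong_def)
lemma vcong_sym: "vcong q x y \<Longrightarrow> vcong q y x" by (simp add: vcong_def cong_sym_eq)
lemma vcong_trans [trans]: "vcong q x y \<Longrightarrow> vcong q y z \<Longrightarrow> vcong q x z"
  unfolding vcong_def by (meson cong_trans)
lemma vcong_mult: "mcong q A B \<Longrightarrow> vcong q x y \<Longrightarrow> vcong q (A *v x) (B *v y)"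
  unfolding mcong_def vcong_def matrix_vector_mult_def by (auto intro!: cong_sum cong_mult)

lemma det_GL3Z: "A \<in> GL3Z \<Longrightarrow> det A * det A = 1"
proof -
  assume "A \<in> GL3Z"
  then obtain B where "A ** B = mat 1" by (auto simp: GL3Z_def)
  then have "det A * det B = 1" by (metis det_I det_mul)
  then have "\<bar>det A\<bar> = 1" by (metis dvd_triv_left zdvd1_eq)
  then show ?thesis by (metis abs_mult_self_eq mult_1)
qed

text \<open>By Cramer's rule \<open>det A\<close> times the adjugate is an inverse once the
  determinant squares to 1. Unimodularity becomes a polynomial identity, which explicit matrices
  satisfy by computation.\<close>

lemma GL3Z_iff: "A \<in> GL3Z \<longleftrightarrow> det A * det A = 1"
proof
  assume h: "det A * det A = 1"
  define B where "B = (\<chi> i j. det A * adj3 A $ i $ j)"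
  have "A ** B = (\<chi> i j. det A * (A ** adj3 A) $ i $ j)"
    by (simp add: B_def matrix_matrix_mult_def sum_distrib_left vec_eq_iff mult_ac)
  also have "\<dots> = mat 1" using h by (simp add: mult_adj3 mat_def vec_eq_iff)
  finally have 1: "A ** B = mat 1" .
  have "B ** A = (\<chi> i j. det A * (adj3 A ** A) $ i $ j)"
    by (simp add: B_def matrix_matrix_mult_def sum_distrib_left vec_eq_iff mult_ac)
  also have "\<dots> = mat 1" using h by (simp add: adj3_mult_self mat_def vec_eq_iff)
  finally show "A \<in> GL3Z" using 1 by (auto simp: GL3Z_def)
qed (rule det_GL3Z)

lemma GL3Z_mult: "A \<in> GL3Z \<Longrightarrow> B \<in> GL3Z \<Longrightarrow> A ** B \<in> GL3Z"
proof -
  assume "A \<in> GL3Z" "B \<in> GL3Z"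
  then have "(det A * det A) * (det B * det B) = 1" by (simp add: GL3Z_iff)
  then show ?thesis by (simp add: GL3Z_iff det_mul mult_ac)
qed

lemma GL3Z_inverse:
  assumes "A \<in> GL3Z" obtains B where "B \<in> GL3Z" "A ** B = mat 1" "B ** A = mat 1"
  using assms unfolding GL3Z_def by blast

lemma coprime_det_GL3Z: "A \<in> GL3Z \<Longrightarrow> coprime (det A) q"
  using det_GL3Z[of A] by (intro is_unit_left_imp_coprime) (metis dvd_triv_left)

text \<open>Cramer's rule modulo q: the adjugate is divided by the determinant through its inverse u
  modulo q.\<close>

lemma matrix_inverse_mod:
  assumes "coprime (det A) q"
  shows "\<exists>B. coprime (det B) q \<and> mcong q (A ** B) (mat 1) \<and> mcong q (B ** A) (mat 1)"
proof -
  obtain u where u: "[det A * u = 1] (mod q)" using assms cong_solve_coprime_int by blast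
  define B where "B = (\<chi> i j. u * adj3 A $ i $ j)"
  have "A ** B = (\<chi> i j. u * (A ** adj3 A) $ i $ j)"
    by (simp add: B_def matrix_matrix_mult_def sum_distrib_left vec_eq_iff mult_ac)
  then have 1: "mcong q (A ** B) (mat 1)" using u by (auto simp: mcong_def mult_adj3 mat_def mult.commute)
  have "B ** A = (\<chi> i j. u * (adj3 A ** A) $ i $ j)"
    by (simp add: B_def matrix_matrix_mult_def sum_distrib_left vec_eq_iff mult_ac)
  then have 2: "mcong q (B ** A) (mat 1)" using u by (auto simp: mcong_def adj3_mult_self mat_def mult.commute)
  from mcong_det[OF 1] have "[det A * det B = 1] (mod q)" by (simp add: det_mul)
  then have "coprime (det B) q" by (metis cong_imp_coprime cong_sym coprime_1_left coprime_mult_left_iff)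
  with 1 2 show ?thesis by blast
qed

section \<open>Equivalence of matrices over Z/q\<close>

definition mod_equiv :: "int \<Rightarrow> imat3 \<Rightarrow> imat3 \<Rightarrow> bool" where
  "mod_equiv q S S' \<longleftrightarrow> (\<exists>A. coprime (det A) q \<and> mcong q (transpose A ** S ** A) S')"

lemma congr_mult:
  "transpose (A ** B) ** S ** (A ** B) = transpose B ** (transpose A ** S ** A) ** (B::'a::comm_ring_1^'n^'n)"
  by (simp add: matrix_transpose_mul matrix_mul_assoc)

lemma mod_equiv_trans:
  assumes "mod_equiv q S S'" "mod_equiv q S' S''" shows "mod_equiv q S S''"
proof -
  obtain A B where A: "coprime (det A) q" "mcong q (transpose A ** S ** A) S'"
    and B: "coprime (det B) q" "mcong q (transpose B ** S' ** B) S''"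
    using assms unfolding mod_equiv_def by blast
  have "mcong q (transpose (A ** B) ** S ** (A ** B)) (transpose B ** S' ** B)"
    unfolding congr_mult by (intro mcong_mult A(2) mcong_refl)
  then have "mcong q (transpose (A ** B) ** S ** (A ** B)) S''" using B(2) by (rule mcong_trans)
  moreover have "coprime (det (A ** B)) q" using A(1) B(1) by (simp add: det_mul)
  ultimately show ?thesis unfolding mod_equiv_def by blast
qed

lemma mod_equiv_sym:
  assumes "mod_equiv q S S'" shows "mod_equiv q S' S"
proof -
  obtain A where A: "coprime (det A) q" "mcong q (transpose A ** S ** A) S'"
    using assms unfolding mod_equiv_def by blast
  obtain B where B: "coprime (det B) q" "mcong q (A ** B) (mat 1)" using matrix_inverse_mod[OF A(1)] by blast
  have "mcong q (transpose B ** S' ** B) (transpose B ** (transpose A ** S ** A) ** B)"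
    by (intro mcong_mult mcong_refl mcong_sym[OF A(2)])
  also have "\<dots> = transpose (A ** B) ** S ** (A ** B)" by (simp only: congr_mult)
  also have "mcong q \<dots> (transpose (mat 1) ** S ** mat 1)"
    by (intro mcong_mult mcong_transpose mcong_refl B)
  finally have "mcong q (transpose B ** S' ** B) S" by simp
  then show ?thesis using B(1) unfolding mod_equiv_def by blast
qed

lemma mod_equiv_GL3Z: "U \<in> GL3Z \<Longrightarrow> mod_equiv q S (transpose U ** S ** U)"
  unfolding mod_equiv_def using coprime_det_GL3Z mcong_refl by blast

text \<open>The k-th approximation itself serves modulo p^k. Its determinant is prime to p because
  it agrees with \<open>A 1\<close> modulo p; this says nothing about \<open>A 0\<close>, whence the
  separate case of modulus 1.\<close>

lemma mod_equiv_padic: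
  assumes "padic_equiv p S S'" "prime p"
  shows "mod_equiv (int p ^ k) S S'"
proof (cases k)
  case 0 then show ?thesis unfolding mod_equiv_def by (auto simp: mcong_def)
next
  case (Suc l)
  obtain A where A: "\<And>k. mcong (int p ^ k) (A (Suc k)) (A k)" "\<not> int p dvd det (A 1)"
     "\<And>k. mcong (int p ^ k) (transpose (A k) ** S ** A k) S'"
    using assms unfolding padic_equiv_def mcong_def by blast
  have "mcong (int p) (A (Suc l)) (A 1)" for l
  proof (induction l)
    case (Suc l)
    have "mcong (int p) (A (Suc (Suc l))) (A (Suc l))" using A(1)[of "Suc l"] by (rule mcong_dvd) simp
    then show ?case using Suc mcong_trans by blast
  qed simp
  from mcong_det[OF this[of l]] A(2) have "\<not> int p dvd det (A k)" unfolding Suc by (simp add: cong_dvd_iff)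
  then have "coprime (int p) (det (A k))" using assms(2) by (intro prime_imp_coprime) auto
  then have "coprime (det (A k)) (int p ^ k)" by (simp add: coprime_commute)
  then show ?thesis using A(3) unfolding mod_equiv_def by blast
qed

lemma mod_equiv_dvd_entries:
  assumes "mod_equiv q S S'" "\<And>i j. q dvd S$i$j" shows "q dvd S'$i$j"
proof -
  obtain A where A: "mcong q (transpose A ** S ** A) S'" using assms unfolding mod_equiv_def by blast
  have "mcong q S 0" using assms(2) by (simp add: mcong_def cong_0_iff)
  then have "mcong q (transpose A ** S ** A) (transpose A ** 0 ** A)" by (intro mcong_mult mcong_refl)
  moreover have "transpose A ** 0 ** A = 0" by (simp add: mat3_simps)
  ultimately have "mcong q S' 0" using A by (metis mcong_sym mcong_trans)
  then show ?thesis by (simp add: mcong_def cong_0_iff)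
qed

text \<open>The adjugate reverses products, so a base change A of S induces the base change
  \<open>transpose (adj3 A)\<close> of the adjugate, whose determinant is prime to q because it
  divides a power of \<open>det A\<close>.\<close>

lemma mod_equiv_adj: "mod_equiv q S S' \<Longrightarrow> mod_equiv q (adj3 S) (adj3 S')"
proof -
  assume "mod_equiv q S S'"
  then obtain A where A: "coprime (det A) q" "mcong q (transpose A ** S ** A) S'"
    unfolding mod_equiv_def by blast
  have "det (adj3 A) * det A = det A ^ 3"
    by (simp only: det_mul[symmetric] adj3_mult_self det_mat_3)
  then have 1: "coprime (det (adj3 A)) q"
    using A(1) by (metis coprime_mult_left_iff coprime_power_left_iff)
  have "mcong q (adj3 (transpose A ** S ** A)) (adj3 S')" by (rule mcong_adj[OF A(2)])
  then have "mcong q (transpose (transpose (adj3 A)) ** adj3 S ** transpose (adj3 A)) (adj3 S')"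
    by (simp add: adj3_mult adj3_transpose matrix_mul_assoc)
  then show ?thesis unfolding mod_equiv_def using 1 by (metis det_transpose)
qed

lemma mod_equiv_det_dvd:
  assumes "mod_equiv q S S'" "q dvd det S" shows "q dvd det S'"
proof -
  obtain A where A: "mcong q (transpose A ** S ** A) S'" using assms unfolding mod_equiv_def by blast
  from mcong_det[OF A] have "[det A * det S * det A = det S'] (mod q)" by (simp add: det_mul)
  moreover have "q dvd det A * det S * det A" using assms(2) by simp
  ultimately show ?thesis by (simp add: cong_dvd_iff)
qed

section \<open>Invariants of a genus\<close>

definition locally_equiv :: "imat3 \<Rightarrow> imat3 \<Rightarrow> bool" where
  "locally_equiv S S' \<longleftrightarrow> (\<forall>p::int. prime p \<longrightarrow> (\<forall>k. mod_equiv (p ^ k) S S'))"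

lemma locally_equiv_sym: "locally_equiv S S' \<Longrightarrow> locally_equiv S' S"
  unfolding locally_equiv_def using mod_equiv_sym by blast
lemma locally_equiv_trans: "locally_equiv S S' \<Longrightarrow> locally_equiv S' S'' \<Longrightarrow> locally_equiv S S''"
  unfolding locally_equiv_def using mod_equiv_trans by blast
lemma locally_equiv_GL3Z: "U \<in> GL3Z \<Longrightarrow> locally_equiv S (transpose U ** S ** U)"
  unfolding locally_equiv_def using mod_equiv_GL3Z by blast

text \<open>Solvability modulo each single prime power is all that is taken from the p-adic
  conditions. The real place serves only in \<open>genus_sym_det\<close>.\<close>

lemma genus_locally_equiv:
  assumes "S' \<in> genus S" shows "locally_equiv S S'"
  unfolding locally_equiv_def
proof (intro allI impI)
  fix p :: int and k assume "prime p"
  then have p: "prime (nat p)" "int (nat p) = p" by (simp_all add: prime_ge_0_int)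
  then have "padic_equiv (nat p) S S'" using assms by (simp add: genus_def)
  from mod_equiv_padic[OF this p(1), of k] show "mod_equiv (p ^ k) S S'" by (simp only: p(2))
qed

lemma prime_power_dvd_imp_dvd:
  fixes g h :: int
  assumes "\<And>p k. prime p \<Longrightarrow> p ^ k dvd g \<Longrightarrow> p ^ k dvd h"
  shows "g dvd h"
proof (cases "h = 0")
  case False
  \<comment> \<open>If g were 0, every power of 2 would divide the nonzero h.\<close>
  have "g \<noteq> 0"
  proof
    assume "g = 0"
    then have "2 ^ k dvd h" for k using assms[of 2 k] by simp
    then have "\<bar>2 ^ nat \<bar>h\<bar>\<bar> \<le> \<bar>h\<bar>" using dvd_imp_le_int False by blast
    moreover have "int (nat \<bar>h\<bar>) < 2 ^ nat \<bar>h\<bar>" by (rule of_nat_less_two_power)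
    ultimately show False by simp
  qed
  then show ?thesis
    using False assms multiplicity_dvd
    by (intro multiplicity_le_imp_dvd) (auto intro!: multiplicity_geI)
qed simp

lemma Gcd_entries_eq:
  assumes "locally_equiv S S'"
  shows "Gcd {S$i$j | i j. True} = Gcd {S'$i$j | i j. True}"
proof (rule zdvd_antisym_nonneg)
  have *: "Gcd {S$i$j | i j. True} dvd Gcd {S'$i$j | i j. True}" if "locally_equiv S S'" for S S' :: imat3
  proof (rule prime_power_dvd_imp_dvd)
    fix p :: int and k
    assume p: "prime p" and d: "p ^ k dvd Gcd {S$i$j | i j. True}"
    have "p ^ k dvd S$i$j" for i j by (rule dvd_trans[OF d]) (auto intro: Gcd_dvd)
    then have "p ^ k dvd S'$i$j" for i j
      using that p mod_equiv_dvd_entries unfolding locally_equiv_def by blast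
    then show "p ^ k dvd Gcd {S'$i$j | i j. True}" by (auto intro: Gcd_greatest)
  qed
  show "Gcd {S$i$j | i j. True} dvd Gcd {S'$i$j | i j. True}"
    by (rule *[OF assms])
  show "Gcd {S'$i$j | i j. True} dvd Gcd {S$i$j | i j. True}"
    by (rule *[OF locally_equiv_sym[OF assms]])
qed simp_all

lemma locally_equiv_adj: "locally_equiv S S' \<Longrightarrow> locally_equiv (adj3 S) (adj3 S')"
  unfolding locally_equiv_def using mod_equiv_adj by blast

lemma locally_equiv_Omega: "locally_equiv S S' \<Longrightarrow> Omega S = Omega S'"
  unfolding Omega_def using Gcd_entries_eq[OF locally_equiv_adj] by simp

text \<open>Locally the determinant changes by the square of a unit, so the same prime powers divide
  it on both sides; positivity fixes the sign.\<close>

lemma locally_equiv_det: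
  assumes "locally_equiv S S'" "det S > 0" "det S' > 0" shows "det S = det S'"
proof (rule zdvd_antisym_nonneg)
  have *: "det S dvd det S'" if "locally_equiv S S'" for S S'
  proof (rule prime_power_dvd_imp_dvd)
    fix p :: int and k assume "prime p" and d: "p ^ k dvd det S"
    then have "mod_equiv (p ^ k) S S'" using that by (simp add: locally_equiv_def)
    then show "p ^ k dvd det S'" using d by (rule mod_equiv_det_dvd)
  qed
  show "det S dvd det S'" "det S' dvd det S"
    by (rule *[OF assms(1)], rule *[OF locally_equiv_sym[OF assms(1)]])
qed (use assms in auto)

lemma special_locally_equiv:
  assumes "special S" "locally_equiv S S'" "sym_mat S'" "det S' > 0" "x \<in> cone S'"
  shows "special S'"
proof -
  have "det S = det S'" using assms by (intro locally_equiv_det) (auto simp: special_def)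
  moreover have "Omega S = Omega S'" using assms by (intro locally_equiv_Omega)
  moreover have "primitive_mat S'" using assms Gcd_entries_eq[OF assms(2)] by (simp add: special_def primitive_mat_def)
  moreover have "isotropic S'" using assms(5) by (auto simp: isotropic_def cone_def)
  ultimately show ?thesis using assms by (simp add: special_def NN_def Delta_def)
qed

lemma real_mat_mult: "real_mat (A ** B) = real_mat A ** real_mat B"
  by (simp add: real_mat_def mat3_simps)
lemma real_mat_transpose: "real_mat (transpose A) = transpose (real_mat A)"
  by (simp add: real_mat_def mat3_simps)
lemma real_mat_det: "det (real_mat A) = of_int (det A)"
  by (simp add: real_mat_def mat3_simps)
lemma real_mat_eq_iff: "real_mat A = real_mat B \<longleftrightarrow> A = B"
  by (simp add: real_mat_def mat3_simps)

text \<open>Symmetry and the sign of the determinant are read off at the real place, where det S' =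
  (det A)^2 det S.\<close>

lemma genus_sym_det:
  assumes "S' \<in> genus S" "sym_mat S" "det S > 0"
  shows "sym_mat S'" "det S' > 0"
proof -
  obtain A :: "real^3^3" where A: "invertible A" "transpose A ** real_mat S ** A = real_mat S'"
    using assms(1) unfolding genus_def real_equiv_def by blast
  have S: "transpose (real_mat S) = real_mat S"
    using assms(2) by (simp flip: real_mat_transpose add: sym_mat_def)
  have "transpose (real_mat S') = real_mat S'"
    unfolding A(2)[symmetric] by (simp add: matrix_transpose_mul S matrix_mul_assoc)
  then show "sym_mat S'" by (simp flip: real_mat_transpose add: sym_mat_def real_mat_eq_iff)
  have "det (real_mat S') = det A * det (real_mat S) * det A"
    unfolding A(2)[symmetric] by (simp add: det_mul)
  then have "det (real_mat S') = (det A)^2 * of_int (det S)" by (simp add: real_mat_det power2_eq_square)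
  moreover have "det A \<noteq> 0" using A(1) invertible_det_nz by blast
  ultimately have "det (real_mat S') > 0" using assms(3) by simp
  then show "det S' > 0" by (simp add: real_mat_det)
qed

subsection \<open>Normal forms of pointed isotropic matrices\<close>

definition e1 :: ivec3 where "e1 = vector [1, 0, 0]"

text \<open>The matrix of a form in a basis whose first vector is isotropic and pairs trivially with
  the second. The sign of the middle entry makes the determinant m^2 a, so that a is positive. The
  cross term c is removed in \<open>nf_exists\<close>.\<close>

definition nfc :: "'a::comm_ring_1 \<Rightarrow> 'a \<Rightarrow> 'a \<Rightarrow> 'a \<Rightarrow> 'a^3^3" where
  "nfc m a c d = vector [vector [0, 0, m], vector [0, - a, c], vector [m, c, d]]"

abbreviation nf :: "'a::comm_ring_1 \<Rightarrow> 'a \<Rightarrow> 'a \<Rightarrow> 'a^3^3" where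
  "nf m a d \<equiv> nfc m a 0 d"

lemma det_nfc: "det (nfc m a c d) = m^2 * a"
  by (simp add: nfc_def det_3 power2_eq_square algebra_simps)

lemma adj3_nfc: "adj3 (nfc m a c d) =
  vector [vector [-(a*d) - c^2, m*c, a*m], vector [m*c, -(m^2), 0], vector [a*m, 0, 0]]"
  by (simp add: nfc_def adj3_def mat3_simps power2_eq_square algebra_simps)

lemma bezout_unimodular:
  fixes p q :: int
  shows "\<exists>a b c d. a * d - b * c = 1 \<and> a * p + b * q = gcd p q \<and> c * p + d * q = 0"
proof (cases "gcd p q = 0")
  case True
  then have "1 * 1 - 0 * 0 = (1::int) \<and> 1 * p + 0 * q = gcd p q \<and> 0 * p + 1 * q = 0" by simp
  then show ?thesis by blast
next
  case False
  obtain a b where ab: "a * p + b * q = gcd p q" using bezout_int by blast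
  obtain p' q' where pq: "p = gcd p q * p'" "q = gcd p q * q'"
    by (meson dvdE gcd_dvd1 gcd_dvd2)
  have "gcd p q * (a * p' + b * q') = gcd p q * 1" using ab pq by (simp add: algebra_simps)
  then have "a * p' + b * q' = 1" using False by (metis mult_left_cancel)
  then have "a * p' - b * (- q') = 1" by simp
  moreover have "- q' * p + p' * q = 0" by (subst pq(1), subst (2) pq(2)) (simp add: algebra_simps)
  ultimately show ?thesis using ab by blast
qed

lemma primitive_vec_iff: "primitive_vec x \<longleftrightarrow> gcd (x$1) (gcd (x$2) (x$3)) = 1"
proof -
  have "{x$i | i. True} = {x$1, x$2, x$3}" by (simp add: full_SetCompr_eq UNIV_3)
  then show ?thesis by (simp add: primitive_vec_def)
qed

text \<open>Two applications of \<open>bezout_unimodular\<close> reduce x to e1; the inverse of this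
  reduction has x as its first column.\<close>

lemma complete_primitive:
  assumes "primitive_vec x"
  obtains U where "U \<in> GL3Z" "U *v e1 = x"
proof -
  obtain a b c d where 1: "a * d - b * c = 1" "a * (x$2) + b * (x$3) = gcd (x$2) (x$3)" "c * (x$2) + d * (x$3) = 0"
    using bezout_unimodular by blast
  define g where "g = gcd (x$2) (x$3)"
  obtain a' b' c' d' where 2: "a' * d' - b' * c' = 1" "a' * (x$1) + b' * g = gcd (x$1) g" "c' * (x$1) + d' * g = 0"
    using bezout_unimodular by blast
  have gg: "gcd (x$1) g = 1" using assms by (simp add: primitive_vec_iff g_def)
  define V :: imat3 where "V = vector [vector [1,0,0], vector [0,a,b], vector [0,c,d]]"
  define W :: imat3 where "W = vector [vector [a',b',0], vector [c',d',0], vector [0,0,1]]"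
  have V: "V \<in> GL3Z" and W: "W \<in> GL3Z"
    using 1 2 by (simp_all add: GL3Z_iff V_def W_def det_3)
  have "V *v x = vector [x$1, g, 0]" using 1 by (simp add: V_def mat3_simps g_def)
  then have "W *v (V *v x) = e1" using 2 gg by (simp add: W_def mat3_simps e1_def)
  then have eq: "(W ** V) *v x = e1" by (simp add: matrix_vector_mul_assoc)
  obtain U where U: "U \<in> GL3Z" "U ** (W ** V) = mat 1"
    using GL3Z_inverse[OF GL3Z_mult[OF W V]] by metis
  have "U *v e1 = x" unfolding eq[symmetric] matrix_vector_mul_assoc U(2) by simp
  with U show ?thesis using that by blast
qed

lemma sym_mat_congr: "sym_mat S \<Longrightarrow> sym_mat (transpose U ** S ** U)"
  by (simp add: sym_mat_def matrix_transpose_mul matrix_mul_assoc)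

lemma nfc_exists:
  assumes "sym_mat S" "det S > 0" "x \<in> cone S"
  obtains U m a c d where "U \<in> GL3Z" "U *v e1 = x" "m > 0" "a > 0" "transpose U ** S ** U = nfc m a c d"
proof -
  obtain V where V: "V \<in> GL3Z" "V *v e1 = x" using assms complete_primitive by (auto simp: cone_def)
  define S1 where "S1 = transpose V ** S ** V"
  have "qf S1 e1 = 0" using assms V qf_mult[of S V e1] by (simp add: cone_def S1_def)
  then have 11: "S1$1$1 = 0" by (simp add: qf_def e1_def sum_3)
  have sym: "sym_mat S1" unfolding S1_def by (rule sym_mat_congr[OF assms(1)])
  then have s: "S1$2$1 = S1$1$2" "S1$3$1 = S1$1$3" "S1$3$2 = S1$2$3"
    unfolding sym_mat_def by (simp_all add: vec_eq_iff transpose_def)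
  obtain a b c d where bz: "a * d - b * c = 1" "a * (S1$1$2) + b * (S1$1$3) = gcd (S1$1$2) (S1$1$3)"
    "c * (S1$1$2) + d * (S1$1$3) = 0"
    using bezout_unimodular by blast
  \<comment> \<open>The Bezout columns are placed in the order (c, d), (a, b), so that the first row
    of the new matrix becomes 0, 0, gcd.\<close>
  define W :: imat3 where "W = vector [vector [1,0,0], vector [0,c,a], vector [0,d,b]]"
  define S2 where "S2 = transpose W ** S1 ** W"
  have W: "W \<in> GL3Z" using bz by (simp add: GL3Z_iff W_def det_3) algebra
  have We: "W *v e1 = e1" by (simp add: W_def e1_def mat3_simps)
  define m where "m = gcd (S1$1$2) (S1$1$3)"
  have S2: "S2 = nfc m (- S2$2$2) (S2$2$3) (S2$3$3)"
    using 11 s bz by (simp add: S2_def nfc_def W_def mat3_simps m_def algebra_simps)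
  have U: "V ** W \<in> GL3Z" by (rule GL3Z_mult[OF V(1) W])
  have eq: "transpose (V ** W) ** S ** (V ** W) = S2" by (simp add: congr_mult S1_def S2_def)
  have "det S2 = det (V ** W) * det (V ** W) * det S" unfolding eq[symmetric] by (simp add: det_mul)
  then have "det S2 > 0" using assms det_GL3Z[OF U] by simp
  then have "m\<^sup>2 * (- S2$2$2) > 0" by (subst (asm) S2) (simp only: det_nfc)
  moreover have "m \<ge> 0" by (simp add: m_def)
  moreover have "m \<noteq> 0" using calculation by (auto simp: power2_eq_square)
  ultimately have "m > 0" "m\<^sup>2 > 0" by simp_all
  with \<open>m\<^sup>2 * (- S2$2$2) > 0\<close> have pos: "m > 0" "- S2$2$2 > 0" by (simp_all only: zero_less_mult_pos)
  have "(V ** W) *v e1 = x" using V(2) We by (simp flip: matrix_vector_mul_assoc)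
  from that[OF U this pos trans[OF eq S2]] show ?thesis .
qed

lemma dvd_Omega_nfc_iff:
  "k dvd Omega (nfc m a c d) \<longleftrightarrow> k dvd m^2 \<and> k dvd m*c \<and> k dvd a*m \<and> k dvd a*d + c^2"
proof -
  have "{adj3 (nfc m a c d) $i$j | i j. True} = {-(a*d) - c^2, m*c, a*m, -(m^2), 0}"
  proof -
    have "{adj3 (nfc m a c d) $i$j | i j. True} = (\<Union>i. \<Union>j. {adj3 (nfc m a c d) $i$j})" by auto
    also have "\<dots> = {-(a*d) - c^2, m*c, a*m, -(m^2), 0}" by (auto simp: adj3_nfc UNIV_3)
    finally show ?thesis .
  qed
  then have "Omega (nfc m a c d) = - Gcd {-(a*d) - c^2, m*c, a*m, -(m^2), 0}" by (simp add: Omega_def)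
  moreover have "k dvd -(a*d) - c^2 \<longleftrightarrow> k dvd a*d + c^2"
    by (metis dvd_minus_iff minus_add_distrib diff_conv_add_uminus)
  ultimately show ?thesis by auto
qed

section \<open>Exponents of a prime in the invariants of a special form\<close>

lemma adj3_adj3: "adj3 (adj3 A) $i$j = det (A::'a::comm_ring_1^3^3) * A$i$j"
proof -
  have "\<forall>i j. adj3 (adj3 A) $i$j = det A * A$i$j"
    by (simp add: adj3_def mat3_simps algebra_simps)
  then show ?thesis by simp
qed

text \<open>The 2 by 2 minors of the adjugate are the entries of S times det S
  (\<open>adj3_adj3\<close>), and each is divisible by the square of \<open>Omega S\<close>. As the
  entries of S are coprime, this square divides det S, and the division in \<open>Delta\<close> is
  exact.\<close>

lemma det_Delta:
  assumes "primitive_mat S" shows "det S = Delta S * (Omega S)^2"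
proof -
  have *: "Omega S dvd adj3 S $i$j" for i j unfolding Omega_def by (auto intro!: Gcd_dvd)
  have "(Omega S)^2 dvd det S * S$i$j" for i j
    unfolding adj3_adj3[symmetric] power2_eq_square adj3_def[of "adj3 S"] by (simp add: mult_dvd_mono *)
  then have "(Omega S)^2 dvd Gcd ((*) (det S) ` {S$i$j | i j. True})" by (intro Gcd_greatest) auto
  also have "\<dots> = \<bar>det S\<bar>" using assms by (subst Gcd_mult) (simp add: primitive_mat_def)
  finally show ?thesis by (simp add: Delta_def)
qed

text \<open>Write |Omega| = n o' and Delta = n d' with n = N. Then o' and d' are coprime, so p
  divides at most one of them. The exponents of p in n, o', d' are at most 1, which leaves six
  pairs.\<close>

lemma special_multiplicities:
  fixes p :: int
  assumes "special S" "prime p"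
  shows "(multiplicity p (Omega S), multiplicity p (Delta S)) \<in> {(0,0),(0,1),(1,0),(1,1),(1,2),(2,1)}"
    and "multiplicity p (det S) = multiplicity p (Delta S) + 2 * multiplicity p (Omega S)"
    and "Omega S \<noteq> 0"
proof -
  have D: "det S = Delta S * (Omega S)^2" using assms det_Delta by (auto simp: special_def)
  have pos: "det S > 0" using assms by (simp add: special_def)
  then have nz: "Delta S \<noteq> 0" "Omega S \<noteq> 0" using D by auto
  show "Omega S \<noteq> 0" by fact
  show "multiplicity p (det S) = multiplicity p (Delta S) + 2 * multiplicity p (Omega S)"
  proof -
    have "prime_elem p" using assms(2) by (rule prime_imp_prime_elem)
    then have "multiplicity p (Delta S * (Omega S)^2) = multiplicity p (Delta S) + 2 * multiplicity p (Omega S)"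
      using nz by (simp only: prime_elem_multiplicity_mult_distrib prime_elem_multiplicity_power_distrib
        power_eq_0_iff not_False_eq_True simp_thms)
    then show ?thesis using D by simp
  qed
  define n where "n = NN S"
  have n: "n \<noteq> 0" "n dvd Omega S" "n dvd Delta S" using nz by (auto simp: n_def NN_def)
  have sq: "squarefree n" "squarefree (\<bar>Omega S\<bar> div n)" "squarefree (Delta S div n)"
    using assms by (simp_all add: special_def n_def)
  obtain o' d' where od: "\<bar>Omega S\<bar> = n * o'" "Delta S = n * d'"
    using n by (meson dvdE dvd_abs_iff)
  have od': "o' = \<bar>Omega S\<bar> div n" "d' = Delta S div n" using od n by simp_all
  have onz: "o' \<noteq> 0" "d' \<noteq> 0" using od nz by auto
  have le: "multiplicity p n \<le> 1" "multiplicity p o' \<le> 1" "multiplicity p d' \<le> 1"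
    using sq assms(2) onz n unfolding od'[symmetric] by (simp_all add: squarefree_factorial_semiring'')
  have "gcd o' d' = 1"
  proof -
    have "n = gcd \<bar>Omega S\<bar> (Delta S)" by (simp add: n_def NN_def)
    also have "\<dots> = gcd (n * o') (n * d')" unfolding od ..
    also have "\<dots> = \<bar>n\<bar> * gcd o' d'" by (simp add: gcd_mult_distrib_int)
    also have "\<bar>n\<bar> = n" by (simp add: n_def NN_def)
    finally show ?thesis using n(1) by simp
  qed
  then have "\<not> (p dvd o' \<and> p dvd d')"
    using assms(2) gcd_greatest[of p o' d'] by (auto dest: not_prime_unit)
  then have zero: "multiplicity p o' = 0 \<or> multiplicity p d' = 0"
    by (metis not_dvd_imp_multiplicity_0)
  have "multiplicity p (Omega S) = multiplicity p \<bar>Omega S\<bar>" by (simp add: abs_if)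
  also have "\<dots> = multiplicity p n + multiplicity p o'"
    unfolding od using n(1) onz
    by (intro prime_elem_multiplicity_mult_distrib prime_imp_prime_elem[OF assms(2)])
  finally have 1: "multiplicity p (Omega S) = multiplicity p n + multiplicity p o'" .
  have 2: "multiplicity p (Delta S) = multiplicity p n + multiplicity p d'"
    unfolding od using n(1) onz
    by (intro prime_elem_multiplicity_mult_distrib prime_imp_prime_elem[OF assms(2)])
  have "multiplicity p n \<in> {0,1}" "multiplicity p o' \<in> {0,1}" "multiplicity p d' \<in> {0,1}"
    using le by auto
  then show "(multiplicity p (Omega S), multiplicity p (Delta S)) \<in> {(0,0),(0,1),(1,0),(1,1),(1,2),(2,1)}"
    unfolding 1 2 using zero by (elim insertE emptyE disjE) simp_all
qed

lemma primitive_mat_nfc: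
  assumes "primitive_mat (nfc m a c d)" "prime p"
  shows "\<not> (p dvd m \<and> p dvd a \<and> p dvd c \<and> p dvd d)"
proof
  assume *: "p dvd m \<and> p dvd a \<and> p dvd c \<and> p dvd d"
  have "\<forall>i j. p dvd nfc m a c d $i$j" using * by (simp add: nfc_def forall_3)
  then have "p dvd Gcd {nfc m a c d $i$j | i j. True}" by (auto intro!: Gcd_greatest)
  then show False using assms by (auto simp: primitive_mat_def)
qed

text \<open>
  The pairs \<open>(\<omega>, \<psi>)\<close> below are those left by the square-freeness conditions. Since
  \<open>2 \<mu> + \<alpha> = \<psi> + 2 \<omega>\<close>, each of them leaves finitely many \<open>(\<mu>, \<alpha>)\<close>, and the minors
  together with primitivity exclude all but one.
\<close>
lemma nfc_local:
  fixes p :: int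
  assumes "special (nfc m a c d)" "m > 0" "a > 0" "prime p"
  defines "\<mu> \<equiv> multiplicity p m" and "\<alpha> \<equiv> multiplicity p a"
    and "\<omega> \<equiv> multiplicity p (Omega (nfc m a c d))" and "\<psi> \<equiv> multiplicity p (Delta (nfc m a c d))"
  shows "(\<mu> = 0 \<and> \<alpha> = 0 \<and> \<omega> = 0 \<and> \<psi> = 0) \<or> (\<mu> = 0 \<and> \<alpha> = 1 \<and> \<omega> = 0 \<and> \<psi> = 1) \<or>
    (\<mu> = 1 \<and> \<alpha> = 0 \<and> \<omega> = 1 \<and> \<psi> = 0 \<and> p dvd a * d + c^2) \<or>
    (\<mu> = 1 \<and> \<alpha> = 1 \<and> \<omega> = 1 \<and> \<psi> = 1 \<and> p dvd c \<and> \<not> p dvd d) \<or>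
    (\<mu> = 2 \<and> \<alpha> = 0 \<and> \<omega> = 1 \<and> \<psi> = 2 \<and> p dvd a * d + c^2 \<and> \<not> p^2 dvd a * d + c^2) \<or>
    (\<mu> = 1 \<and> \<alpha> = 3 \<and> \<omega> = 2 \<and> \<psi> = 1 \<and> p dvd c \<and> \<not> p dvd d)"
proof -
  note sp = special_multiplicities[OF assms(1) assms(4), folded \<omega>_def \<psi>_def]
  have pr: "prime_elem p" "\<not> is_unit p" using assms(4) by (auto simp: prime_imp_prime_elem)
  have "multiplicity p (m^2 * a) = 2 * \<mu> + \<alpha>"
    using assms(2,3) pr unfolding \<mu>_def \<alpha>_def
    by (simp add: prime_elem_multiplicity_mult_distrib prime_elem_multiplicity_power_distrib)
  then have eq: "2 * \<mu> + \<alpha> = \<psi> + 2 * \<omega>" using sp(2) by (simp add: det_nfc)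
  have m: "p ^ k dvd m \<longleftrightarrow> k \<le> \<mu>" and a: "p ^ k dvd a \<longleftrightarrow> k \<le> \<alpha>"
    and O: "p ^ k dvd Omega (nfc m a c d) \<longleftrightarrow> k \<le> \<omega>" for k
    using assms(2,3) sp(3) pr unfolding \<mu>_def \<alpha>_def \<omega>_def
    by (simp_all add: power_dvd_iff_le_multiplicity)
  note m1 = m[of 1, simplified] and a1 = a[of 1, simplified] and O1 = O[of 1, simplified, unfolded dvd_Omega_nfc_iff]
    and O2 = O[of 2, unfolded dvd_Omega_nfc_iff]
  have no_common: "\<not> (p dvd m \<and> p dvd a \<and> p dvd c \<and> p dvd d)"
    using assms(1,4) primitive_mat_nfc by (auto simp: special_def)
  have dsq: "p dvd x^2 \<longleftrightarrow> p dvd x" for x using assms(4) by (intro prime_dvd_power_iff) auto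
  have mu: "\<omega> \<ge> 1 \<Longrightarrow> \<mu> \<ge> 1" using O1 dsq m1 by simp
  have pc: "p dvd c" if "\<omega> \<ge> 1" "\<alpha> \<ge> 1"
  proof -
    have "p dvd a * d + c^2" "p dvd a" using that O1 a1 by auto
    then have "p dvd c^2" by (metis dvd_add_right_iff dvd_mult2)
    then show ?thesis using dsq by simp
  qed
  have nd: "\<not> p dvd d" if "\<omega> \<ge> 1" "\<alpha> \<ge> 1" using no_common pc that mu m1 a1 by auto
  consider "\<omega> = 0" "\<psi> \<le> 1" | "\<omega> = 1" "\<psi> = 0" | "\<omega> = 1" "\<psi> = 1" | "\<omega> = 1" "\<psi> = 2" | "\<omega> = 2" "\<psi> = 1"
    using sp(1) by auto
  then show ?thesis
  proof cases
    case 1 then show ?thesis using eq by auto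
  next
    case 2
    then have "\<mu> \<ge> 1" using mu by simp
    then have "\<mu> = 1" "\<alpha> = 0" using eq 2 by arith+
    then show ?thesis using 2 O1 by auto
  next
    case 3
    then have "\<mu> \<ge> 1" using mu by simp
    then have "\<mu> = 1" "\<alpha> = 1" using eq 3 by arith+
    then show ?thesis using 3 pc nd by auto
  next
    case 4
    have no: "\<not> (p^2 dvd m^2 \<and> p^2 dvd m*c \<and> p^2 dvd a*m \<and> p^2 dvd a*d + c^2)" using O2 4 by simp
    have "p dvd m" using mu 4 m1 by simp
    then have m2: "p^2 dvd m^2" by simp
    \<comment> \<open>With \<mu> = 1 the determinant gives \<alpha> = 2, and p^2 would divide every
      minor, against \<omega> = 1.\<close>
    have "\<mu> \<noteq> 1"
    proof
      assume "\<mu> = 1"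
      then have "\<alpha> = 2" using 4 eq by simp
      then have "p dvd c" "p^2 dvd a" using pc 4 a[of 2] by auto
      then have "p^2 dvd m * c" "p^2 dvd a*m" "p^2 dvd a*d + c^2"
        using \<open>p dvd m\<close> by (auto simp: power2_eq_square intro: mult_dvd_mono dvd_add)
      with no m2 show False by blast
    qed
    moreover have "\<mu> \<ge> 1" using mu 4 by simp
    ultimately have mu2: "\<mu> = 2" "\<alpha> = 0" using eq 4 by arith+
    then have "p^2 dvd m" using m[of 2] by simp
    then have "\<not> p^2 dvd a*d + c^2" using no m2 by auto
    then show ?thesis using mu2 4 O1 by auto
  next
    case 5
    have o2: "p^2 dvd a*d + c^2" using O2 5 by simp
    \<comment> \<open>With \<mu> = 2 the determinant gives \<alpha> = 1, so p divides c and p^2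
      would divide a d; but p divides a only once and does not divide d.\<close>
    have "\<mu> \<noteq> 2"
    proof
      assume "\<mu> = 2"
      then have al: "\<alpha> = 1" using 5 eq by simp
      then have "p dvd c" using pc 5 by auto
      then have "p^2 dvd c^2" by simp
      then have "p^2 dvd a * d" using o2 by (metis dvd_add_left_iff)
      have nz: "a * d \<noteq> 0" using nd al 5 assms(3) by auto
      have "multiplicity p (a * d) = multiplicity p a + multiplicity p d"
        using nz by (intro prime_elem_multiplicity_mult_distrib[OF pr(1)]) auto
      then have "multiplicity p (a * d) = 1"
        using nd al 5 unfolding \<alpha>_def by (simp add: not_dvd_imp_multiplicity_0)
      then show False using \<open>p^2 dvd a * d\<close> nz pr(2) by (simp add: power_dvd_iff_le_multiplicity)
    qed
    moreover have "\<mu> \<ge> 1" using mu 5 by simp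
    ultimately have "\<mu> = 1" "\<alpha> = 3" using eq 5 by arith+
    then show ?thesis using 5 pc nd by auto
  qed
qed

lemma primitive_vec_iff_unit: "primitive_vec x \<longleftrightarrow> (\<forall>k. (\<forall>i. k dvd x$i) \<longrightarrow> k dvd 1)"
proof
  assume "primitive_vec x"
  then show "\<forall>k. (\<forall>i. k dvd x$i) \<longrightarrow> k dvd 1"
    unfolding primitive_vec_iff by (metis gcd_greatest)
next
  assume *: "\<forall>k. (\<forall>i. k dvd x$i) \<longrightarrow> k dvd 1"
  have "gcd (x$1) (gcd (x$2) (x$3)) dvd x$i" for i
    using exhaust_3[of i] by (auto intro: dvd_trans[OF gcd_dvd2])
  then have "gcd (x$1) (gcd (x$2) (x$3)) dvd 1" using * by blast
  then show "primitive_vec x" unfolding primitive_vec_iff by simp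
qed

lemma primitive_vec_GL3Z:
  assumes "U \<in> GL3Z" "primitive_vec x" shows "primitive_vec (U *v x)"
  unfolding primitive_vec_iff_unit
proof (intro allI impI)
  fix k assume k: "\<forall>i. k dvd (U *v x)$i"
  obtain V where V: "V ** U = mat 1" using GL3Z_inverse[OF assms(1)] by metis
  have "x = V *v (U *v x)" by (simp add: matrix_vector_mul_assoc V)
  then have "x$i = (\<Sum>j\<in>UNIV. V$i$j * (U *v x)$j)" for i
    by (metis (no_types) matrix_vector_mult_def vec_lambda_beta)
  then have "k dvd x$i" for i using k by (auto intro!: dvd_sum)
  then show "k dvd 1" using assms(2) unfolding primitive_vec_iff_unit by blast
qed

lemma cone_GL3Z:
  assumes "U \<in> GL3Z"
  shows "U *v x \<in> cone S \<longleftrightarrow> x \<in> cone (transpose U ** S ** U)"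
proof -
  obtain V where V: "V \<in> GL3Z" "V ** U = mat 1" using GL3Z_inverse[OF assms] by metis
  have "x = V *v (U *v x)" by (simp add: matrix_vector_mul_assoc V)
  then have "primitive_vec (U *v x) \<longleftrightarrow> primitive_vec x"
    using primitive_vec_GL3Z V(1) assms by metis
  then show ?thesis by (simp add: cone_def qf_mult)
qed

lemma special_congr:
  assumes "special S" "U \<in> GL3Z" shows "special (transpose U ** S ** U)"
proof -
  obtain x where x: "x \<in> cone S" using assms(1) by (auto simp: special_def isotropic_def cone_def)
  obtain V where V: "U ** V = mat 1" using GL3Z_inverse[OF assms(2)] by metis
  have "U *v (V *v x) = x" by (simp add: matrix_vector_mul_assoc V)
  then have c: "V *v x \<in> cone (transpose U ** S ** U)" using x cone_GL3Z[OF assms(2)] by metis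
  have "det (transpose U ** S ** U) = (det U * det U) * det S" by (simp add: det_mul)
  then have "det (transpose U ** S ** U) > 0"
    using assms det_GL3Z[OF assms(2)] by (simp add: special_def)
  then show ?thesis
    using special_locally_equiv[OF assms(1) locally_equiv_GL3Z[OF assms(2)] _ _ c] assms(1)
    by (simp add: special_def sym_mat_congr)
qed

text \<open>The cases of \<open>nfc_local\<close> for c = 0. Where the minor a d is constrained, p
  does not divide a, so the constraint passes to d.\<close>

lemma nf_local:
  fixes p :: int
  assumes "special (nf m a d)" "m > 0" "a > 0" "prime p"
  defines "\<mu> \<equiv> multiplicity p m" and "\<alpha> \<equiv> multiplicity p a"
  obtains "\<mu> = 0" "\<alpha> = 0" | "\<mu> = 0" "\<alpha> = 1"
    | "\<mu> = 1" "\<alpha> = 0" "p dvd d" | "\<mu> = 1" "\<alpha> = 1" "\<not> p dvd d"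
    | "\<mu> = 2" "\<alpha> = 0" "p dvd d" "\<not> p^2 dvd d" | "\<mu> = 1" "\<alpha> = 3" "\<not> p dvd d"
proof -
  have pa: "\<not> p dvd a" if "multiplicity p a = 0"
    using that assms(3,4) by (metis less_irrefl multiplicity_eq_zero_iff not_prime_unit)
  have d: "p dvd d" if "multiplicity p a = 0" "p dvd a * d"
    using that pa assms(4) prime_dvd_mult_iff by blast
  have d2: "\<not> p^2 dvd d" if "\<not> p^2 dvd a * d" using that by auto
  have "(\<mu> = 0 \<and> \<alpha> = 0) \<or> (\<mu> = 0 \<and> \<alpha> = 1) \<or> (\<mu> = 1 \<and> \<alpha> = 0 \<and> p dvd a * d) \<or>
    (\<mu> = 1 \<and> \<alpha> = 1 \<and> \<not> p dvd d) \<or> (\<mu> = 2 \<and> \<alpha> = 0 \<and> p dvd a * d \<and> \<not> p^2 dvd a * d) \<or>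
    (\<mu> = 1 \<and> \<alpha> = 3 \<and> \<not> p dvd d)"
    using nfc_local[OF assms(1-4)] unfolding \<mu>_def \<alpha>_def by (elim disjE conjE) simp_all
  then show ?thesis using that d d2 unfolding \<mu>_def \<alpha>_def by blast
qed

text \<open>Unipotent base changes fixing e1 alter c by multiples of a and of m, so c can be cleared
  once gcd a m divides it.\<close>

lemma nf_exists:
  assumes "special S" "x \<in> cone S"
  obtains U m a d where "U \<in> GL3Z" "U *v e1 = x" "m > 0" "a > 0" "transpose U ** S ** U = nf m a d"
proof -
  obtain U m a c d where U: "U \<in> GL3Z" "U *v e1 = x" "m > 0" "a > 0" "transpose U ** S ** U = nfc m a c d"
    using nfc_exists assms unfolding special_def by metis
  have sp: "special (nfc m a c d)" using special_congr[OF assms(1) U(1)] U(5) by simp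
  \<comment> \<open>In the cases of \<open>nfc_local\<close> where p divides both a and m, the
    exponent of p in m is 1 and p divides c.\<close>
  have "gcd a m dvd c"
  proof (rule prime_power_dvd_imp_dvd)
    fix p :: int and k assume p: "prime p" and "p ^ k dvd gcd a m"
    then have "p ^ k dvd a" "p ^ k dvd m" by auto
    then have k: "k \<le> multiplicity p a" "k \<le> multiplicity p m"
      using U(3,4) p by (auto intro!: multiplicity_geI)
    show "p ^ k dvd c"
    proof (cases "k = 0")
      case False
      then have "p dvd c \<and> k = 1" using nfc_local[OF sp U(3,4) p] k by (elim disjE conjE) simp_all
      then show ?thesis by simp
    qed simp
  qed
  then obtain c' where c': "c = gcd a m * c'" by blast
  obtain t s where ts: "t * a + s * m = gcd a m" using bezout_int by blast
  define W :: imat3 where "W = vector [vector [1, - s * c', 0], vector [0, 1, t * c'], vector [0, 0, 1]]"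
  have W: "W \<in> GL3Z" by (simp add: W_def GL3Z_iff det_3)
  have "c - a * (t * c') + (- s * c') * m = 0" unfolding c' ts[symmetric] by (simp add: algebra_simps)
  then have "transpose W ** nfc m a c d ** W = nf m a (d - a * (t*c')^2 + 2 * c * (t*c'))"
    by (simp add: W_def nfc_def mat3_simps power2_eq_square) (simp add: algebra_simps)
  then have "transpose (U ** W) ** S ** (U ** W) = nf m a (d - a * (t*c')^2 + 2 * c * (t*c'))"
    by (simp add: congr_mult U(5))
  moreover have "W *v e1 = e1" by (simp add: W_def e1_def mat3_simps)
  then have "(U ** W) *v e1 = x" using U(2) by (simp flip: matrix_vector_mul_assoc)
  ultimately show ?thesis using that[OF GL3Z_mult[OF U(1) W] _ U(3,4)] by blast
qed

text \<open>The six cases of \<open>nfc_local\<close> have distinct pairs (\<omega>, \<psi>), so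
  Omega and Delta determine the exponent of every prime in m; the determinant then determines
  a.\<close>

lemma nf_unique:
  assumes sp: "special (nf m a d)" "special (nf m' a' d')" and pos: "m > 0" "a > 0" "m' > 0" "a' > 0"
    and eq: "Omega (nf m a d) = Omega (nf m' a' d')" "det (nf m a d) = det (nf m' a' d')"
  shows "m = m' \<and> a = a'"
proof -
  have D: "Delta (nf m a d) = Delta (nf m' a' d')" using eq by (simp add: Delta_def)
  have "multiplicity p m = multiplicity p m'" if p: "prime p" for p
    using nfc_local[OF sp(1) pos(1,2) p] nfc_local[OF sp(2) pos(3,4) p] eq(1) D by auto
  then have "m = m'" using pos by (intro multiplicity_eq_int) auto
  then show ?thesis using eq(2) pos by (simp add: det_nfc)
qed

subsection \<open>Normal forms in the same genus\<close>

text \<open>Here x and y are the second and third columns of the transforming matrix. The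
  congruences express the norm of y, the orthogonality of x and y, and the norm of x.\<close>

lemma mod_equiv_nf_columns:
  assumes "mod_equiv q (nf m a d) (nf m a d')"
  obtains x2 x3 y2 y3 x1 y1 where
    "[- a * y2^2 + 2 * m * (y1 * y3) + d * y3^2 = d'] (mod q)"
    "[- a * x2 * y2 + m * (x1 * y3 + x3 * y1) + d * (x3 * y3) = 0] (mod q)"
    "[- a * x2^2 + 2 * m * (x1 * x3) + d * x3^2 = - a] (mod q)"
proof -
  obtain A where A: "mcong q (transpose A ** nf m a d ** A) (nf m a d')" using assms unfolding mod_equiv_def by blast
  let ?x = "\<lambda>i. A$i$2" and ?y = "\<lambda>i. A$i$3"
  have "(transpose A ** nf m a d ** A)$3$3 = - a * (?y 2)^2 + 2 * m * (?y 1 * ?y 3) + d * (?y 3)^2"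
    "(transpose A ** nf m a d ** A)$2$3 = - a * ?x 2 * ?y 2 + m * (?x 1 * ?y 3 + ?x 3 * ?y 1) + d * (?x 3 * ?y 3)"
    "(transpose A ** nf m a d ** A)$2$2 = - a * (?x 2)^2 + 2 * m * (?x 1 * ?x 3) + d * (?x 3)^2"
    by (simp_all add: mat3_simps nfc_def power2_eq_square algebra_simps)
  moreover have "nf m a d'$3$3 = d'" "nf m a d'$2$3 = 0" "nf m a d'$2$2 = - a" by (simp_all add: nfc_def)
  ultimately show ?thesis using A that unfolding mcong_def by metis
qed

text \<open>Modulo a divisor of 2 m the hyperbolic term of the norm vanishes, so d' is represented
  by the binary form - a y2^2 + d y3^2.\<close>

lemma mod_equiv_nf_corner:
  assumes "mod_equiv q (nf m a d) (nf m a d')" "q dvd 2 * m"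
  obtains y2 y3 where "[- a * y2^2 + d * y3^2 = d'] (mod q)"
proof -
  obtain y1 y2 y3 where y: "[- a * y2^2 + 2 * m * (y1 * y3) + d * y3^2 = d'] (mod q)"
    using mod_equiv_nf_columns[OF assms(1)] by metis
  have "[- a * y2^2 + d * y3^2 = - a * y2^2 + 2 * m * (y1 * y3) + d * y3^2] (mod q)"
    using assms(2) by (simp add: cong_iff_dvd_diff)
  then show ?thesis using that cong_trans[OF _ y] by blast
qed

lemma mod_equiv_nf_even:
  assumes "mod_equiv 2 (nf m a d) (nf m a d')" "even a" "even d" shows "even d'"
proof -
  obtain y2 y3 where "[- a * y2^2 + d * y3^2 = d'] (mod 2)"
    using mod_equiv_nf_corner[OF assms(1)] by auto
  moreover have "even (- a * y2^2 + d * y3^2)" using assms by simp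
  ultimately show ?thesis by (metis cong_dvd_iff)
qed

text \<open>Since a is odd while d and d' are even, y2 is forced to be even, and its square vanishes
  modulo 4. This serves the prime 2 when it divides m exactly once.\<close>

lemma mod_equiv_nf_four:
  assumes "mod_equiv 4 (nf m a d) (nf m a d')" "even m" "odd a" "even d'" "4 dvd d" shows "4 dvd d'"
proof -
  have "4 dvd 2 * m" using assms(2) by auto
  then obtain y2 y3 where y: "[- a * y2^2 + d * y3^2 = d'] (mod 4)"
    using mod_equiv_nf_corner[OF assms(1)] by auto
  then have "[- a * y2^2 + d * y3^2 = d'] (mod 2)" by (rule cong_dvd_modulus) simp
  then have "even (- a * y2^2 + d * y3^2)" using assms(4) by (metis cong_dvd_iff)
  moreover have "even d" using assms(5) by (meson dvd_trans even_numeral)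
  ultimately have "even y2" using assms(3) by auto
  then have "4 dvd y2^2" by (auto elim!: evenE simp: power2_eq_square)
  then have "4 dvd - a * y2^2 + d * y3^2" using assms(5) by (intro dvd_add) auto
  then show ?thesis using y by (metis cong_dvd_iff)
qed

lemma odd_square_mod_8: "odd (x::int) \<Longrightarrow> [x^2 = 1] (mod 8)"
proof -
  assume "odd x"
  then have "x mod 8 = 1 \<or> x mod 8 = 3 \<or> x mod 8 = 5 \<or> x mod 8 = 7" by presburger
  then show ?thesis unfolding cong_def power_mod[of x 8, symmetric] by auto
qed

text \<open>Used at the prime 2 when m has exponent 2, where the corner matters modulo 8. As 8
  divides 2 m, the norm of y reads d' = - a y2^2 + d y3^2 modulo 8, and y2 = 2 s is even. The point
  is to show that s is even too, so that the first term vanishes.\<close>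

lemma mod_equiv_nf_eight:
  assumes "mod_equiv 8 (nf m a d) (nf m a d')" "4 dvd m" "odd a" "even d" "\<not> 4 dvd d" "even d'" "\<not> 4 dvd d'"
  shows "\<exists>w. odd w \<and> [d' = w^2 * d] (mod 8)"
proof -
  obtain x2 x3 y2 y3 x1 y1 where
    yy: "[- a * y2^2 + 2 * m * (y1 * y3) + d * y3^2 = d'] (mod 8)" and
    xy: "[- a * x2 * y2 + m * (x1 * y3 + x3 * y1) + d * (x3 * y3) = 0] (mod 8)" and
    xx: "[- a * x2^2 + 2 * m * (x1 * x3) + d * x3^2 = - a] (mod 8)"
    using mod_equiv_nf_columns[OF assms(1)] by metis
  obtain m' where m': "m = 4 * m'" using assms(2) by auto
  obtain d1 where d1: "d = 2 * d1" "odd d1" using assms(4,5)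
    by (metis dvd_def mult.assoc mult_2 numeral_Bit0 mult_2_right)
  obtain d1' where d1': "d' = 2 * d1'" using assms(6) by auto
  have yy8: "8 dvd - a * y2^2 + 8 * (m' * (y1 * y3)) + 2 * d1 * y3^2 - 2 * d1'"
    using yy unfolding cong_iff_dvd_diff m' d1 d1' by (simp add: algebra_simps)
  then have "2 dvd - a * y2^2 + 8 * (m' * (y1 * y3)) + 2 * d1 * y3^2 - 2 * d1'" by (rule dvd_trans[rotated]) simp
  then have "even (a * y2^2)" by simp
  then have "even y2" using assms(3) by simp
  then obtain s where s: "y2 = 2 * s" by auto
  \<comment> \<open>The norm of y does not exclude an odd s. But for odd s the orthogonality
    relation makes x2 and x3 y3 of equal parity, and the norm of x makes x2 odd, so x3 is odd as
    well. As odd squares are 1 modulo 8, the norm of x then gives 2 d1 = 0 modulo 8, although d1 is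
    odd.\<close>
  have "even s"
  proof (rule ccontr)
    assume "odd s"
    have "8 dvd - a * x2 * (2 * s) + 4 * m' * (x1 * y3 + x3 * y1) + 2 * d1 * (x3 * y3)"
      using xy unfolding cong_0_iff m' d1 s .
    then have "4 dvd - a * x2 * (2 * s) + 4 * m' * (x1 * y3 + x3 * y1) + 2 * d1 * (x3 * y3)"
      by (rule dvd_trans[rotated]) simp
    then have "2 * 2 dvd 2 * (- a * x2 * s + 2 * m' * (x1 * y3 + x3 * y1) + d1 * (x3 * y3))"
      by (simp add: algebra_simps)
    then have "even (- a * x2 * s + 2 * m' * (x1 * y3 + x3 * y1) + d1 * (x3 * y3))"
      by (simp only: dvd_mult_cancel_left) simp
    then have par: "even (x2 - x3 * y3)" using assms(3) \<open>odd s\<close> d1(2) by auto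
    have xx8: "8 dvd - a * x2^2 + 8 * (m' * (x1 * x3)) + 2 * d1 * x3^2 + a"
      using xx unfolding cong_iff_dvd_diff m' d1 by (simp add: algebra_simps)
    then have "2 dvd - a * x2^2 + 8 * (m' * (x1 * x3)) + 2 * d1 * x3^2 + a" by (rule dvd_trans[rotated]) simp
    then have ox: "odd x2" using assms(3) by simp
    then have "odd x3" using par by auto
    from odd_square_mod_8[OF ox] obtain k where k: "x2^2 = 1 + 8 * k"
      by (metis cong_iff_lin cong_sym)
    from odd_square_mod_8[OF \<open>odd x3\<close>] obtain l where l: "x3^2 = 1 + 8 * l"
      by (metis cong_iff_lin cong_sym)
    have "- a * x2^2 + 8 * (m' * (x1 * x3)) + 2 * d1 * x3^2 + a = 8 * (- a * k + m' * (x1 * x3) + 2 * d1 * l) + 2 * d1"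
      unfolding k l by (simp add: algebra_simps)
    then have "8 dvd 2 * d1" using xx8 by (metis dvd_add_right_iff dvd_triv_left)
    then show False using d1(2) by presburger
  qed
  then obtain r where r: "s = 2 * r" by auto
  have "- a * y2^2 + 8 * (m' * (y1 * y3)) + 2 * d1 * y3^2 - 2 * d1'
     = 8 * (- 2 * a * r^2 + m' * (y1 * y3)) + (y3^2 * d - d')"
    unfolding s r d1 d1' by (simp add: power2_eq_square algebra_simps)
  then have c: "8 dvd y3^2 * d - d'" using yy8 by (metis dvd_add_right_iff dvd_triv_left)
  have "odd y3"
  proof
    assume "even y3"
    then have "4 dvd y3^2 * d" by (auto elim!: evenE simp: power2_eq_square)
    moreover have "4 dvd y3^2 * d - d'" using c by (rule dvd_trans[rotated]) simp
    ultimately have "4 dvd d'" using dvd_diff[of 4 "y3^2 * d" "y3^2 * d - d'"] by simp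
    then show False using assms(7) by simp
  qed
  moreover have "[d' = y3^2 * d] (mod 8)" using c by (simp add: cong_iff_dvd_diff dvd_diff_commute)
  ultimately show ?thesis by blast
qed

lemma multiplicity_double:
  assumes "prime p" "(m::int) \<noteq> 0"
  shows "multiplicity p (2 * m) = (if p = 2 then 1 else 0) + multiplicity p m"
proof -
  have "multiplicity p (2 * m) = multiplicity p 2 + multiplicity p m"
    using assms by (intro prime_elem_multiplicity_mult_distrib prime_imp_prime_elem) auto
  moreover have "multiplicity p 2 = (if p = 2 then 1 else 0)"
    using assms(1) by (auto intro: prime_multiplicity_other)
  ultimately show ?thesis by simp
qed

text \<open>The two freedoms in d at one prime: the square of a unit w, and the shear by t of
  \<open>nf_shift\<close>, which requires m to divide a t. A nonzero t is called for only at the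
  prime 2, when the exponents of m and a are both 0 or both 1.\<close>

lemma nf_genus_local:
  fixes p :: int
  assumes sp: "special (nf m a d)" "special (nf m a d')" and pos: "m > 0" "a > 0"
    and eq: "locally_equiv (nf m a d) (nf m a d')" and p: "prime p"
  shows "\<exists>w t. \<not> p dvd w \<and> p ^ multiplicity p m dvd a * t \<and> [d' = w^2 * d - a * t^2] (mod p ^ multiplicity p (2 * m))"
proof -
  define q where "q = p ^ multiplicity p (2 * m)"
  have q2m: "q dvd 2 * m" unfolding q_def by (rule multiplicity_dvd)
  have eq: "mod_equiv (p ^ k) (nf m a d) (nf m a d')" "mod_equiv (p ^ k) (nf m a d') (nf m a d)" for k
    using eq p mod_equiv_sym unfolding locally_equiv_def by auto
  have mult: "multiplicity p (2 * m) = (if p = 2 then 1 else 0) + multiplicity p m"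
    using p pos by (intro multiplicity_double) auto
  have dvda: "p ^ k dvd a \<longleftrightarrow> k \<le> multiplicity p a" and dvdm: "p ^ k dvd m \<longleftrightarrow> k \<le> multiplicity p m" for k
    using pos p by (auto simp: power_dvd_iff_le_multiplicity)
  have np: "\<not> p dvd 1" "p \<noteq> 0" using p not_prime_unit by auto
  have easy: ?thesis if "\<not> p dvd w" "[d' = w^2 * d] (mod q)" for w
    using that by (intro exI[of _ w] exI[of _ 0]) (simp add: q_def)
  \<comment> \<open>If the p-part q of 2 m divides a, the term a y2^2 vanishes modulo q, and y3 is
    prime to p because d' is.\<close>
  have unit: ?thesis if "q dvd a" "\<not> p dvd d'" "p dvd q"
  proof -
    obtain y2 y3 where y: "[- a * y2^2 + d * y3^2 = d'] (mod q)"
      using mod_equiv_nf_corner[OF eq(1) q2m[unfolded q_def]] unfolding q_def by metis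
    then have c: "[d' = y3^2 * d] (mod q)"
      using that(1) by (simp add: cong_iff_dvd_diff) (smt (verit) dvd_diff_commute dvd_add_right_iff dvd_minus_iff dvd_mult2 mult.commute)
    then have "[d' = y3^2 * d] (mod p)" using that(3) by (rule cong_dvd_modulus)
    then have "\<not> p dvd y3" using that(2) by (metis cong_dvd_iff dvd_mult2 dvd_power zero_less_numeral dvd_trans)
    then show ?thesis using easy c by blast
  qed
  show ?thesis
  proof (cases "p = 2")
    case False
    then have q: "q = p ^ multiplicity p m" by (simp add: q_def mult)
    show ?thesis
    proof (rule nf_local[OF sp(2) pos p])
      assume "multiplicity p m = 0" "multiplicity p a = 0" then show ?thesis using easy[of 1] np q by simp
    next
      assume "multiplicity p m = 0" "multiplicity p a = 1" then show ?thesis using easy[of 1] np q by simp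
    next
      assume h: "multiplicity p m = 1" "multiplicity p a = 0" "p dvd d'"
      then have "p dvd d" by (cases rule: nf_local[OF sp(1) pos p]) auto
      then show ?thesis using easy[of 1] np q h by (simp add: cong_iff_dvd_diff)
    next
      assume h: "multiplicity p m = 1" "multiplicity p a = 1" "\<not> p dvd d'"
      show ?thesis using unit h q dvda[of 1] by simp
    next
      assume h: "multiplicity p m = 1" "multiplicity p a = 3" "\<not> p dvd d'"
      show ?thesis using unit h q dvda[of 1] by simp
    next
      assume h: "multiplicity p m = 2" "multiplicity p a = 0" "p dvd d'" "\<not> p^2 dvd d'"
      then have d: "p dvd d" by (cases rule: nf_local[OF sp(1) pos p]) auto
      have q: "q = p^2" using q h by simp
      \<comment> \<open>As p divides d and d' but not a, it divides y2, so a y2^2 vanishes modulo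
        p^2. And p cannot divide y3, since p^2 does not divide d'.\<close>
      obtain y2 y3 where y: "[- a * y2^2 + d * y3^2 = d'] (mod p^2)"
        using mod_equiv_nf_corner[OF eq(1)[of 2]] q2m q by metis
      then have "[- a * y2^2 + d * y3^2 = d'] (mod p)" by (rule cong_dvd_modulus) simp
      then have "p dvd - a * y2^2 + d * y3^2" using h(3) cong_dvd_iff by metis
      then have "p dvd a * y2^2" using d by (metis dvd_add_left_iff dvd_minus_iff dvd_mult2 mult_minus_left)
      moreover have "\<not> p dvd a" using dvda[of 1] h by simp
      ultimately have "p dvd y2" using p prime_dvd_mult_iff prime_dvd_power by blast
      then have "p^2 dvd a * y2^2" by simp
      then have c: "[d' = y3^2 * d] (mod p^2)"
        using y by (simp add: cong_iff_dvd_diff) (smt (verit) dvd_diff_commute dvd_add_right_iff dvd_minus_iff mult.commute)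
      have "\<not> p dvd y3"
      proof
        assume "p dvd y3"
        then have "p^2 dvd y3^2 * d" by simp
        then show False using h(4) c by (metis cong_dvd_iff)
      qed
      then show ?thesis using easy c q by blast
    qed
  next
    case True
    then have q: "q = 2 ^ (1 + multiplicity 2 m)" unfolding q_def mult using True by simp
    note p2 = p[unfolded True]
    show ?thesis
    proof (rule nf_local[OF sp(2) pos p2])
      assume h: "multiplicity 2 m = 0" "multiplicity 2 a = 0"
      then have "odd a" using dvda[of 1] True by simp
      \<comment> \<open>Since a is odd, the shear by t = d - d' changes the parity of d exactly when
        d and d' differ in parity.\<close>
      then have "even (d' - (1^2 * d - a * (d - d')^2))" by auto
      then show ?thesis
        using h q unfolding q_def True
        by (intro exI[of _ 1] exI[of _ "d - d'"]) (simp add: cong_iff_dvd_diff)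
    next
      assume h: "multiplicity 2 m = 0" "multiplicity 2 a = 1"
      then have "even a" using dvda[of 1] True by simp
      then have "even d \<longleftrightarrow> even d'" using mod_equiv_nf_even eq[of 1] True by auto
      then have "even (d' - d)" by simp
      then show ?thesis using easy[of 1] h q True by (simp add: cong_iff_dvd_diff)
    next
      assume h: "multiplicity 2 m = 1" "multiplicity 2 a = 0" "2 dvd d'"
      then have "even d" by (cases rule: nf_local[OF sp(1) pos p2]) auto
      moreover have "odd a" "even m" using dvda[of 1] dvdm[of 1] True h by auto
      ultimately have "4 dvd d \<longleftrightarrow> 4 dvd d'" using mod_equiv_nf_four eq[of 2] True h(3) by auto
      then have "4 dvd d' - d" using h(3) \<open>even d\<close> by presburger
      then show ?thesis using easy[of 1] h q True by (simp add: cong_iff_dvd_diff)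
    next
      assume h: "multiplicity 2 m = 1" "multiplicity 2 a = 1" "\<not> 2 dvd d'"
      then have "odd d" by (cases rule: nf_local[OF sp(1) pos p2]) auto
      \<comment> \<open>The modulus is 4. With t = (d - d') / 2 and a = 2 a0, a0 odd, the two sides
        differ by 2 t (1 - a0 t) up to sign, and one of t, 1 - a0 t is even.\<close>
      then have "even (d - d')" using h(3) by simp
      then obtain t where t: "d - d' = 2 * t" by (rule evenE)
      have "2 ^ 1 dvd a" "\<not> 2 ^ 2 dvd a" using dvda[of 1] dvda[of 2] True h(2) by auto
      then obtain a0 where a0: "a = 2 * a0" "odd a0"
        by (metis dvd_def mult.assoc power2_eq_square power_one_right)
      have "d' - (1^2 * d - a * t^2) = - (2 * (t * (1 - a0 * t)))"
        using t by (simp add: a0(1) power2_eq_square algebra_simps)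
      moreover have "even (t * (1 - a0 * t))" using a0(2) by auto
      ultimately have "2 * 2 dvd d' - (1^2 * d - a * t^2)" by (metis dvd_minus_iff dvd_refl mult_dvd_mono)
      then show ?thesis
        using h(1) a0(1) q unfolding q_def True
        by (intro exI[of _ 1] exI[of _ t]) (simp add: cong_iff_dvd_diff)
    next
      assume h: "multiplicity 2 m = 1" "multiplicity 2 a = 3" "\<not> 2 dvd d'"
      then have "q = 4" using q by simp
      moreover have "4 dvd a" using dvda[of 2] True h by simp
      ultimately show ?thesis using unit h True by simp
    next
      assume h: "multiplicity 2 m = 2" "multiplicity 2 a = 0" "2 dvd d'" "\<not> 2^2 dvd d'"
      then have "even d" "\<not> 2^2 dvd d" by (cases rule: nf_local[OF sp(1) pos p2]; auto)+
      moreover have "odd a" "4 dvd m" using dvda[of 1] dvdm[of 2] True h by auto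
      ultimately obtain w where "odd w" "[d' = w^2 * d] (mod 8)"
        using mod_equiv_nf_eight[of m a d d'] eq(1)[of 3] True h(3,4) by auto
      then show ?thesis using easy[of w] h q True by simp
    qed
  qed
qed

section \<open>From local to global solutions\<close>

lemma gcd_prime_power_dvd:
  fixes p x :: int
  assumes "prime p" "x \<noteq> 0"
  shows "gcd (p ^ k) x dvd p ^ multiplicity p x"
proof -
  obtain y where y: "x = p ^ multiplicity p x * y" "\<not> p dvd y"
  proof -
    have "\<not> is_unit p" using assms not_prime_unit by auto
    from multiplicity_decompose'[OF assms(2) this] show ?thesis using that by blast
  qed
  have "coprime (p ^ k) y" using assms(1) y(2) prime_imp_coprime coprime_power_left_iff by blast
  then have "coprime (gcd (p ^ k) x) y" using coprime_divisors dvd_refl gcd_dvd1 by blast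
  moreover have "gcd (p ^ k) x dvd p ^ multiplicity p x * y" using y(1) by (metis gcd_dvd2)
  ultimately show ?thesis by (simp add: coprime_dvd_mult_left_iff)
qed

text \<open>Induction on n, splitting off the full power of one prime and gluing w and t by the
  Chinese remainder theorem. The gcds with n restrict the claim to the part of m seen by n. That w
  is prime to all of n, not only to 2 m, matters because \<open>kappa_scale\<close> inverts it
  modulo \<open>residue_modulus\<close>.\<close>

lemma patch_local_solutions:
  fixes a d d' m :: int
  assumes m: "m > 0" and loc: "\<And>p. prime p \<Longrightarrow> \<exists>w t. \<not> p dvd w \<and> p ^ multiplicity p m dvd a * t \<and>
     [d' = w^2 * d - a * t^2] (mod p ^ multiplicity p (2 * m))"
  assumes "n > 0"
  shows "\<exists>w t. coprime w n \<and> gcd n m dvd a * t \<and> [d' = w^2 * d - a * t^2] (mod gcd n (2 * m))"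
  using \<open>n > 0\<close>
proof (induction "nat n" arbitrary: n rule: less_induct)
  case less
  show ?case
  proof (cases "n = 1")
    case True then show ?thesis by (intro exI[of _ 1] exI[of _ 0]) simp
  next
    case False
    then obtain p where p: "prime p" "p dvd n" using less.prems prime_divisor_exists[of n] by auto
    define k where "k = multiplicity p n"
    obtain n' where n': "n = p ^ k * n'" "\<not> p dvd n'"
    proof -
      have "n \<noteq> 0" "\<not> is_unit p" using less.prems p not_prime_unit by auto
      from multiplicity_decompose'[OF this] show ?thesis using that unfolding k_def by blast
    qed
    have p0: "p > 1" using p(1) prime_gt_1_int by blast
    have k0: "k > 0" using n' p by (cases k) auto
    have n'0: "n' > 0" using n' less.prems p0 by (simp add: zero_less_mult_iff)
    have "p ^ k > 1" using p0 k0 by (simp add: one_less_power)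
    then have "n' < n" using n' n'0 by simp
    then obtain w1 t1 where 1: "coprime w1 n'" "gcd n' m dvd a * t1"
      "[d' = w1^2 * d - a * t1^2] (mod gcd n' (2 * m))"
      using less.hyps[of n'] n'0 by auto
    obtain w2 t2 where 2: "\<not> p dvd w2" "p ^ multiplicity p m dvd a * t2"
      "[d' = w2^2 * d - a * t2^2] (mod p ^ multiplicity p (2 * m))" using loc[OF p(1)] by blast
    have cop: "coprime (p ^ k) n'" using p(1) n'(2) prime_imp_coprime coprime_power_left_iff by blast
    obtain w where w: "[w = w2] (mod p ^ k)" "[w = w1] (mod n')" using binary_chinese_remainder_int[OF cop] by blast
    obtain t where t: "[t = t2] (mod p ^ k)" "[t = t1] (mod n')" using binary_chinese_remainder_int[OF cop] by blast
    have "coprime w2 (p ^ k)" using p(1) 2(1) prime_imp_coprime by (metis coprime_commute coprime_power_right_iff)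
    then have cw: "coprime w n"
      using w 1(1) unfolding n'(1) by (metis cong_imp_coprime cong_sym coprime_mult_right_iff)
    \<comment> \<open>A divisor of p^k n' is a divisor of p^k times a divisor of n', so the moduli
      for n are covered by the coprime moduli for p^k and n'.\<close>
    have gg: "gcd n x dvd gcd (p ^ k) x * gcd n' x" for x
    proof -
      have "gcd n x dvd p ^ k * n'" using n'(1) gcd_dvd1 by metis
      then obtain b c where "gcd n x = b * c" "b dvd p ^ k" "c dvd n'" using division_decomp by blast
      moreover have "b dvd x" "c dvd x" using \<open>gcd n x = b * c\<close>
        by (metis dvd_mult_left dvd_mult_right gcd_dvd2)+
      ultimately show ?thesis by (metis gcd_greatest mult_dvd_mono)
    qed
    have cg: "coprime (gcd (p ^ k) x) (gcd n' x)" for x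
      using cop coprime_divisors[OF gcd_dvd1 gcd_dvd1] by blast
    have "[a * t = a * t2] (mod gcd (p ^ k) m)"
      by (rule cong_dvd_modulus[OF cong_scalar_left[OF t(1)] gcd_dvd1])
    moreover have "gcd (p ^ k) m dvd a * t2"
      using gcd_prime_power_dvd[OF p(1)] m 2(2) dvd_trans by (metis less_irrefl)
    ultimately have a1: "gcd (p ^ k) m dvd a * t" by (simp add: cong_dvd_iff)
    have "[a * t = a * t1] (mod gcd n' m)"
      by (rule cong_dvd_modulus[OF cong_scalar_left[OF t(2)] gcd_dvd1])
    then have a2: "gcd n' m dvd a * t" using 1(2) by (simp add: cong_dvd_iff)
    have "[w^2 * d - a * t^2 = w2^2 * d - a * t2^2] (mod p ^ k)"
      by (intro cong_diff cong_mult cong_pow w t cong_refl)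
    then have "[w^2 * d - a * t^2 = w2^2 * d - a * t2^2] (mod gcd (p ^ k) (2 * m))"
      by (rule cong_dvd_modulus) simp
    moreover have "[d' = w2^2 * d - a * t2^2] (mod gcd (p ^ k) (2 * m))"
      using 2(3) by (rule cong_dvd_modulus) (use gcd_prime_power_dvd[OF p(1)] m in simp)
    ultimately have c1: "[d' = w^2 * d - a * t^2] (mod gcd (p ^ k) (2 * m))"
      by (metis cong_sym cong_trans)
    have "[w^2 * d - a * t^2 = w1^2 * d - a * t1^2] (mod n')"
      by (intro cong_diff cong_mult cong_pow w t cong_refl)
    then have "[w^2 * d - a * t^2 = w1^2 * d - a * t1^2] (mod gcd n' (2 * m))"
      by (rule cong_dvd_modulus) simp
    then have c2: "[d' = w^2 * d - a * t^2] (mod gcd n' (2 * m))"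
      using 1(3) by (metis cong_sym cong_trans)
    have "gcd n m dvd a * t" using divides_mult[OF a1 a2 cg] gg dvd_trans by blast
    moreover have "[d' = w^2 * d - a * t^2] (mod gcd n (2 * m))"
      using coprime_cong_mult[OF c1 c2 cg] gg cong_dvd_modulus by blast
    ultimately show ?thesis using cw by blast
  qed
qed

lemma nf_genus_global:
  assumes "special (nf m a d)" "special (nf m a d')" "m > 0" "a > 0"
    "locally_equiv (nf m a d) (nf m a d')" "R > 0" "2 * m dvd R"
  obtains w t where "coprime w R" "m dvd a * t" "[d' = w^2 * d - a * t^2] (mod 2 * m)"
proof -
  have "\<exists>w t. coprime w R \<and> gcd R m dvd a * t \<and> [d' = w^2 * d - a * t^2] (mod gcd R (2 * m))"
    using assms by (intro patch_local_solutions nf_genus_local) auto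
  moreover have "gcd R m = m" "gcd R (2 * m) = 2 * m"
    using assms(3,7) by (simp_all add: gcd_proj2_iff dvd_mult_right)
  ultimately show ?thesis using that by metis
qed

subsection \<open>Lattice points in ellipses\<close>

text \<open>The half-open square of side R with corner z. Its translates to all points of one
  residue class modulo R tile the plane, so counting these points amounts to measuring a union of
  squares.\<close>

definition grid_cell :: "real \<Rightarrow> int \<times> int \<Rightarrow> (real^2) set" where
  "grid_cell R z = {x. of_int (fst z) \<le> x$1 \<and> x$1 < of_int (fst z) + R \<and>
                  of_int (snd z) \<le> x$2 \<and> x$2 < of_int (snd z) + R}"

abbreviation vec_of :: "int \<times> int \<Rightarrow> real^2" where
  "vec_of z \<equiv> vector [of_int (fst z), of_int (snd z)]"

lemma grid_cell_lmeasurable: "grid_cell R z \<in> lmeasurable" and measure_grid_cell: "R > 0 \<Longrightarrow> measure lebesgue (grid_cell R z) = R^2"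
proof -
  let ?a = "vec_of z" and ?b = "vector [of_int (fst z) + R, of_int (snd z) + R] :: real^2"
  have eq: "grid_cell R z = cbox ?a ?b \<inter> {x. x$1 < of_int (fst z) + R} \<inter> {x. x$2 < of_int (snd z) + R}"
    by (auto simp: grid_cell_def mem_box_cart forall_2)
  have "grid_cell R z \<in> sets lebesgue" unfolding eq
    by (intro sets.Int) (auto intro!: borel_open open_halfspace_component_lt_cart)
  then show m: "grid_cell R z \<in> lmeasurable"
    by (rule fmeasurableI2[OF lmeasurable_cbox, rotated]) (auto simp: eq)
  assume R: "R > 0"
  have sub: "box ?a ?b \<subseteq> grid_cell R z" "grid_cell R z \<subseteq> cbox ?a ?b"
    by (auto simp: grid_cell_def mem_box_cart forall_2)
  have ne: "cbox ?a ?b \<noteq> {}" using R by (simp add: interval_ne_empty_cart forall_2)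
  have c: "measure lebesgue (cbox ?a ?b) = R^2"
    by (subst measure_completion) (auto simp: content_cbox_cart[OF ne] UNIV_2 power2_eq_square)
  moreover have "measure lebesgue (box ?a ?b) = measure lebesgue (cbox ?a ?b)"
    by (simp add: measure_lborel_box_eq measure_lborel_cbox_eq)
  moreover have "measure lebesgue (box ?a ?b) \<le> measure lebesgue (grid_cell R z)"
    using sub(1) m by (intro measure_mono_fmeasurable) auto
  moreover have "measure lebesgue (grid_cell R z) \<le> measure lebesgue (cbox ?a ?b)"
    using sub(2) m by (intro measure_mono_fmeasurable) auto
  ultimately show "measure lebesgue (grid_cell R z) = R^2" by linarith
qed

lemma grid_cell_disjoint:
  assumes "x \<in> grid_cell (of_int R) z" "x \<in> grid_cell (of_int R) z'" "R > 0"
    "[fst z = fst z'] (mod R)" "[snd z = snd z'] (mod R)"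
  shows "z = z'"
proof -
  have "of_int \<bar>fst z - fst z'\<bar> < (of_int R :: real)" "of_int \<bar>snd z - snd z'\<bar> < (of_int R :: real)"
    using assms(1,2) by (auto simp: grid_cell_def)
  then have "\<bar>fst z - fst z'\<bar> < R" "\<bar>snd z - snd z'\<bar> < R" by (simp_all only: of_int_less_iff)
  moreover have "R dvd fst z - fst z'" "R dvd snd z - snd z'" using assms(4,5) by (auto simp: cong_iff_dvd_diff)
  ultimately have "fst z - fst z' = 0" "snd z - snd z' = 0"
    using dvd_imp_le_int assms(3) by (metis abs_of_pos not_less)+
  then show ?thesis by (simp add: prod_eq_iff)
qed

lemma grid_cell_cover:
  assumes "R > 0"
  obtains z where "x \<in> grid_cell (of_int R) z" "[fst z = r] (mod R)" "[snd z = s] (mod R)"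
proof -
  have *: "of_int (r + R * \<lfloor>(y - of_int r) / of_int R\<rfloor>) \<le> y \<and> y < of_int (r + R * \<lfloor>(y - of_int r) / of_int R\<rfloor>) + of_int R"
    for y :: real and r :: int
  proof -
    define k :: real where "k = of_int \<lfloor>(y - of_int r) / of_int R\<rfloor>"
    have "k \<le> (y - of_int r) / of_int R" "(y - of_int r) / of_int R < k + 1" unfolding k_def by linarith+
    then have "k * of_int R \<le> y - of_int r" "y - of_int r < (k + 1) * of_int R"
      using assms by (simp_all add: pos_le_divide_eq pos_divide_less_eq)
    then show ?thesis by (simp add: k_def algebra_simps)
  qed
  show ?thesis
    by (rule that[of "(r + R * \<lfloor>(x$1 - of_int r) / of_int R\<rfloor>, s + R * \<lfloor>(x$2 - of_int s) / of_int R\<rfloor>)"])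
       (use *[of r "x$1"] *[of s "x$2"] in \<open>auto simp: grid_cell_def cong_iff_dvd_diff\<close>)
qed

definition lattice_points :: "real^2^2 \<Rightarrow> int \<Rightarrow> int \<Rightarrow> int \<Rightarrow> real \<Rightarrow> (int \<times> int) set" where
  "lattice_points M R r s t = {z. [fst z = r] (mod R) \<and> [snd z = s] (mod R) \<and> norm (M *v vec_of z) \<le> t}"

lemma measure_ellipse:
  fixes M :: "real^2^2"
  assumes "det M \<noteq> 0" "t \<ge> 0"
  shows "{x. norm (M *v x) \<le> t} \<in> lmeasurable" "measure lebesgue {x. norm (M *v x) \<le> t} = pi * t^2 / \<bar>det M\<bar>"
proof -
  have "invertible M" using assms invertible_det_nz by blast
  then obtain N where N: "M ** N = mat 1" "N ** M = mat 1" unfolding invertible_def by blast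
  have eq: "{x. norm (M *v x) \<le> t} = (\<lambda>x. N *v x) ` cball 0 t"
  proof (intro equalityI subsetI)
    fix x assume "x \<in> {x. norm (M *v x) \<le> t}"
    then show "x \<in> (\<lambda>x. N *v x) ` cball 0 t"
      by (intro image_eqI[of _ _ "M *v x"]) (simp_all add: matrix_vector_mul_assoc N)
  qed (auto simp: matrix_vector_mul_assoc N)
  have lin: "linear (\<lambda>x. N *v x)" by (rule matrix_vector_mul_linear)
  show "{x. norm (M *v x) \<le> t} \<in> lmeasurable"
    unfolding eq by (rule measurable_linear_image[OF lin]) simp
  have "det N * det M = 1" by (metis N(2) det_I det_mul)
  then have d: "\<bar>det N\<bar> = 1 / \<bar>det M\<bar>" using assms(1) by (simp add: field_simps flip: abs_mult)
  show "measure lebesgue {x. norm (M *v x) \<le> t} = pi * t^2 / \<bar>det M\<bar>"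
    unfolding eq using assms
    by (subst measure_linear_image[OF lin]) (simp_all add: d content_cball unit_ball_vol_2)
qed

text \<open>Gauss's argument: the squares at the points in the ellipse of size t lie inside the
  ellipse of size t + K and cover the one of size t - K, where K bounds how far M moves apart a
  corner and a point of its square. K is the same for all residue classes.\<close>

lemma lattice_points_bounds:
  fixes M :: "real^2^2"
  assumes M: "det M \<noteq> 0" and R: "R > 0"
  obtains K where "K \<ge> 0"
    "\<And>r s t. t \<ge> 0 \<Longrightarrow> finite (lattice_points M R r s t)"
    "\<And>r s t. t \<ge> 0 \<Longrightarrow> real (card (lattice_points M R r s t)) * (of_int R)^2 \<le> pi * (t + K)^2 / \<bar>det M\<bar>"
    "\<And>r s t. t \<ge> K \<Longrightarrow> pi * (t - K)^2 / \<bar>det M\<bar> \<le> real (card (lattice_points M R r s t)) * (of_int R)^2"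
proof -
  obtain B where B: "B > 0" "\<And>x. norm (M *v x) \<le> B * norm x"
    using linear_bounded_pos[OF matrix_vector_mul_linear[of M]] by metis
  define K where "K = B * (2 * of_int R)"
  have K0: "K \<ge> 0" using B R by (simp add: K_def)
  have near: "norm (M *v x - M *v vec_of z) \<le> K" if "x \<in> grid_cell (of_int R) z" for x z
  proof -
    have "norm (x - vec_of z) \<le> (\<Sum>i\<in>UNIV. \<bar>(x - vec_of z)$i\<bar>)" by (rule norm_le_l1_cart)
    also have "\<dots> \<le> 2 * of_int R" using that by (simp add: UNIV_2 grid_cell_def)
    finally have "B * norm (x - vec_of z) \<le> K" unfolding K_def using B(1) by (intro mult_left_mono) auto
    then show ?thesis using B(2)[of "x - vec_of z"] by (simp add: matrix_vector_mult_diff_distrib)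
  qed
  have union: "measure lebesgue (\<Union>z\<in>F. grid_cell (of_int R) z) = real (card F) * (of_int R)^2"
    if "finite F" "F \<subseteq> lattice_points M R r s t" for F r s t
  proof -
    have "disjoint_family_on (grid_cell (of_int R)) F"
      unfolding disjoint_family_on_def
    proof (intro ballI impI)
      fix z z' assume z: "z \<in> F" "z' \<in> F" "z \<noteq> z'"
      then have "[fst z = fst z'] (mod R)" "[snd z = snd z'] (mod R)"
        using subsetD[OF that(2) z(1)] subsetD[OF that(2) z(2)] by (simp_all add: lattice_points_def cong_def)
      then show "grid_cell (of_int R) z \<inter> grid_cell (of_int R) z' = {}" using grid_cell_disjoint R z(3) by blast
    qed
    then have "measure lebesgue (\<Union>z\<in>F. grid_cell (of_int R) z) = (\<Sum>z\<in>F. measure lebesgue (grid_cell (of_int R) z))"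
      using that(1) fmeasurableD[OF grid_cell_lmeasurable] fmeasurableD2[OF grid_cell_lmeasurable]
      by (intro measure_finite_Union) (blast | metis infinity_ennreal_def)+
    then show ?thesis using R by (simp add: measure_grid_cell)
  qed
  \<comment> \<open>Stated for finite subsets F, because finiteness of the whole set is deduced from
    this bound on cardinalities.\<close>
  have upper: "real (card F) * (of_int R)^2 \<le> pi * (t + K)^2 / \<bar>det M\<bar>"
    if F: "finite F" "F \<subseteq> lattice_points M R r s t" and t: "t \<ge> 0" for F r s t
  proof -
    have "(\<Union>z\<in>F. grid_cell (of_int R) z) \<subseteq> {x. norm (M *v x) \<le> t + K}"
    proof
      fix x assume "x \<in> (\<Union>z\<in>F. grid_cell (of_int R) z)"
      then obtain z where z: "z \<in> lattice_points M R r s t" "x \<in> grid_cell (of_int R) z" using F by auto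
      then have "norm (M *v vec_of z) \<le> t" by (simp add: lattice_points_def)
      then show "x \<in> {x. norm (M *v x) \<le> t + K}"
        using near[OF z(2)] norm_triangle_sub[of "M *v x" "M *v vec_of z"] by simp
    qed
    then have "measure lebesgue (\<Union>z\<in>F. grid_cell (of_int R) z) \<le> measure lebesgue {x. norm (M *v x) \<le> t + K}"
      using measure_ellipse(1)[OF M] t K0 F(1) grid_cell_lmeasurable
      by (intro measure_mono_fmeasurable) (auto intro!: fmeasurableD fmeasurable.finite_UN)
    then show ?thesis using measure_ellipse(2)[OF M, of "t + K"] t K0 union[OF F] by simp
  qed
  have fin: "finite (lattice_points M R r s t)" if t: "t \<ge> 0" for r s t
  proof (rule finite_if_finite_subsets_card_bdd[THEN conjunct1])
    define C where "C = nat \<lceil>(pi * (t + K)^2 / \<bar>det M\<bar>) / (of_int R)^2\<rceil>"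
    fix G assume "G \<subseteq> lattice_points M R r s t" "finite G"
      from upper[OF this(2,1) t] R have "real (card G) \<le> (pi * (t + K)^2 / \<bar>det M\<bar>) / (of_int R)^2"
        by (subst pos_le_divide_eq) auto
      then show "card G \<le> C" unfolding C_def by linarith
  qed
  have lower: "pi * (t - K)^2 / \<bar>det M\<bar> \<le> real (card (lattice_points M R r s t)) * (of_int R)^2" if t: "t \<ge> K" for r s t
  proof -
    have f: "finite (lattice_points M R r s t)" using fin t K0 by simp
    have "{x. norm (M *v x) \<le> t - K} \<subseteq> (\<Union>z\<in>lattice_points M R r s t. grid_cell (of_int R) z)"
    proof
      fix x assume x: "x \<in> {x. norm (M *v x) \<le> t - K}"
      obtain z where z: "x \<in> grid_cell (of_int R) z" "[fst z = r] (mod R)" "[snd z = s] (mod R)"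
        using grid_cell_cover[OF R] by blast
      have "norm (M *v vec_of z) \<le> t"
        using near[OF z(1)] norm_triangle_sub[of "M *v vec_of z" "M *v x"] x
        by (simp add: norm_minus_commute)
      then show "x \<in> (\<Union>z\<in>lattice_points M R r s t. grid_cell (of_int R) z)" using z by (intro UN_I[of z]) (simp_all add: lattice_points_def)
    qed
    then have "measure lebesgue {x. norm (M *v x) \<le> t - K} \<le> measure lebesgue (\<Union>z\<in>lattice_points M R r s t. grid_cell (of_int R) z)"
      using measure_ellipse(1)[OF M, of "t - K"] t f grid_cell_lmeasurable
      by (intro measure_mono_fmeasurable) (auto intro!: fmeasurableD fmeasurable.finite_UN)
    then show ?thesis using measure_ellipse(2)[OF M, of "t - K"] t union[OF f order_refl] by simp
  qed
  have "real (card (lattice_points M R r s t)) * (of_int R)^2 \<le> pi * (t + K)^2 / \<bar>det M\<bar>" if "t \<ge> 0" for r s t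
    using upper[OF fin[OF that] order_refl that] .
  from that[OF K0 fin this lower] show ?thesis .
qed

lemma lattice_points_asymptotic:
  fixes M :: "real^2^2"
  assumes M: "det M \<noteq> 0" and R: "R > 0"
  shows "((\<lambda>t. real (card (lattice_points M R r s t)) / t^2) \<longlongrightarrow> pi / (\<bar>det M\<bar> * (of_int R)^2)) at_top"
proof -
  obtain K where K: "K \<ge> 0"
    "\<And>r s t. t \<ge> 0 \<Longrightarrow> real (card (lattice_points M R r s t)) * (of_int R)^2 \<le> pi * (t + K)^2 / \<bar>det M\<bar>"
    "\<And>r s t. t \<ge> K \<Longrightarrow> pi * (t - K)^2 / \<bar>det M\<bar> \<le> real (card (lattice_points M R r s t)) * (of_int R)^2"
    using lattice_points_bounds[OF M R] by metis
  define c where "c = pi / (\<bar>det M\<bar> * (of_int R)^2)"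
  have l: "((\<lambda>t. c * (1 + e * (K / t))^2) \<longlongrightarrow> c * (1 + e * 0)^2) at_top" for e :: real
    by (intro tendsto_intros tendsto_divide_0[OF tendsto_const] filterlim_at_top_imp_at_infinity filterlim_ident)
  show ?thesis unfolding c_def[symmetric]
  proof (rule tendsto_sandwich)
    show "((\<lambda>t. c * (1 + (-1) * (K / t))^2) \<longlongrightarrow> c) at_top" using l[of "-1"] by simp
    show "((\<lambda>t. c * (1 + 1 * (K / t))^2) \<longlongrightarrow> c) at_top" using l[of 1] by simp
    have e: "c * (1 + e * (K / t))^2 = (pi * (t + e * K)^2 / \<bar>det M\<bar>) / (of_int R)^2 / t^2" if "t > 0" for e t
    proof -
      have "1 + e * (K / t) = (t + e * K) / t" using that by (simp add: field_simps)
      then show ?thesis by (simp add: c_def power_divide)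
    qed
    show "\<forall>\<^sub>F t in at_top. c * (1 + (-1) * (K / t))^2 \<le> real (card (lattice_points M R r s t)) / t^2"
      using eventually_gt_at_top[of 0] eventually_ge_at_top[of K]
    proof eventually_elim
      case (elim t)
      have "pi * (t + (-1) * K)^2 / \<bar>det M\<bar> / (of_int R)^2 \<le> real (card (lattice_points M R r s t))"
        using K(3)[OF elim(2), of r s] R by (subst pos_divide_le_eq) auto
      then show ?case unfolding e[OF elim(1)] by (intro divide_right_mono) auto
    qed
    show "\<forall>\<^sub>F t in at_top. real (card (lattice_points M R r s t)) / t^2 \<le> c * (1 + 1 * (K / t))^2"
      using eventually_gt_at_top[of 0]
    proof eventually_elim
      case (elim t)
      have "real (card (lattice_points M R r s t)) \<le> pi * (t + 1 * K)^2 / \<bar>det M\<bar> / (of_int R)^2"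
        using K(2)[of t r s] elim R by (subst pos_le_divide_eq) auto
      then show ?case unfolding e[OF elim(1)] by (intro divide_right_mono) auto
    qed
  qed
qed

subsection \<open>Primitive points\<close>

definition moebius :: "nat \<Rightarrow> real" where
  "moebius n = (if squarefree n then (-1) ^ card (prime_factors n) else 0)"

lemma moebius_one [simp]: "moebius (Suc 0) = 1" by (simp add: moebius_def)

lemma abs_moebius_le: "\<bar>moebius n\<bar> \<le> 1"
  by (simp add: moebius_def power_abs)

lemma moebius_prime_mult:
  assumes "prime p" "\<not> p dvd d" "d > 0" shows "moebius (p * d) = - moebius d"
proof -
  have c: "coprime p d" using assms prime_imp_coprime by blast
  have "squarefree (p * d) \<longleftrightarrow> squarefree d"
    using c assms(1) by (metis squarefree_mult_coprime squarefree_multD(2) squarefree_prime)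
  moreover have "prime_factors (p * d) = insert p (prime_factors d)"
    using assms by (simp add: prime_factors_product prime_prime_factors prime_gt_0_nat)
  moreover have "p \<notin> prime_factors d" using assms(2) by auto
  ultimately show ?thesis by (simp add: moebius_def)
qed

text \<open>For a prime p dividing n, the divisors d not divisible by p cancel against p d, and the
  remaining ones are divisible by p^2.\<close>

lemma sum_moebius:
  assumes "n > 0" shows "(\<Sum>d | d dvd n. moebius d) = (if n = 1 then 1 else 0)"
proof (cases "n = 1")
  case False
  then obtain p where p: "prime p" "p dvd n" using prime_factor_nat by blast
  have fin: "finite {d. d dvd n}" using assms by simp
  let ?A = "{d. d dvd n \<and> \<not> p dvd d}" and ?B = "{d. d dvd n \<and> p dvd d}"
  let ?B' = "{d. d dvd n \<and> p dvd d \<and> squarefree d}"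
  have pos: "d > 0" if "d dvd n" for d using that assms by (auto intro: Nat.gr0I)
  have "(\<Sum>d | d dvd n. moebius d) = sum moebius (?A \<union> ?B)" by (rule sum.cong) auto
  also have "\<dots> = sum moebius ?A + sum moebius ?B"
    using fin by (intro sum.union_disjoint) (auto elim: rev_finite_subset)
  also have "sum moebius ?B = sum moebius ((\<lambda>d. p * d) ` ?A)"
  proof (rule sum.mono_neutral_right)
    show "finite ?B" using fin by (rule rev_finite_subset) auto
    show "(\<lambda>d. p * d) ` ?A \<subseteq> ?B"
      using p by (auto intro: divides_mult prime_imp_coprime)
    show "\<forall>i\<in>?B - (\<lambda>d. p * d) ` ?A. moebius i = 0"
    proof
      fix i assume i: "i \<in> ?B - (\<lambda>d. p * d) ` ?A"
      then obtain e where e: "i = p * e" by auto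
      have "e dvd n" using i e by (auto intro: dvd_trans[of e i n])
      then have "p dvd e" using i e by auto
      then have "p^2 dvd i" by (simp add: e power2_eq_square)
      then have "\<not> squarefree i" using p not_prime_unit by (auto simp: squarefree_def)
      then show "moebius i = 0" by (simp add: moebius_def)
    qed
  qed
  also have "\<dots> = (\<Sum>d\<in>?A. moebius (p * d))"
    using p by (subst sum.reindex) (auto simp: inj_on_def prime_gt_0_nat)
  also have "\<dots> = (\<Sum>d\<in>?A. - moebius d)"
    using p pos by (intro sum.cong refl moebius_prime_mult) auto
  finally show ?thesis using False by (simp add: sum_negf)
qed simp

text \<open>The terms after the first are at most 1/2^2, 1/3^2, ... in absolute value. Comparison
  with the telescoping series 1/(1 2) + 1/(2 3) + ... bounds their sum only by 1, so its first term
  1/2 is lowered to the exact 1/4. The bound 3/4 gives positivity without evaluating an Euler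
  product.\<close>

lemma inverse_square_series_pos:
  assumes "\<And>k. \<bar>f k\<bar> \<le> (1::real)" "f 0 = 1"
  shows "(\<Sum>k. f k / (real (Suc k))^2) > 0"
proof -
  let ?a = "\<lambda>k. f k / (real (Suc k))^2"
  define b where "b k = 1 / real (Suc k) - 1 / real (Suc (Suc k)) - (if k = 0 then 1/4 else 0)" for k
  have "(\<lambda>k. 1 / real (Suc k)) \<longlonglongrightarrow> 0" using LIMSEQ_inverse_real_of_nat by (simp add: inverse_eq_divide)
  from telescope_sums'[OF this] have "(\<lambda>k. 1 / real (Suc k) - 1 / real (Suc (Suc k))) sums 1" by simp
  from sums_diff[OF this sums_single[of 0 "\<lambda>_. 1/4::real"]]
  have b: "b sums (3/4)" unfolding b_def by simp
  have le: "norm (?a (Suc k)) \<le> b k" for k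
  proof -
    have "norm (?a (Suc k)) \<le> 1 / (real (Suc (Suc k)))^2"
      using assms(1)[of "Suc k"] by (simp add: divide_right_mono)
    also have "\<dots> \<le> b k"
    proof (cases k)
      case 0 then show ?thesis by (simp add: b_def)
    next
      case (Suc j)
      have "1 / real (Suc k) - 1 / real (Suc (Suc k)) = 1 / (real (Suc k) * real (Suc (Suc k)))"
        by (simp add: field_simps)
      also have "1 / (real (Suc (Suc k)))^2 \<le> \<dots>"
        unfolding power2_eq_square by (intro frac_le mult_mono) auto
      finally show ?thesis using Suc by (simp add: b_def)
    qed
    finally show ?thesis .
  qed
  have sm: "summable (\<lambda>k. ?a (Suc k))" by (rule summable_comparison_test'[OF sums_summable[OF b], of 0]) (use le in auto)
  have "\<bar>\<Sum>k. ?a (Suc k)\<bar> \<le> 3/4"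
    using norm_suminf_le[OF le sums_summable[OF b]] sums_unique[OF b] by simp
  moreover have "(\<Sum>k. ?a k) = ?a 0 + (\<Sum>k. ?a (Suc k))"
    using suminf_split_head[OF sm[unfolded summable_Suc_iff[of ?a]]] by simp
  ultimately show ?thesis using assms(2) by simp
qed

lemma nonzero_lower_bound:
  fixes M :: "real^2^2"
  assumes "det M \<noteq> 0"
  obtains q where "q > 0" "\<And>z. z \<noteq> (0, 0) \<Longrightarrow> q \<le> norm (M *v vec_of z)"
proof -
  have "invertible M" using assms invertible_det_nz by blast
  then obtain N where N: "N ** M = mat 1" unfolding invertible_def by blast
  obtain B where B: "B > 0" "\<And>x. norm (N *v x) \<le> B * norm x"
    using linear_bounded_pos[OF matrix_vector_mul_linear[of N]] by metis
  have "1 / B \<le> norm (M *v vec_of z)" if z: "z \<noteq> (0, 0)" for z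
  proof -
    have "\<bar>vec_of z $ 1\<bar> \<ge> 1 \<or> \<bar>vec_of z $ 2\<bar> \<ge> 1"
      using z by (cases z) auto
    then have "1 \<le> norm (vec_of z)" by (metis component_le_norm_cart order_trans)
    also have "vec_of z = N *v (M *v vec_of z)" by (simp add: matrix_vector_mul_assoc N)
    also have "norm (N *v (M *v vec_of z)) \<le> B * norm (M *v vec_of z)" by (rule B)
    finally show ?thesis using B(1) by (simp add: field_simps)
  qed
  then show ?thesis using that[of "1 / B"] B(1) by simp
qed

definition nonzero_points :: "real^2^2 \<Rightarrow> real \<Rightarrow> (int \<times> int) set" where
  "nonzero_points M t = {z. z \<noteq> (0, 0) \<and> norm (M *v vec_of z) \<le> t}"

text \<open>A bound without lower order terms, valid for small t as well: below the shortest vector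
  there are no points, and above it K is absorbed into a multiple of t. It will be applied at t / k
  for all k at once.\<close>

lemma nonzero_points_bound:
  fixes M :: "real^2^2"
  assumes "det M \<noteq> 0"
  obtains C where "C \<ge> 0" "\<And>t. t > 0 \<Longrightarrow> finite (nonzero_points M t) \<and> real (card (nonzero_points M t)) \<le> C * t^2"
proof -
  obtain q where q: "q > 0" "\<And>z. z \<noteq> (0, 0) \<Longrightarrow> q \<le> norm (M *v vec_of z)"
    using nonzero_lower_bound[OF assms] by blast
  obtain K where K: "K \<ge> 0" "\<And>t. t \<ge> 0 \<Longrightarrow> finite (lattice_points M 1 0 0 t)"
    "\<And>t. t \<ge> 0 \<Longrightarrow> real (card (lattice_points M 1 0 0 t)) \<le> pi * (t + K)^2 / \<bar>det M\<bar>"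
    using lattice_points_bounds[OF assms, of 1] by (metis of_int_1 one_power2 mult_1_right zero_less_one)
  define C where "C = pi * (1 + K / q)^2 / \<bar>det M\<bar>"
  have sub: "nonzero_points M t \<subseteq> lattice_points M 1 0 0 t" for t by (auto simp: nonzero_points_def lattice_points_def)
  have "finite (nonzero_points M t) \<and> real (card (nonzero_points M t)) \<le> C * t^2" if t: "t > 0" for t
  proof
    show f: "finite (nonzero_points M t)" using finite_subset[OF sub K(2)] t by simp
    show "real (card (nonzero_points M t)) \<le> C * t^2"
    proof (cases "t < q")
      case True
      have "z \<notin> nonzero_points M t" for z using q(2)[of z] True unfolding nonzero_points_def by auto
      then have "nonzero_points M t = {}" by blast
      then show ?thesis by (simp add: C_def)
    next
      case False
      have "real (card (nonzero_points M t)) \<le> real (card (lattice_points M 1 0 0 t))"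
        using card_mono[OF K(2) sub] t by simp
      also have "\<dots> \<le> pi * (t + K)^2 / \<bar>det M\<bar>" using K(3) t by simp
      also have "\<dots> \<le> pi * (t + K / q * t)^2 / \<bar>det M\<bar>"
      proof (intro divide_right_mono mult_left_mono power_mono add_left_mono)
        have "K * q \<le> K * t" using False K(1) by (intro mult_left_mono) auto
        then show "K \<le> K / q * t" using q(1) by (simp add: field_simps)
      qed (use t K in auto)
      also have "\<dots> = C * t^2" by (simp add: C_def power2_eq_square algebra_simps)
      finally show ?thesis .
    qed
  qed
  then show ?thesis using that[of C] by (simp add: C_def)
qed

text \<open>The origin is left out because every k divides it, so that it would occur in each term
  of the Moebius sum.\<close>

definition multiple_points :: "real^2^2 \<Rightarrow> int \<Rightarrow> int \<Rightarrow> int \<Rightarrow> nat \<Rightarrow> real \<Rightarrow> (int \<times> int) set" where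
  "multiple_points M R r s k t = {z \<in> lattice_points M R r s t. z \<noteq> (0, 0) \<and> int k dvd fst z \<and> int k dvd snd z}"

lemma multiple_points_card_le:
  fixes M :: "real^2^2"
  assumes "finite (nonzero_points M (t / real k))" "k > 0"
  shows "finite (multiple_points M R r s k t)" "card (multiple_points M R r s k t) \<le> card (nonzero_points M (t / real k))"
proof -
  have sub: "multiple_points M R r s k t \<subseteq> (\<lambda>z. (int k * fst z, int k * snd z)) ` nonzero_points M (t / real k)"
  proof
    fix z assume z: "z \<in> multiple_points M R r s k t"
    then obtain u v where uv: "z = (int k * u, int k * v)" by (cases z) (auto simp: multiple_points_def elim!: dvdE)
    have "vec_of z = real k *\<^sub>R vec_of (u, v)" by (simp add: uv vec_eq_iff forall_2)
    then have "norm (M *v vec_of z) = real k * norm (M *v vec_of (u, v))"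
      by (simp add: matrix_vector_mult_scaleR)
    then have "(u, v) \<in> nonzero_points M (t / real k)"
      using z assms(2) unfolding multiple_points_def lattice_points_def nonzero_points_def uv by (auto simp: field_simps)
    then show "z \<in> (\<lambda>z. (int k * fst z, int k * snd z)) ` nonzero_points M (t / real k)"
      unfolding uv by force
  qed
  show "finite (multiple_points M R r s k t)" by (rule finite_subset[OF sub finite_imageI[OF assms(1)]])
  show "card (multiple_points M R r s k t) \<le> card (nonzero_points M (t / real k))"
    using card_mono[OF finite_imageI[OF assms(1)] sub] card_image_le[OF assms(1)] order_trans by blast
qed

text \<open>Divisibility of both coordinates by k together with a class modulo R is one class modulo
  k R. Removing the origin changes the count by at most 1.\<close>

lemma multiple_points_asymptotic:
  fixes M :: "real^2^2"
  assumes M: "det M \<noteq> 0" and R: "R > 0" and k: "k > 0" "coprime (int k) R"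
  shows "((\<lambda>t. real (card (multiple_points M R r s k t)) / t^2) \<longlongrightarrow> pi / (\<bar>det M\<bar> * (of_int R)^2) / (real k)^2) at_top"
proof -
  obtain r' where r': "[r' = 0] (mod int k)" "[r' = r] (mod R)" using binary_chinese_remainder_int[OF k(2)] by blast
  obtain s' where s': "[s' = 0] (mod int k)" "[s' = s] (mod R)" using binary_chinese_remainder_int[OF k(2)] by blast
  have split: "[x = y'] (mod int k * R) \<longleftrightarrow> int k dvd x \<and> [x = y] (mod R)"
    if "[y' = 0] (mod int k)" "[y' = y] (mod R)" for x y y'
  proof -
    have "[x = y'] (mod int k * R) \<longleftrightarrow> [x = y'] (mod int k) \<and> [x = y'] (mod R)"
      using coprime_cong_mult[OF _ _ k(2)] by (auto intro: cong_modulus_mult cong_dvd_modulus)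
    also have "[x = y'] (mod int k) \<longleftrightarrow> int k dvd x"
      using that(1) by (metis cong_0_iff cong_sym cong_trans)
    also have "[x = y'] (mod R) \<longleftrightarrow> [x = y] (mod R)" using that(2) by (metis cong_sym cong_trans)
    finally show ?thesis .
  qed
  let ?L = "\<lambda>t. lattice_points M (int k * R) r' s' t"
  have eq: "multiple_points M R r s k t = ?L t - {(0,0)}" for t
    using split[OF r'] split[OF s'] by (auto simp: multiple_points_def lattice_points_def)
  have kR: "int k * R > 0" using k R by simp
  let ?z = "if [0 = r'] (mod int k * R) \<and> [0 = s'] (mod int k * R) then 1 else (0::real)"
  have "real (card (multiple_points M R r s k t)) = real (card (?L t)) - ?z" if "t > 0" for t
  proof -
    have fin: "finite (?L t)" using lattice_points_bounds[OF M kR] that by (metis less_imp_le)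
    have "vec_of (0, 0) = 0" by (simp add: vec_eq_iff forall_2)
    then have "(0, 0) \<in> ?L t \<longleftrightarrow> ?z = 1" using that by (auto simp: lattice_points_def)
    moreover have "card (?L t) > 0" if "(0, 0) \<in> ?L t" using fin that card_gt_0_iff by blast
    ultimately show ?thesis using fin unfolding eq
      by (auto simp: card_Diff_singleton_if of_nat_diff Suc_le_eq)
  qed
  then have c: "real (card (?L t)) / t^2 - ?z / t^2 = real (card (multiple_points M R r s k t)) / t^2" if "t > 0" for t
    using that by (simp only: diff_divide_distrib)
  have ev: "\<forall>\<^sub>F t in at_top. real (card (?L t)) / t^2 - ?z / t^2 = real (card (multiple_points M R r s k t)) / t^2"
    by (rule eventually_mono[OF eventually_gt_at_top[of 0]]) (rule c)
  have "((\<lambda>t::real. ?z / t^2) \<longlongrightarrow> 0) at_top"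
    by (intro tendsto_divide_0[OF tendsto_const] filterlim_at_top_imp_at_infinity
        filterlim_pow_at_top filterlim_ident) simp
  from tendsto_diff[OF lattice_points_asymptotic[OF M kR, of r' s'] this]
  have "((\<lambda>t. real (card (?L t)) / t^2 - ?z / t^2) \<longlongrightarrow> pi / (\<bar>det M\<bar> * (of_int (int k * R))^2)) at_top"
    by (simp only: diff_0_right)
  from Lim_transform_eventually[OF this ev] show ?thesis by (simp add: power_mult_distrib mult_ac)
qed

definition primitive_points :: "real^2^2 \<Rightarrow> int \<Rightarrow> int \<Rightarrow> int \<Rightarrow> real \<Rightarrow> (int \<times> int) set" where
  "primitive_points M R r s t = {z \<in> lattice_points M R r s t. coprime (fst z) (snd z)}"

text \<open>The sum of mu(k) / k^2 over k prime to R, that is, the Euler product of 1 - p^(-2) over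
  the primes p not dividing R.\<close>

definition primitive_factor :: "int \<Rightarrow> real" where
  "primitive_factor R = (\<Sum>k. (if coprime (int (Suc k)) R then moebius (Suc k) else 0) / (real (Suc k))^2)"

lemma primitive_factor_pos: "primitive_factor R > 0"
  unfolding primitive_factor_def by (rule inverse_square_series_pos) (auto simp: abs_moebius_le)

text \<open>Moebius inversion over the gcd of the coordinates. A k sharing a factor with R
  contributes nothing, since that factor would divide r, s and R. The finite sum is written as a
  series to allow dominated convergence.\<close>

lemma card_primitive_points:
  fixes M :: "real^2^2"
  assumes M: "det M \<noteq> 0" and R: "R > 0" and r: "gcd r (gcd s R) = 1" and t: "t > 0"
  shows "real (card (primitive_points M R r s t)) =
    (\<Sum>k. (if coprime (int (Suc k)) R then moebius (Suc k) else 0) * real (card (multiple_points M R r s (Suc k) t)))"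
proof -
  obtain q where q: "q > 0" "\<And>z. z \<noteq> (0, 0) \<Longrightarrow> q \<le> norm (M *v vec_of z)"
    using nonzero_lower_bound[OF M] by blast
  \<comment> \<open>No nonzero point in the ellipse of size t has a gcd above t / q, so n bounds the
    k that occur.\<close>
  define n where "n = nat \<lceil>t / q\<rceil>"
  have n: "real n * q \<ge> t" using q(1) t unfolding n_def by (simp add: pos_divide_le_eq[symmetric])
  let ?L = "{z \<in> lattice_points M R r s t. z \<noteq> (0, 0)}"
  have fin: "finite (lattice_points M R r s t)" using lattice_points_bounds[OF M R] t by (metis less_imp_le)
  have le: "nat (gcd (fst z) (snd z)) \<le> n" if z: "z \<in> ?L" for z
  proof -
    let ?g = "gcd (fst z) (snd z)"
    obtain u v where uv: "fst z = ?g * u" "snd z = ?g * v" by (meson dvdE gcd_dvd1 gcd_dvd2)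
    have g: "?g > 0" using z by (cases z) auto
    have "vec_of z = of_int ?g *\<^sub>R vec_of (u, v)" using arg_cong[OF uv(1), of real_of_int] arg_cong[OF uv(2), of real_of_int]
      by (simp add: vec_eq_iff forall_2)
    then have e: "norm (M *v vec_of z) = of_int ?g * norm (M *v vec_of (u, v))"
      using g by (simp add: matrix_vector_mult_scaleR)
    have "(u, v) \<noteq> (0, 0)" using uv z by (cases z) auto
    then have "of_int ?g * q \<le> of_int ?g * norm (M *v vec_of (u, v))"
      using q(2) g by (intro mult_left_mono) auto
    also have "\<dots> \<le> t" using z unfolding e[symmetric] by (simp add: lattice_points_def)
    also have "t \<le> real n * q" by (rule n)
    finally have "real_of_int ?g \<le> real n" using q(1) by simp
    then show ?thesis by linarith
  qed
  have zero: "(if coprime (int (Suc k)) R then moebius (Suc k) else 0) * real (card (multiple_points M R r s (Suc k) t))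
     = moebius (Suc k) * real (card (multiple_points M R r s (Suc k) t))" for k
  proof (cases "coprime (int (Suc k)) R")
    case False
    have "multiple_points M R r s (Suc k) t = {}"
    proof (rule ccontr)
      assume "multiple_points M R r s (Suc k) t \<noteq> {}"
      then obtain z where z: "int (Suc k) dvd fst z" "int (Suc k) dvd snd z" "[fst z = r] (mod R)" "[snd z = s] (mod R)"
        by (auto simp: multiple_points_def lattice_points_def)
      let ?c = "gcd (int (Suc k)) R"
      have "?c dvd fst z" "?c dvd snd z" using z(1,2) by (meson dvd_trans gcd_dvd1)+
      moreover have "[fst z = r] (mod ?c)" "[snd z = s] (mod ?c)" using z(3,4) by (auto intro: cong_dvd_modulus)
      ultimately have "?c dvd r" "?c dvd s" by (simp_all add: cong_dvd_iff)
      then have "?c dvd gcd r (gcd s R)" by auto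
      then show False using r False by (simp add: coprime_iff_gcd_eq_1)
    qed
    then show ?thesis by simp
  qed simp
  have mz: "{z \<in> ?L. int k dvd fst z \<and> int k dvd snd z} = multiple_points M R r s k t" for k
    by (auto simp: multiple_points_def)
  have "primitive_points M R r s t = {z \<in> ?L. gcd (fst z) (snd z) = 1}"
    by (auto simp: primitive_points_def coprime_iff_gcd_eq_1)
  then have "real (card (primitive_points M R r s t)) = (\<Sum>z\<in>?L. if gcd (fst z) (snd z) = 1 then 1 else 0)"
    using fin by (simp add: sum.If_cases Int_def conj_commute)
  also have "\<dots> = (\<Sum>z\<in>?L. \<Sum>k | k \<in> {1..n} \<and> int k dvd fst z \<and> int k dvd snd z. moebius k)"
  proof (rule sum.cong[OF refl])
    fix z assume z: "z \<in> ?L"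
    let ?g = "nat (gcd (fst z) (snd z))"
    have g: "?g > 0" using z by (cases z) auto
    have "{k \<in> {1..n}. int k dvd fst z \<and> int k dvd snd z} = {k. k dvd ?g}"
    proof (intro equalityI subsetI)
      fix k assume "k \<in> {k. k dvd ?g}"
      then have k: "k dvd ?g" by simp
      then have "k > 0" using dvd_pos_nat[OF g] by blast
      moreover have "k \<le> n" using dvd_imp_le[OF k g] le[OF z] by simp
      moreover have "int k dvd gcd (fst z) (snd z)" using k int_dvd_int_iff[of k ?g] by simp
      ultimately show "k \<in> {k \<in> {1..n}. int k dvd fst z \<and> int k dvd snd z}" by auto
    next
      fix k assume "k \<in> {k \<in> {1..n}. int k dvd fst z \<and> int k dvd snd z}"
      then have "int k dvd gcd (fst z) (snd z)" by auto
      then show "k \<in> {k. k dvd ?g}" using int_dvd_int_iff[of k ?g] by simp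
    qed
    moreover have "gcd (fst z) (snd z) = 1 \<longleftrightarrow> ?g = 1" by linarith
    ultimately show "(if gcd (fst z) (snd z) = 1 then 1 else 0) =
        (\<Sum>k | k \<in> {1..n} \<and> int k dvd fst z \<and> int k dvd snd z. moebius k)"
      using sum_moebius[OF g] by (simp only:)
  qed
  also have "\<dots> = (\<Sum>k\<in>{1..n}. \<Sum>z | z \<in> ?L \<and> int k dvd fst z \<and> int k dvd snd z. moebius k)"
    using fin by (intro sum.swap_restrict) auto
  also have "\<dots> = (\<Sum>k\<in>{1..n}. moebius k * real (card (multiple_points M R r s k t)))"
    using mz by (simp add: mult.commute)
  also have "\<dots> = (\<Sum>k<n. moebius (Suc k) * real (card (multiple_points M R r s (Suc k) t)))"
    by (rule sum.reindex_bij_witness[of _ Suc "\<lambda>k. k - 1"]) auto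
  also have "\<dots> = (\<Sum>k. moebius (Suc k) * real (card (multiple_points M R r s (Suc k) t)))"
  proof (rule suminf_finite[symmetric])
    fix k assume k: "k \<notin> {..<n}"
    have "multiple_points M R r s (Suc k) t = {}"
    proof (rule ccontr)
      assume "multiple_points M R r s (Suc k) t \<noteq> {}"
      then obtain z where z: "z \<in> multiple_points M R r s (Suc k) t" by blast
      then have zL: "z \<in> ?L" using mz by blast
      have "int (Suc k) dvd gcd (fst z) (snd z)" using z by (simp add: multiple_points_def)
      moreover have "gcd (fst z) (snd z) > 0" using zL by (cases z) auto
      ultimately have "int (Suc k) \<le> gcd (fst z) (snd z)" by (rule zdvd_imp_le)
      then show False using le[OF zL] k by auto
    qed
    then show "moebius (Suc k) * real (card (multiple_points M R r s (Suc k) t)) = 0" by simp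
  qed simp
  finally show ?thesis unfolding zero .
qed

text \<open>The termwise limits of \<open>multiple_points_asymptotic\<close> are interchanged with
  the sum over k by Tannery's theorem. Dividing by k maps the points counted for k to nonzero points
  of size t / k, which gives the summable majorant C / k^2.\<close>

theorem primitive_points_asymptotic:
  fixes M :: "real^2^2"
  assumes M: "det M \<noteq> 0" and R: "R > 0" and r: "gcd r (gcd s R) = 1"
  shows "((\<lambda>t. real (card (primitive_points M R r s t)) / t^2) \<longlongrightarrow> pi / (\<bar>det M\<bar> * (of_int R)^2) * primitive_factor R) at_top"
proof -
  define c where "c = pi / (\<bar>det M\<bar> * (of_int R)^2)"
  define \<mu> where "\<mu> k = (if coprime (int (Suc k)) R then moebius (Suc k) else 0)" for k
  obtain C where C: "C \<ge> 0" "\<And>t. t > 0 \<Longrightarrow> finite (nonzero_points M t) \<and> real (card (nonzero_points M t)) \<le> C * t^2"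
    using nonzero_points_bound[OF M] by blast
  define a where "a k t = \<mu> k * (real (card (multiple_points M R r s (Suc k) t)) / t^2)" for k t
  define b where "b k = \<mu> k * (c / (real (Suc k))^2)" for k
  have lim: "((\<lambda>t. a k t) \<longlongrightarrow> b k) at_top" for k
  proof (cases "coprime (int (Suc k)) R")
    case True
    show ?thesis unfolding a_def b_def c_def
      by (intro tendsto_mult_left multiple_points_asymptotic[OF M R _ True]) simp
  qed (simp add: a_def b_def \<mu>_def)
  have mu1: "\<bar>\<mu> k\<bar> \<le> 1" for k by (simp add: \<mu>_def abs_moebius_le)
  have bound: "norm (a k t) \<le> C / (real (Suc k))^2" if t: "t > 0" for k t
  proof -
    have tk: "t / real (Suc k) > 0" using t by simp
    have "real (card (multiple_points M R r s (Suc k) t)) \<le> real (card (nonzero_points M (t / real (Suc k))))"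
      using multiple_points_card_le(2)[of M t "Suc k"] C(2)[OF tk] by simp
    also have "\<dots> \<le> C * (t / real (Suc k))^2" using C(2)[OF tk] by simp
    finally have "real (card (multiple_points M R r s (Suc k) t)) / t^2 \<le> C / (real (Suc k))^2"
      using t by (simp add: power_divide field_simps)
    then have "\<bar>\<mu> k\<bar> * (real (card (multiple_points M R r s (Suc k) t)) / t^2) \<le> 1 * (C / (real (Suc k))^2)"
      using mu1 by (intro mult_mono) auto
    then show ?thesis by (simp add: a_def abs_mult)
  qed
  have ev: "\<forall>\<^sub>F (k, t) in at_top \<times>\<^sub>F at_top. norm (a k t) \<le> C / (real (Suc k))^2"
    unfolding eventually_prod_filter
    using bound by (intro exI[of _ "\<lambda>_. True"] exI[of _ "\<lambda>t. t > 0"]) (auto simp: eventually_gt_at_top)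
  have sm: "summable (\<lambda>k. C / (real (Suc k))^2)"
    using summable_mult[OF inverse_power_summable[of 2, where 'a = real], of C]
    by (subst summable_Suc_iff[of "\<lambda>k. C / (real k)^2"]) (simp add: field_simps inverse_eq_divide)
  from tannerys_theorem[OF lim ev sm] have "((\<lambda>t. suminf (\<lambda>k. a k t)) \<longlongrightarrow> suminf b) at_top" by simp
  moreover have "\<forall>\<^sub>F t in at_top. suminf (\<lambda>k. a k t) = real (card (primitive_points M R r s t)) / t^2"
  proof (rule eventually_mono[OF eventually_gt_at_top[of 0]])
    fix t :: real assume t: "t > 0"
    have "summable (\<lambda>k. \<mu> k * real (card (multiple_points M R r s (Suc k) t)))"
    proof (rule summable_comparison_test'[OF summable_mult[OF sm, of "t^2"], of 0])
      fix k
      have "norm (\<mu> k * real (card (multiple_points M R r s (Suc k) t))) = t^2 * norm (a k t)"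
        using t by (simp add: a_def abs_mult)
      also have "\<dots> \<le> t^2 * (C / (real (Suc k))^2)" using bound[OF t] by (intro mult_left_mono) auto
      finally show "norm (\<mu> k * real (card (multiple_points M R r s (Suc k) t))) \<le> t^2 * (C / (real (Suc k))^2)" .
    qed
    from suminf_divide[OF this, of "t^2"]
    show "suminf (\<lambda>k. a k t) = real (card (primitive_points M R r s t)) / t^2"
      unfolding card_primitive_points[OF M R r t] a_def \<mu>_def[symmetric] by simp
  qed
  ultimately have "((\<lambda>t. real (card (primitive_points M R r s t)) / t^2) \<longlongrightarrow> suminf b) at_top"
    by (rule Lim_transform_eventually)
  moreover have "suminf b = c * primitive_factor R"
  proof -
    have "summable (\<lambda>k. \<mu> k / (real (Suc k))^2)"
    proof (rule summable_comparison_test'[of "\<lambda>k. 1 / (real (Suc k))^2" 0])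
      show "summable (\<lambda>k. 1 / (real (Suc k))^2)"
        using inverse_power_summable[of 2, where 'a = real]
        by (subst summable_Suc_iff[of "\<lambda>k. 1 / (real k)^2"]) (simp add: inverse_eq_divide)
    qed (use mu1 in \<open>simp add: divide_right_mono\<close>)
    from suminf_mult[OF this, of c] show ?thesis
      unfolding b_def primitive_factor_def \<mu>_def[symmetric] by (simp add: mult_ac)
  qed
  ultimately show ?thesis unfolding c_def by simp
qed

subsection \<open>Orbits and congruences\<close>

text \<open>The orbit of e1 under the orthogonal group of N over Z/q. Only the class of x modulo q
  matters.\<close>

definition local_stab_reaches :: "int \<Rightarrow> imat3 \<Rightarrow> ivec3 \<Rightarrow> bool" where
  "local_stab_reaches q N x \<longleftrightarrow>
     (\<exists>B. coprime (det B) q \<and> mcong q (transpose B ** N ** B) N \<and> vcong q (B *v e1) x)"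

lemma nf_shift:
  fixes m a d t r :: int
  assumes "m dvd a * t"
  obtains W where "W \<in> GL3Z" "W *v e1 = e1" "transpose W ** nf m a d ** W = nf m a (d - a * t^2 + 2 * m * r)"
proof -
  obtain s where s: "a * t = m * s" using assms by blast
  define W :: imat3 where "W = vector [vector [1, s, r], vector [0, 1, t], vector [0, 0, 1]]"
  have "W \<in> GL3Z" by (simp add: W_def GL3Z_iff det_3)
  moreover have "W *v e1 = e1" by (simp add: W_def e1_def mat3_simps)
  moreover have "transpose W ** nf m a d ** W = nf m a (d - a * t^2 + 2 * m * r)"
    using s by (simp add: W_def nfc_def mat3_simps power2_eq_square) (simp add: algebra_simps)
  ultimately show ?thesis using that by blast
qed

text \<open>Source of the modulus 2 m^2. For an isometry E modulo 2 m^2 with first column e1,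
  pairing with e1 gives m E32 = 0 and m E33 = m, hence E32 = 0 and E33 = 1 modulo 2 m after
  cancelling m. With t = E23, the (2,3) entry yields m | a t, since E22 is prime to m, and the
  corner yields the congruence for d.\<close>

lemma local_stabilizer_nf:
  assumes m: "m > 0" and C: "coprime (det C) (2 * m^2)"
    "mcong (2 * m^2) (transpose C ** nf m a d' ** C) (nf m a d)" "vcong (2 * m^2) (C *v e1) e1"
  obtains t where "m dvd a * t" "[d = d' - a * t^2] (mod 2 * m)"
proof -
  define q where "q = 2 * m^2"
  define E :: imat3 where "E = (\<chi> i j. if j = 1 then e1 $ i else C $ i $ j)"
  have CE: "mcong q C E"
    using C(3) by (auto simp: mcong_def vcong_def E_def e1_def mat3_simps q_def)
  have "mcong q (transpose E ** nf m a d' ** E) (transpose C ** nf m a d' ** C)"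
    by (intro mcong_mult mcong_transpose mcong_refl mcong_sym[OF CE])
  then have cong: "mcong q (transpose E ** nf m a d' ** E) (nf m a d)"
    using C(2) unfolding q_def by (rule mcong_trans)
  have det: "[det C = det E] (mod q)" by (rule mcong_det[OF CE])
  let ?p = "E$2$2" and ?q = "E$3$2" and ?t = "E$2$3" and ?w = "E$3$3"
  have E1: "E$1$1 = 1" "E$2$1 = 0" "E$3$1 = 0" by (simp_all add: E_def e1_def)
  have ent: "[(transpose E ** nf m a d' ** E)$i$j = nf m a d $i$j] (mod q)" for i j
    using cong by (simp add: mcong_def)
  have "[m * ?q = m * 0] (mod m * (2 * m))"
    using ent[of 1 2] by (simp add: mat3_simps nfc_def E1 q_def power2_eq_square mult_ac)
  then have q: "2 * m dvd ?q" using m by (simp add: cong_iff_dvd_diff)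
  have "[m * ?w = m * 1] (mod m * (2 * m))"
    using ent[of 1 3] by (simp add: mat3_simps nfc_def E1 q_def power2_eq_square mult_ac)
  then have "m * (2 * m) dvd m * (?w - 1)" by (simp add: cong_iff_dvd_diff algebra_simps)
  then have w: "2 * m dvd ?w - 1" using m by simp
  have "coprime (det E) q" using C(1) det cong_imp_coprime unfolding q_def by blast
  then have "coprime (det E) m" by (simp add: q_def)
  moreover have dE: "det E = ?p * ?w - ?q * ?t" by (simp add: det_3 E1)
  ultimately have "coprime (?p * ?w - ?q * ?t) m" by simp
  moreover have "[?p * ?w - ?q * ?t = ?p * ?w] (mod m)"
    using q by (simp add: cong_iff_dvd_diff dvd_mult_right)
  ultimately have "coprime (?p * ?w) m" using cong_imp_coprime by blast
  then have p: "coprime m ?p" by (simp add: coprime_commute)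
  have "[- a * ?p * ?t + m * (E$1$2 * ?w + ?q * E$1$3) + d' * (?q * ?w) = 0] (mod q)"
    using ent[of 2 3] by (simp add: mat3_simps nfc_def algebra_simps)
  then have "m dvd - a * ?p * ?t + m * (E$1$2 * ?w + ?q * E$1$3) + d' * (?q * ?w)"
    unfolding cong_0_iff by (rule dvd_trans[rotated]) (simp add: q_def power2_eq_square)
  moreover have "m dvd m * (E$1$2 * ?w + ?q * E$1$3) + d' * (?q * ?w)"
    using q by (intro dvd_add) (auto intro: dvd_mult dvd_mult2 dvd_mult_right)
  ultimately have "m dvd - a * ?p * ?t + m * (E$1$2 * ?w + ?q * E$1$3) + d' * (?q * ?w)
      - (m * (E$1$2 * ?w + ?q * E$1$3) + d' * (?q * ?w))" by (rule dvd_diff)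
  then have "m dvd - a * ?p * ?t" by simp
  then have "m dvd ?p * (a * ?t)" by (simp add: mult_ac)
  then have at: "m dvd a * ?t" using p by (simp add: coprime_dvd_mult_right_iff)
  have "[- a * ?t^2 + 2 * m * (E$1$3 * ?w) + d' * ?w^2 = d] (mod q)"
    using ent[of 3 3] by (simp add: mat3_simps nfc_def power2_eq_square algebra_simps)
  then have c1: "[- a * ?t^2 + 2 * m * (E$1$3 * ?w) + d' * ?w^2 = d] (mod 2 * m)"
    by (rule cong_dvd_modulus) (simp add: q_def power2_eq_square)
  have c2: "[- a * ?t^2 + 2 * m * (E$1$3 * ?w) + d' * ?w^2 = - a * ?t^2 + 0 + d' * 1^2] (mod 2 * m)"
    using w by (intro cong_add cong_mult cong_pow cong_refl) (simp_all add: cong_iff_dvd_diff)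
  from cong_trans[OF cong_sym[OF c1] c2] have "[d = d' - a * ?t^2] (mod 2 * m)" by simp
  with at show ?thesis using that by blast
qed

lemma orbit_subset_cone:
  assumes "x \<in> cone S" shows "orbit S x \<subseteq> cone S"
proof
  fix x' assume "x' \<in> orbit S x"
  then obtain A where A: "x' = A *v x" "A \<in> GL3Z" "transpose A ** S ** A = S" by (auto simp: orbit_def OS_def)
  then show "x' \<in> cone S" using assms cone_GL3Z[OF A(2), of x S] by simp
qed

lemma e1_cone: "e1 \<in> cone (nf m a d)"
  by (simp add: cone_def primitive_vec_iff qf_def nfc_def e1_def sum_3)

text \<open>For the converse, bring the form pointed at x to normal form. It has the same m and a,
  by \<open>nf_unique\<close>, and some corner d'. The isometry modulo 2 m^2 forces d and d' to
  agree up to a shear modulo 2 m, and such a shear is integral; composing with it gives an integral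
  isometry taking e1 to x.\<close>

lemma orbit_nf_iff:
  assumes sp: "special (nf m a d)" and pos: "m > 0" "a > 0" and x: "x \<in> cone (nf m a d)"
  shows "x \<in> orbit (nf m a d) e1 \<longleftrightarrow> local_stab_reaches (2 * m^2) (nf m a d) x"
proof
  assume "x \<in> orbit (nf m a d) e1"
  then obtain A where A: "x = A *v e1" "A \<in> GL3Z" "transpose A ** nf m a d ** A = nf m a d"
    by (auto simp: orbit_def OS_def)
  show "local_stab_reaches (2 * m^2) (nf m a d) x"
    unfolding local_stab_reaches_def A(1)
    by (intro exI[of _ A] conjI coprime_det_GL3Z A(2)) (simp_all add: A(3))
next
  assume "local_stab_reaches (2 * m^2) (nf m a d) x"
  then obtain B where B: "coprime (det B) (2 * m^2)" "mcong (2 * m^2) (transpose B ** nf m a d ** B) (nf m a d)"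
    "vcong (2 * m^2) (B *v e1) x" unfolding local_stab_reaches_def by blast
  obtain U m' a' d' where U: "U \<in> GL3Z" "U *v e1 = x" "m' > 0" "a' > 0" "transpose U ** nf m a d ** U = nf m' a' d'"
    using nf_exists[OF sp x] by blast
  have sp': "special (nf m' a' d')" using special_congr[OF sp U(1)] U(5) by simp
  have "det (nf m' a' d') = (det U * det U) * det (nf m a d)" unfolding U(5)[symmetric] by (simp add: det_mul)
  then have "det (nf m' a' d') = det (nf m a d)" using det_GL3Z[OF U(1)] by simp
  moreover have "Omega (nf m' a' d') = Omega (nf m a d)"
    using locally_equiv_Omega[OF locally_equiv_GL3Z[OF U(1), of "nf m a d"]] U(5) by simp
  ultimately have ma: "m' = m" "a' = a" using nf_unique[OF sp' sp U(3,4) pos] by auto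
  obtain V where V: "V \<in> GL3Z" "V ** U = mat 1" "U ** V = mat 1" using GL3Z_inverse[OF U(1)] by metis
  define C where "C = V ** B"
  have 1: "coprime (det C) (2 * m^2)" using B(1) coprime_det_GL3Z[OF V(1), of "2 * m^2"]
    by (simp add: C_def det_mul)
  have "transpose V ** nf m a d' ** V = transpose (U ** V) ** nf m a d ** (U ** V)"
    using U(5) ma by (simp add: congr_mult)
  then have "transpose V ** nf m a d' ** V = nf m a d" using V by simp
  then have 2: "mcong (2 * m^2) (transpose C ** nf m a d' ** C) (nf m a d)"
    using B(2) by (simp only: C_def congr_mult)
  have "vcong (2 * m^2) (V *v (B *v e1)) (V *v x)" by (intro vcong_mult mcong_refl B(3))
  moreover have "V *v x = e1" unfolding U(2)[symmetric] by (simp add: matrix_vector_mul_assoc V)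
  ultimately have 3: "vcong (2 * m^2) (C *v e1) e1" by (simp add: C_def matrix_vector_mul_assoc)
  obtain t where t: "m dvd a * t" "[d = d' - a * t^2] (mod 2 * m)"
    using local_stabilizer_nf[OF pos(1) 1 2 3] by blast
  obtain r where r: "d = d' - a * t^2 + 2 * m * r" using t(2) by (metis cong_iff_lin cong_sym)
  obtain W where W: "W \<in> GL3Z" "W *v e1 = e1" "transpose W ** nf m a d' ** W = nf m a d"
    using nf_shift[OF t(1), of d' r] r by metis
  have "transpose (U ** W) ** nf m a d ** (U ** W) = nf m a d" using U(5) W(3) ma by (simp add: congr_mult)
  moreover have "U ** W \<in> GL3Z" by (rule GL3Z_mult[OF U(1) W(1)])
  moreover have "x = (U ** W) *v e1" using U(2) W(2) by (simp flip: matrix_vector_mul_assoc)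
  ultimately show "x \<in> orbit (nf m a d) e1" unfolding orbit_def OS_def by blast
qed

subsection \<open>Parametrization of the cone\<close>

text \<open>With D = 4 A C - B^2, the ellipse where the positive form A u^2 + B u v + C v^2 is at
  most T has area pi T / (sqrt D / 2). Dividing by R^2 selects one residue class, and
  \<open>primitive_factor\<close> its coprime pairs.\<close>

definition ellipse_density :: "int \<Rightarrow> real \<Rightarrow> real" where
  "ellipse_density R D = pi / (sqrt D / 2 * (of_int R)^2) * primitive_factor R"

lemma ellipse_density_pos: "R > 0 \<Longrightarrow> D > 0 \<Longrightarrow> ellipse_density R D > 0"
  unfolding ellipse_density_def using primitive_factor_pos by (intro mult_pos_pos divide_pos_pos) auto

definition primitive_reps :: "real \<Rightarrow> real \<Rightarrow> real \<Rightarrow> int \<Rightarrow> int \<Rightarrow> int \<Rightarrow> real \<Rightarrow> (int \<times> int) set" where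
  "primitive_reps A B C R r s T = {z. [fst z = r] (mod R) \<and> [snd z = s] (mod R) \<and> coprime (fst z) (snd z) \<and>
      A * (of_int (fst z))^2 + B * of_int (fst z) * of_int (snd z) + C * (of_int (snd z))^2 \<le> T}"

lemma primitive_reps_asymptotic:
  assumes A: "A > 0" and D: "4 * A * C - B^2 = D" "D > 0" and R: "R > 0" and r: "gcd r (gcd s R) = 1"
  shows "((\<lambda>T. real (card (primitive_reps A B C R r s T)) / T) \<longlongrightarrow> ellipse_density R D) at_top"
    and "T \<ge> 0 \<Longrightarrow> finite (primitive_reps A B C R r s T)"
proof -
  \<comment> \<open>Completing the square: M is chosen so that the squared norm of M z is the binary
    form, and the bound T becomes the size sqrt T.\<close>
  define M :: "real^2^2" where "M = vector [vector [sqrt A, B / (2 * sqrt A)], vector [0, sqrt (D / (4 * A))]]"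
  have "det M = sqrt A * sqrt (D / (4 * A))" by (simp add: M_def det_2)
  also have "\<dots> = sqrt (D / 4)" using A by (simp flip: real_sqrt_mult)
  also have "\<dots> = sqrt D / 2" by (simp add: real_sqrt_divide)
  finally have det: "det M = sqrt D / 2" .
  moreover have "sqrt D / 2 \<noteq> 0" using D by auto
  ultimately have M: "det M \<noteq> 0" by metis
  have norm: "(norm (M *v vec_of z))^2 = A * (of_int (fst z))^2 + B * of_int (fst z) * of_int (snd z) + C * (of_int (snd z))^2" for z
  proof -
    let ?u = "of_int (fst z) :: real" and ?v = "of_int (snd z) :: real"
    have "(norm (M *v vec_of z))^2 = (sqrt A * ?u + B / (2 * sqrt A) * ?v)^2 + (sqrt (D / (4 * A)) * ?v)^2"
      by (simp add: M_def norm_vec_def L2_set_def sum_2 matrix_vector_mult_def)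
    also have "(sqrt A * ?u + B / (2 * sqrt A) * ?v)^2 = A * ?u^2 + B * ?u * ?v + B^2 / (4 * A) * ?v^2"
      using A by (simp add: power2_sum power_mult_distrib power_divide field_simps)
    also have "(sqrt (D / (4 * A)) * ?v)^2 = D / (4 * A) * ?v^2" using A D by (simp add: power_mult_distrib)
    finally have "(norm (M *v vec_of z))^2 =
      A * ?u^2 + B * ?u * ?v + B^2 / (4 * A) * ?v^2 + D / (4 * A) * ?v^2" .
    moreover have "B^2 / (4 * A) * ?v^2 + D / (4 * A) * ?v^2 = C * ?v^2"
      using A unfolding D(1)[symmetric] by (simp add: field_simps)
    ultimately show ?thesis by linarith
  qed
  have eq: "primitive_reps A B C R r s T = primitive_points M R r s (sqrt T)" if "T \<ge> 0" for T
  proof -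
    have "norm (M *v vec_of z) \<le> sqrt T \<longleftrightarrow> (norm (M *v vec_of z))^2 \<le> T" for z
      using real_le_rsqrt sqrt_le_D that by (metis norm_ge_zero real_sqrt_le_iff real_sqrt_unique)
    then show ?thesis unfolding primitive_reps_def primitive_points_def lattice_points_def norm by auto
  qed
  have "((\<lambda>T. real (card (primitive_points M R r s (sqrt T))) / (sqrt T)^2) \<longlongrightarrow> pi / (\<bar>det M\<bar> * (of_int R)^2) * primitive_factor R) at_top"
    by (rule filterlim_compose[OF primitive_points_asymptotic[OF M R r] sqrt_at_top])
  moreover have "pi / (\<bar>det M\<bar> * (of_int R)^2) * primitive_factor R = ellipse_density R D" using D by (simp add: det ellipse_density_def)
  ultimately have "((\<lambda>T. real (card (primitive_points M R r s (sqrt T))) / (sqrt T)^2) \<longlongrightarrow> ellipse_density R D) at_top" by simp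
  then show "((\<lambda>T. real (card (primitive_reps A B C R r s T)) / T) \<longlongrightarrow> ellipse_density R D) at_top"
    by (rule Lim_transform_eventually)
       (rule eventually_mono[OF eventually_ge_at_top[of 0]], simp add: eq)
  show "finite (primitive_reps A B C R r s T)" if "T \<ge> 0"
  proof -
    obtain K where "\<And>r s t. t \<ge> 0 \<Longrightarrow> finite (lattice_points M R r s t)" using lattice_points_bounds[OF M R] by metis
    then have "finite (lattice_points M R r s (sqrt T))" using that by simp
    then show ?thesis unfolding eq[OF that] primitive_points_def by simp
  qed
qed

text \<open>Prescribing x2 : x3 = u : v, the equation 2 m x1 x3 = a x2^2 - d x3^2 determines x up to
  scaling; this is the solution with denominators cleared.\<close>

definition conic_point :: "int \<Rightarrow> int \<Rightarrow> int \<Rightarrow> int \<times> int \<Rightarrow> ivec3" where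
  "conic_point m a d z = vector [a * (fst z)^2 - d * (snd z)^2, 2 * m * fst z * snd z, 2 * m * (snd z)^2]"

text \<open>
  For coprime pairs the entry \<open>2 m a\<close> is redundant (\<open>dvd_conic_point_coprime\<close>); with it,
  the content depends only on the residue class of the pair.
\<close>
definition point_content :: "int \<Rightarrow> int \<Rightarrow> int \<Rightarrow> int \<times> int \<Rightarrow> int" where
  "point_content m a d z = gcd (gcd (conic_point m a d z $ 1) (gcd (conic_point m a d z $ 2) (conic_point m a d z $ 3))) (2 * m * a)"

definition primitive_point :: "int \<Rightarrow> int \<Rightarrow> int \<Rightarrow> int \<times> int \<Rightarrow> ivec3" where
  "primitive_point m a d z = (\<chi> i. conic_point m a d z $ i div point_content m a d z)"

lemma point_content_dvd: "point_content m a d z dvd conic_point m a d z $ i" "point_content m a d z dvd 2 * m * a"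
proof -
  have "point_content m a d z dvd conic_point m a d z $ 1 \<and> point_content m a d z dvd conic_point m a d z $ 2 \<and> point_content m a d z dvd conic_point m a d z $ 3"
    unfolding point_content_def by (meson dvd_trans gcd_dvd1 gcd_dvd2)
  then show "point_content m a d z dvd conic_point m a d z $ i" using exhaust_3[of i] by auto
  show "point_content m a d z dvd 2 * m * a" unfolding point_content_def by simp
qed

lemma conic_point_eq: "conic_point m a d z $ i = point_content m a d z * primitive_point m a d z $ i"
  using point_content_dvd(1) by (simp add: primitive_point_def)

lemma dvd_point_content_iff: "k dvd point_content m a d z \<longleftrightarrow> (\<forall>i. k dvd conic_point m a d z $ i) \<and> k dvd 2 * m * a"
  unfolding point_content_def by (auto simp: forall_3)

lemma point_content_pos: "m > 0 \<Longrightarrow> a > 0 \<Longrightarrow> point_content m a d z > 0"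
  unfolding point_content_def by (simp add: gcd_pos_int)

text \<open>From x u + y v = 1 and the last two coordinates, k divides 2 m v. The first coordinate
  then shows that it divides 2 m a u^2, and every term of 2 m a (x u + y v)^2 is a multiple of one
  of these.\<close>

lemma dvd_conic_point_coprime:
  assumes "coprime (fst z) (snd z)" "\<And>i. k dvd conic_point m a d z $ i" shows "k dvd 2 * m * a"
proof -
  let ?u = "fst z" and ?v = "snd z"
  obtain x y where xy: "x * ?u + y * ?v = 1" using assms(1) bezout_int[of ?u ?v] by auto
  have k: "k dvd a * ?u^2 - d * ?v^2" "k dvd 2 * m * ?u * ?v" "k dvd 2 * m * ?v^2"
    using assms(2)[of 1] assms(2)[of 2] assms(2)[of 3] by (simp_all add: conic_point_def)
  have "2 * m * ?v = x * (2 * m * ?u * ?v) + y * (2 * m * ?v^2)"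
    using arg_cong[OF xy, of "\<lambda>t. 2 * m * ?v * t"] by (simp add: algebra_simps power2_eq_square)
  then have v: "k dvd 2 * m * ?v" using k by (metis dvd_add dvd_mult)
  have "2 * m * a * ?u^2 = 2 * m * (a * ?u^2 - d * ?v^2) + d * ?v * (2 * m * ?v)"
    by (simp add: algebra_simps power2_eq_square)
  then have u: "k dvd 2 * m * a * ?u^2" using k v by (metis dvd_add dvd_mult)
  have "2 * m * a = 2 * m * a * (x * ?u + y * ?v)^2" using xy by simp
  also have "\<dots> = x^2 * (2 * m * a * ?u^2) + (2 * x * y * ?u * a + y^2 * ?v * a) * (2 * m * ?v)"
    by (simp add: algebra_simps power2_eq_square)
  finally show ?thesis using u v by (metis dvd_add dvd_mult)
qed

lemma primitive_point_primitive:
  assumes "coprime (fst z) (snd z)" "m > 0" "a > 0" shows "primitive_vec (primitive_point m a d z)"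
  unfolding primitive_vec_iff_unit
proof (intro allI impI)
  fix k assume k: "\<forall>i. k dvd primitive_point m a d z $ i"
  have "point_content m a d z * k dvd conic_point m a d z $ i" for i using k by (simp add: conic_point_eq)
  then have "point_content m a d z * k dvd point_content m a d z"
    unfolding dvd_point_content_iff using dvd_conic_point_coprime[OF assms(1)] by blast
  then show "k dvd 1" using point_content_pos[OF assms(2,3), of d z] by (metis dvd_mult_cancel_left mult.right_neutral less_irrefl)
qed

lemma qf_nf: "qf (nf m a d) x = 2 * m * (x$1 * x$3) - a * (x$2)^2 + d * (x$3)^2"
  for m :: int
  by (simp add: qf_def nfc_def sum_3 power2_eq_square algebra_simps)

lemma primitive_point_cone:
  assumes "coprime (fst z) (snd z)" "m > 0" "a > 0" shows "primitive_point m a d z \<in> cone (nf m a d)"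
proof -
  let ?c = "point_content m a d z" and ?p = "primitive_point m a d z"
  have "?c^2 * qf (nf m a d) ?p = 2 * m * ((?c * ?p$1) * (?c * ?p$3)) - a * (?c * ?p$2)^2 + d * (?c * ?p$3)^2"
    unfolding qf_nf by (simp add: algebra_simps power2_eq_square)
  also have "\<dots> = 0" unfolding conic_point_eq[symmetric] by (simp add: conic_point_def algebra_simps power2_eq_square)
  finally have "qf (nf m a d) ?p = 0" using point_content_pos[OF assms(2,3), of d z] by simp
  then show ?thesis using primitive_point_primitive[OF assms] by (simp add: cone_def)
qed

lemma primitive_dvd_multiple:
  assumes "primitive_vec x" "\<And>i. k dvd b * x$i" shows "k dvd b"
proof -
  have "k dvd b * gcd (x$2) (x$3)"
    using assms(2) by (metis gcd_mult_left gcd_greatest dvd_normalize_iff)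
  then have "k dvd b * gcd (x$1) (gcd (x$2) (x$3))"
    using assms(2) by (metis gcd_mult_left gcd_greatest dvd_normalize_iff)
  then show ?thesis using assms(1) by (simp add: primitive_vec_iff)
qed

lemma primitive_proportional:
  assumes "primitive_vec p" "primitive_vec x" "\<And>i. b * p$i = c * x$i" "b \<noteq> 0"
  shows "x = p \<or> x = - p"
proof -
  have "b dvd c" using primitive_dvd_multiple[OF assms(2)] assms(3) by (metis dvd_triv_left)
  moreover have "c dvd b" using primitive_dvd_multiple[OF assms(1)] assms(3) by (metis dvd_triv_left)
  ultimately have "\<bar>b\<bar> = \<bar>c\<bar>" by (metis zdvd_antisym_abs)
  then have "c = b \<or> c = - b" by linarith
  then show ?thesis
  proof
    assume "c = b" then show ?thesis using assms(3,4) by (simp add: vec_eq_iff)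
  next
    assume "c = - b"
    then have "b * p$i = b * (- x$i)" for i using assms(3)[of i] by simp
    then have "p$i = - x$i" for i using assms(4) by (metis mult_left_cancel)
    then show ?thesis by (simp add: vec_eq_iff)
  qed
qed

lemma cone_param:
  assumes x: "x \<in> cone (nf m a d)" and pos: "m > 0" "a > 0"
  obtains z where "coprime (fst z) (snd z)" "x = primitive_point m a d z \<or> x = - primitive_point m a d z"
proof -
  have px: "primitive_vec x" and q: "2 * m * (x$1 * x$3) - a * (x$2)^2 + d * (x$3)^2 = 0"
    using x by (auto simp: cone_def qf_nf)
  show ?thesis
  proof (cases "x$3 = 0")
    \<comment> \<open>Here x is a multiple of e1, which comes from the pair (1, 0).\<close>
    case True
    then have "x$2 = 0" using q pos by simp
    have "point_content m a d (1, 0) * primitive_point m a d (1,0) $ i * x$1 = a * x$i" for i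
      unfolding conic_point_eq[symmetric] using exhaust_3[of i] True \<open>x$2 = 0\<close> by (auto simp: conic_point_def)
    moreover have "x$1 \<noteq> 0" using px True \<open>x$2 = 0\<close> by (auto simp: primitive_vec_iff)
    ultimately have "x = primitive_point m a d (1,0) \<or> x = - primitive_point m a d (1,0)"
      using pos point_content_pos[OF pos, of d "(1,0)"] primitive_point_primitive[of "(1,0)" m a d]
      by (intro primitive_proportional[OF _ px, where b = "point_content m a d (1,0) * x$1" and c = a]) (auto simp: mult_ac)
    then show ?thesis using that[of "(1,0)"] by simp
  next
    case False
    define h where "h = gcd (x$2) (x$3)"
    obtain u v where uv: "x$2 = u * h" "x$3 = v * h" "coprime u v"
      unfolding h_def using gcd_coprime_exists[of "x$2" "x$3"] False by auto
    have h: "h \<noteq> 0" using False by (simp add: h_def)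
    have c: "h^2 * conic_point m a d (u, v) $ i = 2 * m * (x$3) * x$i" for i
    proof -
      have "h^2 * (a * u^2 - d * v^2) = a * (x$2)^2 - d * (x$3)^2"
        by (simp add: uv power2_eq_square algebra_simps)
      also have "\<dots> = 2 * m * x$3 * x$1" using q by (simp add: algebra_simps)
      finally have 1: "h^2 * (a * u^2 - d * v^2) = 2 * m * x$3 * x$1" .
      have 2: "h^2 * (2 * m * u * v) = 2 * m * x$3 * x$2" "h^2 * (2 * m * v^2) = 2 * m * x$3 * x$3"
        by (simp_all add: uv power2_eq_square)
      show ?thesis using exhaust_3[of i] 1 2 by (auto simp: conic_point_def)
    qed
    have "x = primitive_point m a d (u,v) \<or> x = - primitive_point m a d (u,v)"
      using h point_content_pos[OF pos, of d "(u,v)"] primitive_point_primitive[of "(u,v)" m a d] uv pos c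
      by (intro primitive_proportional[OF _ px, where b = "h^2 * point_content m a d (u,v)" and c = "2 * m * (x$3)"])
         (auto simp: conic_point_eq mult_ac)
    then show ?thesis using that[of "(u,v)"] uv by simp
  qed
qed

lemma cone_param_inj:
  assumes cop: "coprime (fst z) (snd z)" "coprime (fst z') (snd z')" and pos: "m > 0" "a > 0"
    and eq: "primitive_point m a d z = primitive_point m a d z'"
  shows "z' = z \<or> z' = - z"
proof -
  let ?u = "fst z" and ?v = "snd z" and ?u' = "fst z'" and ?v' = "snd z'"
  let ?c = "point_content m a d z" and ?c' = "point_content m a d z'"
  have c: "?c > 0" "?c' > 0" using point_content_pos[OF pos] by auto
  have e: "?c' * conic_point m a d z $ i = ?c * conic_point m a d z' $ i" for i unfolding conic_point_eq eq by simp
  have e2: "?c' * (?u * ?v) = ?c * (?u' * ?v')" and e3: "?c' * ?v^2 = ?c * ?v'^2"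
    using e[of 2] e[of 3] pos by (simp_all add: conic_point_def)
  have unit: "\<bar>x\<bar> = 1" if "coprime x (0::int)" for x using that by simp
  show ?thesis
  proof (cases "?v = 0")
    case True
    then have "?v' = 0" using e3 c by simp
    then have "\<bar>?u\<bar> = 1" "\<bar>?u'\<bar> = 1" using cop True unit by auto
    then show ?thesis using True \<open>?v' = 0\<close> by (auto simp: prod_eq_iff abs_if split: if_splits)
  next
    case False
    then have v': "?v' \<noteq> 0" using e3 c by auto
    have "?c * (?v'^2 * ?u * ?v) = (?c' * ?v^2) * (?u * ?v)" unfolding e3 by (simp add: mult_ac)
    also have "\<dots> = ?v^2 * (?c * (?u' * ?v'))" using e2 by (simp add: mult_ac)
    finally have "(?c * ?v * ?v') * (?v' * ?u) = (?c * ?v * ?v') * (?v * ?u')" by (simp add: power2_eq_square mult_ac)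
    then have cross: "?v' * ?u = ?v * ?u'" using False v' c by simp
    have "?v' dvd ?v * ?u'" unfolding cross[symmetric] by simp
    then have "?v' dvd ?v" using cop(2) by (simp add: coprime_dvd_mult_left_iff coprime_commute)
    moreover have "?v dvd ?v' * ?u" unfolding cross by simp
    then have "?v dvd ?v'" using cop(1) by (simp add: coprime_dvd_mult_left_iff coprime_commute)
    ultimately have "?v' = ?v \<or> ?v' = - ?v" by (metis abs_eq_iff zdvd_antisym_abs)
    then show ?thesis
    proof
      assume "?v' = ?v"
      then show ?thesis using cross False by (simp add: prod_eq_iff)
    next
      assume "?v' = - ?v"
      then have "?v * ?u' = ?v * (- ?u)" using cross by simp
      then have "?u' = - ?u" using False by (metis mult_left_cancel)
      then show ?thesis using \<open>?v' = - ?v\<close> by (simp add: prod_eq_iff)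
    qed
  qed
qed

lemma conic_point_cong:
  assumes "[fst z = fst z'] (mod R)" "[snd z = snd z'] (mod R)"
  shows "[conic_point m a d z $ i = conic_point m a d z' $ i] (mod R)"
  using exhaust_3[of i] assms by (auto simp: conic_point_def intro!: cong_diff cong_mult cong_pow)

text \<open>The content divides R, so it divides the coordinates at every congruent pair as
  well.\<close>

lemma point_content_cong:
  assumes "[fst z = fst z'] (mod R)" "[snd z = snd z'] (mod R)" "2 * m * a dvd R"
  shows "point_content m a d z = point_content m a d z'"
proof -
  have *: "point_content m a d z dvd point_content m a d z'"
    if "[fst z = fst z'] (mod R)" "[snd z = snd z'] (mod R)" for z z'
  proof -
    have "[conic_point m a d z $ i = conic_point m a d z' $ i] (mod point_content m a d z)" for i
      using conic_point_cong[OF that] dvd_trans[OF point_content_dvd(2) assms(3)] cong_dvd_modulus by blast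
    then show ?thesis unfolding dvd_point_content_iff[of _ m a d z'] using point_content_dvd by (metis cong_dvd_iff)
  qed
  show ?thesis
  proof (rule zdvd_antisym_nonneg)
    show "point_content m a d z dvd point_content m a d z'" "point_content m a d z' dvd point_content m a d z"
      using * assms(1,2) cong_sym by blast+
  qed (simp_all add: point_content_def)
qed

lemma primitive_point_cong:
  assumes "[fst z = fst z'] (mod q * (2 * m * a))" "[snd z = snd z'] (mod q * (2 * m * a))" and pos: "m > 0" "a > 0"
  shows "vcong q (primitive_point m a d z) (primitive_point m a d z')"
proof -
  have c: "point_content m a d z = point_content m a d z'" by (rule point_content_cong[OF assms(1,2)]) simp
  have "[primitive_point m a d z $ i = primitive_point m a d z' $ i] (mod q)" for i
  proof -
    have "[conic_point m a d z $ i = conic_point m a d z' $ i] (mod q * point_content m a d z)"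
      by (rule cong_dvd_modulus[OF conic_point_cong[OF assms(1,2)]]) (intro mult_dvd_mono dvd_refl point_content_dvd(2))
    then have "point_content m a d z * q dvd point_content m a d z * (primitive_point m a d z $ i - primitive_point m a d z' $ i)"
      unfolding cong_iff_dvd_diff conic_point_eq[of _ _ _ z] conic_point_eq[of _ _ _ z'] c by (simp add: algebra_simps)
    then show ?thesis using point_content_pos[OF pos, of d z] by (simp add: cong_iff_dvd_diff)
  qed
  then show ?thesis by (simp add: vcong_def)
qed

lemma primitive_point_minus: "primitive_point m a d (- z) = primitive_point m a d z"
  by (simp add: primitive_point_def conic_point_def point_content_def)

subsection \<open>Counting the orbit\<close>

text \<open>
  Division by the content, a divisor of \<open>2 m a\<close>, must leave congruences modulo \<open>2 m\<^sup>2\<close>.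
\<close>
definition residue_modulus :: "int \<Rightarrow> int \<Rightarrow> int" where
  "residue_modulus m a = 2 * m^2 * (2 * m * a)"

definition residues :: "int \<Rightarrow> int \<Rightarrow> int \<Rightarrow> (int \<times> int) set" where
  "residues m a d = {z \<in> {0..<residue_modulus m a} \<times> {0..<residue_modulus m a}.
     gcd (fst z) (gcd (snd z) (residue_modulus m a)) = 1 \<and> local_stab_reaches (2 * m^2) (nf m a d) (primitive_point m a d z)}"

text \<open>The factor \<open>1 / 2\<close> accounts for \<open>z\<close> and \<open>- z\<close> giving the same point of the cone.\<close>
definition kappa :: "int \<Rightarrow> int \<Rightarrow> int \<Rightarrow> real" where
  "kappa m a d = 1 / 2 * (\<Sum>z\<in>residues m a d. ellipse_density (residue_modulus m a) (16 * (of_int m)^2 * of_int a) * of_int (point_content m a d z))"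

lemma finite_residues: "finite (residues m a d)"
  unfolding residues_def by (rule finite_subset[of _ "{0..<residue_modulus m a} \<times> {0..<residue_modulus m a}"]) auto

lemma residue_modulus_pos: "m > 0 \<Longrightarrow> a > 0 \<Longrightarrow> residue_modulus m a > 0"
  by (simp add: residue_modulus_def)

lemma local_stab_reaches_cong:
  "local_stab_reaches q N x \<Longrightarrow> vcong q x x' \<Longrightarrow> local_stab_reaches q N x'"
  unfolding local_stab_reaches_def using vcong_trans by blast

lemma kappa_pos:
  assumes "m > 0" "a > 0" shows "kappa m a d > 0"
proof -
  have "residue_modulus m a = 4 * (m^2 * (m * a))" by (simp add: residue_modulus_def)
  moreover have "m^2 * (m * a) > 0" using assms by simp
  ultimately have R: "residue_modulus m a > 1" by linarith
  \<comment> \<open>The pair (1, 0) has content a and gives e1 itself, so at least one residue class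
    contributes.\<close>
  have "gcd a (2 * m * a) = normalize a" by (subst gcd_proj1_iff) simp
  then have c: "point_content m a d (1, 0) = a" using assms by (simp add: point_content_def conic_point_def)
  have "primitive_point m a d (1, 0) = e1" using assms by (simp add: primitive_point_def c conic_point_def e1_def mat3_simps)
  then have "local_stab_reaches (2 * m^2) (nf m a d) (primitive_point m a d (1, 0))"
    unfolding local_stab_reaches_def by (intro exI[of _ "mat 1"]) simp
  then have mem: "(1, 0) \<in> residues m a d" using R by (simp add: residues_def)
  have pos: "ellipse_density (residue_modulus m a) (16 * (of_int m)^2 * of_int a) * of_int (point_content m a d z) > 0" for z
    using assms R point_content_pos[OF assms, of d z] by (intro mult_pos_pos ellipse_density_pos) auto
  have "(\<Sum>z\<in>residues m a d. ellipse_density (residue_modulus m a) (16 * (of_int m)^2 * of_int a) * of_int (point_content m a d z)) > 0"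
    by (rule sum_pos[OF finite_residues]) (use mem pos in auto)
  then show ?thesis by (simp add: kappa_def)
qed

lemma pair_uminus: "pair (- x) y = - pair x y" "pair x (- y) = - pair x y"
  by (simp_all add: pair_def sum_negf)

lemma pair_conic_point:
  "pair (conic_point m a d z) y = (of_int a * y$1) * (of_int (fst z))^2 + (2 * of_int m * y$2) * of_int (fst z) * of_int (snd z)
     + (2 * of_int m * y$3 - of_int d * y$1) * (of_int (snd z))^2"
  by (simp add: pair_def conic_point_def sum_3 algebra_simps)

lemma pair_primitive_point: "of_int (point_content m a d z) * pair (primitive_point m a d z) y = pair (conic_point m a d z) y"
  by (simp add: pair_def conic_point_eq sum_distrib_left mult_ac)

lemma real_mat_nfc: "real_mat (nfc m a c d) = nfc (of_int m) (of_int a) (of_int c) (of_int d)"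
  by (simp add: real_mat_def nfc_def mat3_simps)

lemma qf_adj_nf: "qf (adj3 (real_mat (nf m a d))) y =
   - (of_int a * of_int d) * (y$1)^2 + 2 * of_int a * of_int m * y$1 * y$3 - (of_int m)^2 * (y$2)^2"
  by (simp add: real_mat_nfc adj3_nfc qf_def sum_3 power2_eq_square algebra_simps)

lemma card_double_cover:
  assumes "finite Z" "\<And>z. z \<in> Z \<Longrightarrow> card {x \<in> Z. f x = f z} = 2"
  shows "card Z = 2 * card (f ` Z)"
proof -
  have "card Z = (\<Sum>y\<in>f ` Z. \<Sum>x | x \<in> Z \<and> f x = y. 1)"
    using sum.image_gen[OF assms(1), of "\<lambda>_. 1::nat" f] by simp
  also have "\<dots> = (\<Sum>y\<in>f ` Z. 2)" using assms(2) by (intro sum.cong) auto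
  finally show ?thesis by simp
qed

text \<open>The condition y1 > 0 makes the binary form positive definite. Pairing with y is then
  positive on every \<open>primitive_point\<close>, so of x and - x only that one is
  counted.\<close>

lemma nf_count_pos:
  assumes sp: "special (nf m a d)" and pos: "m > 0" "a > 0" and y1: "y$1 > 0"
    and y: "qf (adj3 (real_mat (nf m a d))) y = 4 * of_int (m^2 * a)"
  shows "((\<lambda>T. real (card {x \<in> orbit (nf m a d) e1. 0 < pair x y \<and> pair x y \<le> T}) / T) \<longlongrightarrow> kappa m a d) at_top"
proof -
  define A where "A = of_int a * y$1"
  define B where "B = 2 * of_int m * y$2"
  define C where "C = 2 * of_int m * y$3 - of_int d * y$1"
  define D :: real where "D = 16 * (of_int m)^2 * of_int a"
  define R where "R = residue_modulus m a"
  define Q where "Q z = A * (of_int (fst z))^2 + B * of_int (fst z) * of_int (snd z) + C * (of_int (snd z))^2" for z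
  let ?N = "nf m a d" and ?c = "point_content m a d" and ?p = "primitive_point m a d"
  have R: "R > 0" unfolding R_def by (rule residue_modulus_pos[OF pos])
  have A: "A > 0" using pos y1 by (simp add: A_def)
  have D: "4 * A * C - B^2 = D" "D > 0"
  proof -
    have "4 * A * C - B^2 = 4 * qf (adj3 (real_mat ?N)) y"
      by (simp add: A_def B_def C_def qf_adj_nf power2_eq_square algebra_simps)
    then show "4 * A * C - B^2 = D" unfolding y by (simp add: D_def)
    show "D > 0" using pos by (simp add: D_def)
  qed
  have Qpos: "Q z > 0" if "z \<noteq> (0, 0)" for z
  proof -
    let ?u = "of_int (fst z) :: real" and ?v = "of_int (snd z) :: real"
    have e: "4 * A * Q z = (2 * A * ?u + B * ?v)^2 + D * ?v^2"
      unfolding D(1)[symmetric] Q_def by (simp add: power2_eq_square algebra_simps)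
    have "4 * A * Q z > 0"
    proof (cases "snd z = 0")
      case True
      then have "fst z \<noteq> 0" using that by (simp add: prod_eq_iff)
      then show ?thesis using A True by (simp add: e)
    next
      case False
      then have "D * ?v^2 > 0" using D(2) by simp
      then show ?thesis unfolding e by (intro add_nonneg_pos) auto
    qed
    then show ?thesis using A by (simp add: zero_less_mult_iff)
  qed
  have cpos: "?c z > 0" for z by (rule point_content_pos[OF pos])
  have pairQ: "pair (?p z) y = Q z / of_int (?c z)" for z
  proof -
    have "of_int (?c z) * pair (?p z) y = Q z" unfolding pair_primitive_point pair_conic_point by (simp add: Q_def A_def B_def C_def)
    then show ?thesis using cpos[of z] by (simp add: field_simps)
  qed
  have nz: "z \<noteq> (0, 0)" if "coprime (fst z) (snd z)" for z using that by auto
  \<comment> \<open>The bound is T times the content, because the pairing of y with the primitive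
    point is \<open>Q z\<close> divided by the content.\<close>
  define Z where "Z T = {z. coprime (fst z) (snd z) \<and> local_stab_reaches (2 * m^2) ?N (?p z) \<and> Q z \<le> T * of_int (?c z)}" for T
  let ?O = "\<lambda>T. {x \<in> orbit ?N e1. 0 < pair x y \<and> pair x y \<le> T}"
  let ?P = "\<lambda>i T. primitive_reps A B C R (fst i) (snd i) (T * of_int (?c i))"
  have img: "?p ` Z T = ?O T" for T
  proof (intro equalityI subsetI)
    fix x assume "x \<in> ?p ` Z T"
    then obtain z where z: "x = ?p z" "coprime (fst z) (snd z)" "local_stab_reaches (2 * m^2) ?N (?p z)" "Q z \<le> T * of_int (?c z)"
      by (auto simp: Z_def)
    have "x \<in> orbit ?N e1" using z orbit_nf_iff[OF sp pos primitive_point_cone[OF z(2) pos]] by simp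
    moreover have "0 < pair x y" unfolding z(1) pairQ using Qpos[OF nz[OF z(2)]] cpos[of z] by simp
    moreover have "pair x y \<le> T" unfolding z(1) pairQ using z(4) cpos[of z] by (simp add: pos_divide_le_eq)
    ultimately show "x \<in> ?O T" by simp
  next
    fix x assume x: "x \<in> ?O T"
    then have xc: "x \<in> cone ?N" using orbit_subset_cone[OF e1_cone] by blast
    obtain z where z: "coprime (fst z) (snd z)" "x = ?p z \<or> x = - ?p z" using cone_param[OF xc pos] by blast
    have "pair (?p z) y > 0" unfolding pairQ using Qpos[OF nz[OF z(1)]] cpos[of z] by simp
    then have xz: "x = ?p z" using z(2) x by (auto simp: pair_uminus)
    have "Q z \<le> T * of_int (?c z)" using x cpos[of z] by (simp add: xz pairQ pos_divide_le_eq)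
    moreover have "local_stab_reaches (2 * m^2) ?N (?p z)" using x orbit_nf_iff[OF sp pos xc] xz by simp
    ultimately show "x \<in> ?p ` Z T" using z(1) unfolding xz Z_def by blast
  qed
  have decomp: "Z T = (\<Union>i\<in>residues m a d. ?P i T)" for T
  proof -
    have key: "?c z = ?c i" "vcong (2 * m^2) (?p z) (?p i)"
      if "[fst z = fst i] (mod R)" "[snd z = snd i] (mod R)" for z i
      using point_content_cong[OF that, of m a d] primitive_point_cong[of z i "2 * m^2" m a d] that pos
      by (auto simp: R_def residue_modulus_def)
    show ?thesis
    proof (intro equalityI subsetI)
      fix z assume z: "z \<in> Z T"
      define i where "i = (fst z mod R, snd z mod R)"
      have i: "[fst z = fst i] (mod R)" "[snd z = snd i] (mod R)" by (simp_all add: i_def cong_def)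
      let ?g = "gcd (fst i) (gcd (snd i) R)"
      have "?g dvd fst i" "?g dvd snd i" "?g dvd R" by (meson dvd_trans gcd_dvd1 gcd_dvd2)+
      then have "?g dvd fst z" "?g dvd snd z" using i by (metis cong_dvd_iff cong_dvd_modulus)+
      then have "?g dvd 1" using z unfolding Z_def by (auto dest: coprime_common_divisor)
      then have "?g = 1" by simp
      moreover have "local_stab_reaches (2 * m^2) ?N (?p i)"
        using z local_stab_reaches_cong key(2)[OF i] by (auto simp: Z_def)
      moreover have "i \<in> {0..<R} \<times> {0..<R}" using R by (simp add: i_def)
      ultimately have "i \<in> residues m a d" unfolding residues_def R_def by blast
      moreover have "z \<in> ?P i T" using z i unfolding primitive_reps_def Z_def Q_def key(1)[OF i, symmetric] by simp
      ultimately show "z \<in> (\<Union>i\<in>residues m a d. ?P i T)" by blast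
    next
      fix z assume "z \<in> (\<Union>i\<in>residues m a d. ?P i T)"
      then obtain i where i: "i \<in> residues m a d" "z \<in> ?P i T" by blast
      then have c: "[fst z = fst i] (mod R)" "[snd z = snd i] (mod R)" by (auto simp: primitive_reps_def)
      have "local_stab_reaches (2 * m^2) ?N (?p z)"
        using i(1) local_stab_reaches_cong vcong_sym[OF key(2)[OF c]] by (auto simp: residues_def)
      then show "z \<in> Z T" using i(2) key(1)[OF c] by (auto simp: Z_def primitive_reps_def Q_def)
    qed
  qed
  have finP: "finite (?P i T)" if "i \<in> residues m a d" "T > 0" for i T
    using that cpos[of i] by (intro primitive_reps_asymptotic(2)[OF A D R]) (auto simp: residues_def R_def)
  have disj: "?P i T \<inter> ?P j T = {}" if "i \<in> residues m a d" "j \<in> residues m a d" "i \<noteq> j" for i j T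
  proof (rule ccontr)
    assume "?P i T \<inter> ?P j T \<noteq> {}"
    then obtain z where z: "z \<in> ?P i T" "z \<in> ?P j T" by blast
    then have "fst i mod R = fst j mod R" "snd i mod R = snd j mod R" by (auto simp: primitive_reps_def cong_def)
    moreover have "fst i mod R = fst i" "snd i mod R = snd i" "fst j mod R = fst j" "snd j mod R = snd j"
      using that(1,2) by (auto simp: residues_def R_def)
    ultimately show False using that(3) by (simp add: prod_eq_iff)
  qed
  have cardZ: "card (Z T) = (\<Sum>i\<in>residues m a d. card (?P i T))" and finZ: "finite (Z T)" if "T > 0" for T
  proof -
    have 1: "\<forall>i\<in>residues m a d. finite (?P i T)" using finP that by simp
    have 2: "\<forall>i\<in>residues m a d. \<forall>j\<in>residues m a d. i \<noteq> j \<longrightarrow> ?P i T \<inter> ?P j T = {}"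
      using disj by simp
    show "card (Z T) = (\<Sum>i\<in>residues m a d. card (?P i T))"
      unfolding decomp by (rule card_UN_disjoint[OF finite_residues 1 2])
    show "finite (Z T)" unfolding decomp by (rule finite_UN_I[OF finite_residues]) (use 1 in blast)
  qed
  have cardO: "card (Z T) = 2 * card (?O T)" if T: "T > 0" for T
    unfolding img[symmetric]
  proof (rule card_double_cover[OF finZ[OF T]])
    fix z assume z: "z \<in> Z T"
    then have cop: "coprime (fst z) (snd z)" by (simp add: Z_def)
    have "- z \<in> Z T" using z by (auto simp: Z_def primitive_point_minus Q_def point_content_def conic_point_def)
    have "x = z \<or> x = - z" if "x \<in> Z T" "?p x = ?p z" for x
      using cone_param_inj[OF cop, of x m a d] that pos by (simp add: Z_def)
    then have "{x \<in> Z T. ?p x = ?p z} = {z, - z}"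
      using z \<open>- z \<in> Z T\<close> by (auto simp only: primitive_point_minus)
    moreover have "z \<noteq> - z" using nz[OF cop] by (cases z) auto
    ultimately show "card {x \<in> Z T. ?p x = ?p z} = 2" by simp
  qed
  have "((\<lambda>T. 1 / 2 * (\<Sum>i\<in>residues m a d. real (card (?P i T)) / (T * of_int (?c i)) * of_int (?c i)))
     \<longlongrightarrow> 1 / 2 * (\<Sum>i\<in>residues m a d. ellipse_density R D * of_int (?c i))) at_top"
  proof (intro tendsto_mult tendsto_const tendsto_sum)
    fix i assume i: "i \<in> residues m a d"
    \<comment> \<open>Rescaling T by the content of the class is what makes the content a weight in
      \<open>kappa\<close>.\<close>
    have f: "filterlim (\<lambda>T::real. T * of_int (?c i)) at_top at_top"
    proof (rule filterlim_at_top_mult_tendsto_pos[OF tendsto_const _ filterlim_ident])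
      show "0 < real_of_int (?c i)" using cpos[of i] by simp
    qed
    have g: "gcd (fst i) (gcd (snd i) R) = 1" using i by (simp add: residues_def R_def)
    show "((\<lambda>T. real (card (?P i T)) / (T * of_int (?c i))) \<longlongrightarrow> ellipse_density R D) at_top"
      by (rule filterlim_compose[OF primitive_reps_asymptotic(1)[OF A D R g] f])
  qed
  then have lim: "((\<lambda>T. 1 / 2 * (\<Sum>i\<in>residues m a d. real (card (?P i T)) / (T * of_int (?c i)) * of_int (?c i)))
     \<longlongrightarrow> kappa m a d) at_top" by (simp only: kappa_def R_def D_def)
  have ev: "1 / 2 * (\<Sum>i\<in>residues m a d. real (card (?P i T)) / (T * of_int (?c i)) * of_int (?c i)) = real (card (?O T)) / T"
    if T: "T > 0" for T
  proof -
    have "(\<Sum>i\<in>residues m a d. real (card (?P i T)) / (T * of_int (?c i)) * of_int (?c i)) =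
      (\<Sum>i\<in>residues m a d. real (card (?P i T)) / T)"
    proof (rule sum.cong[OF refl])
      fix i
      show "real (card (?P i T)) / (T * of_int (?c i)) * of_int (?c i) = real (card (?P i T)) / T"
        using cpos[of i] T by (simp add: field_simps)
    qed
    also have "\<dots> = real (card (Z T)) / T" using cardZ[OF T] by (simp add: sum_divide_distrib)
    finally show ?thesis using cardO[OF T] by simp
  qed
  show ?thesis
    by (rule Lim_transform_eventually[OF lim]) (rule eventually_mono[OF eventually_gt_at_top[of 0]], rule ev)
qed

lemma orbit_uminus: "x' \<in> orbit S x \<Longrightarrow> - x' \<in> orbit S x"
proof -
  assume "x' \<in> orbit S x"
  then obtain A where A: "x' = A *v x" "A \<in> GL3Z" "transpose A ** S ** A = S" by (auto simp: orbit_def OS_def)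
  have "- A \<in> GL3Z" using A(2) by (simp add: GL3Z_iff det_3 algebra_simps)
  moreover have "transpose (- A) ** S ** (- A) = transpose A ** S ** A"
    by (simp add: mat3_simps algebra_simps)
  then have "transpose (- A) ** S ** (- A) = S" using A(3) by simp
  moreover have "- x' = (- A) *v x" by (simp add: A(1) mat3_simps algebra_simps)
  ultimately show ?thesis unfolding orbit_def OS_def by blast
qed

text \<open>The vector y is quantified inside, so k cannot depend on it. This also makes the notion
  stable under base changes, which move y.\<close>

definition orbit_density :: "imat3 \<Rightarrow> ivec3 \<Rightarrow> real \<Rightarrow> bool" where
  "orbit_density S x k \<longleftrightarrow> (\<forall>y. qf (adj3 (real_mat S)) y = 4 * of_int (det S) \<longrightarrow>
     ((\<lambda>T. real (card {x' \<in> orbit S x. 0 < pair x' y \<and> pair x' y \<le> T}) / T) \<longlongrightarrow> k) at_top)"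

text \<open>For y1 = 0 the adjugate form at y is - m^2 y2^2, which cannot be positive. The case y1 <
  0 reduces to y1 > 0 because - 1 is an isometry, so orbits are symmetric.\<close>

lemma orbit_density_nf:
  assumes sp: "special (nf m a d)" and pos: "m > 0" "a > 0"
  shows "orbit_density (nf m a d) e1 (kappa m a d)"
  unfolding orbit_density_def det_nfc
proof (intro allI impI)
  fix y :: "real^3"
  assume y: "qf (adj3 (real_mat (nf m a d))) y = 4 * of_int (m^2 * a)"
  consider "y$1 > 0" | "y$1 < 0" | "y$1 = 0" by linarith
  then show "((\<lambda>T. real (card {x' \<in> orbit (nf m a d) e1. 0 < pair x' y \<and> pair x' y \<le> T}) / T) \<longlongrightarrow> kappa m a d) at_top"
  proof cases
    case 1 then show ?thesis using nf_count_pos[OF sp pos _ y] by blast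
  next
    case 2
    have "qf (adj3 (real_mat (nf m a d))) (- y) = 4 * of_int (m^2 * a)" using y by (simp add: qf_adj_nf)
    then have lim: "((\<lambda>T. real (card {x' \<in> orbit (nf m a d) e1. 0 < pair x' (- y) \<and> pair x' (- y) \<le> T}) / T) \<longlongrightarrow> kappa m a d) at_top"
      using nf_count_pos[OF sp pos, of "- y"] 2 by simp
    have "{x' \<in> orbit (nf m a d) e1. 0 < pair x' y \<and> pair x' y \<le> T} =
        uminus ` {x' \<in> orbit (nf m a d) e1. 0 < pair x' (- y) \<and> pair x' (- y) \<le> T}" for T
    proof (intro equalityI subsetI)
      fix x assume "x \<in> {x' \<in> orbit (nf m a d) e1. 0 < pair x' y \<and> pair x' y \<le> T}"
      then have "- x \<in> {x' \<in> orbit (nf m a d) e1. 0 < pair x' (- y) \<and> pair x' (- y) \<le> T}"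
        using orbit_uminus by (simp add: pair_uminus)
      then show "x \<in> uminus ` {x' \<in> orbit (nf m a d) e1. 0 < pair x' (- y) \<and> pair x' (- y) \<le> T}"
        by (intro image_eqI[of _ _ "- x"]) simp_all
    qed (auto simp: pair_uminus orbit_uminus)
    then have "card {x' \<in> orbit (nf m a d) e1. 0 < pair x' y \<and> pair x' y \<le> T} =
        card {x' \<in> orbit (nf m a d) e1. 0 < pair x' (- y) \<and> pair x' (- y) \<le> T}" for T
      by (simp add: card_image)
    then show ?thesis using lim by simp
  next
    case 3
    have "qf (adj3 (real_mat (nf m a d))) y \<le> 0" using 3 by (simp add: qf_adj_nf)
    moreover have "m^2 * a > 0" using pos by simp
    then have "4 * real_of_int (m^2 * a) > 0" by (simp only: of_int_0_less_iff zero_less_mult_iff zero_less_numeral) simp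
    ultimately show ?thesis using y by linarith
  qed
qed

section \<open>Transport along integral base changes\<close>

lemma pair_mult: "pair (U *v x) y = pair x (transpose (real_mat U) *v y)"
  by (simp add: pair_def mat3_simps real_mat_def algebra_simps)

text \<open>To preserve pairings, y has to move by the transpose of U; the normalization of y
  survives because det U squares to 1.\<close>

lemma adj_quadratic_congr:
  fixes U S :: "'a::comm_ring_1^3^3"
  shows "qf (adj3 (transpose U ** S ** U)) (transpose U *v y) = (det U)^2 * qf (adj3 S) y"
proof -
  have e: "adj3 (transpose U ** S ** U) = adj3 U ** adj3 S ** transpose (adj3 U)"
    by (simp add: adj3_mult adj3_transpose matrix_mul_assoc)
  have "qf (adj3 (transpose U ** S ** U)) (transpose U *v y) =
     qf (transpose (transpose U) ** (adj3 U ** adj3 S ** transpose (adj3 U)) ** transpose U) y"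
    by (simp only: qf_mult e)
  also have "transpose (transpose U) ** (adj3 U ** adj3 S ** transpose (adj3 U)) ** transpose U =
     (U ** adj3 U) ** adj3 S ** transpose (U ** adj3 U)"
    by (simp add: matrix_transpose_mul matrix_mul_assoc)
  also have "qf \<dots> y = (det U)^2 * qf (adj3 S) y"
    unfolding mult_adj3 by (simp add: qf_def mat3_simps power2_eq_square algebra_simps)
  finally show ?thesis .
qed

lemma orbit_congr:
  assumes U: "U \<in> GL3Z"
  shows "orbit S (U *v e) = (\<lambda>v. U *v v) ` orbit (transpose U ** S ** U) e"
proof -
  obtain V where V: "V \<in> GL3Z" "U ** V = mat 1" "V ** U = mat 1" using GL3Z_inverse[OF U] by metis
  show ?thesis
  proof (intro equalityI subsetI)
    fix x assume "x \<in> orbit S (U *v e)"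
    then obtain A where A: "x = A *v (U *v e)" "A \<in> GL3Z" "transpose A ** S ** A = S"
      by (auto simp: orbit_def OS_def)
    let ?B = "V ** A ** U"
    have "U ** ?B = A ** U" by (simp add: matrix_mul_assoc V)
    then have "transpose ?B ** (transpose U ** S ** U) ** ?B = transpose (A ** U) ** S ** (A ** U)"
      by (metis congr_mult)
    also have "\<dots> = transpose U ** S ** U" by (simp only: congr_mult A(3))
    finally have "?B \<in> OS (transpose U ** S ** U)"
      using GL3Z_mult[OF GL3Z_mult[OF V(1) A(2)] U] by (simp add: OS_def)
    moreover have "x = U *v (?B *v e)"
      using A(1) by (simp add: matrix_vector_mul_assoc matrix_mul_assoc V)
    ultimately show "x \<in> (\<lambda>v. U *v v) ` orbit (transpose U ** S ** U) e" unfolding orbit_def by blast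
  next
    fix x assume "x \<in> (\<lambda>v. U *v v) ` orbit (transpose U ** S ** U) e"
    then obtain B where B: "x = U *v (B *v e)" "B \<in> GL3Z"
      "transpose B ** (transpose U ** S ** U) ** B = transpose U ** S ** U"
      by (auto simp: orbit_def OS_def)
    let ?A = "U ** B ** V"
    have "transpose ?A ** S ** ?A = transpose V ** (transpose B ** (transpose U ** S ** U) ** B) ** V"
      by (simp only: congr_mult)
    also have "\<dots> = transpose (U ** V) ** S ** (U ** V)" unfolding B(3) by (simp only: congr_mult)
    also have "\<dots> = S" by (simp add: V)
    finally have "?A \<in> OS S" using GL3Z_mult[OF GL3Z_mult[OF U B(2)] V(1)] by (simp add: OS_def)
    moreover have "x = ?A *v (U *v e)"
      using B(1) V(3) by (simp add: matrix_vector_mul_assoc flip: matrix_mul_assoc)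
    ultimately show "x \<in> orbit S (U *v e)" unfolding orbit_def by blast
  qed
qed

lemma orbit_density_congr:
  assumes U: "U \<in> GL3Z" and k: "orbit_density (transpose U ** S ** U) e k"
  shows "orbit_density S (U *v e) k"
  unfolding orbit_density_def
proof (intro allI impI)
  fix y assume y: "qf (adj3 (real_mat S)) y = 4 * of_int (det S)"
  define y' where "y' = transpose (real_mat U) *v y"
  have d: "det U * det U = 1" by (rule det_GL3Z[OF U])
  then have "(det (real_mat U))^2 = 1" unfolding real_mat_det power2_eq_square by (metis of_int_1 of_int_mult)
  then have "qf (adj3 (real_mat (transpose U ** S ** U))) y' = 4 * of_int (det S)"
    unfolding y'_def real_mat_mult real_mat_transpose adj_quadratic_congr using y by simp
  moreover have "det (transpose U ** S ** U) = (det U * det U) * det S" by (simp add: det_mul)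
  then have "det (transpose U ** S ** U) = det S" using d by simp
  ultimately have lim: "((\<lambda>T. real (card {x' \<in> orbit (transpose U ** S ** U) e. 0 < pair x' y' \<and> pair x' y' \<le> T}) / T) \<longlongrightarrow> k) at_top"
    using k unfolding orbit_density_def by simp
  obtain V where V: "V ** U = mat 1" using GL3Z_inverse[OF U] by metis
  have inj: "inj (\<lambda>v. U *v v)"
    by (rule inj_on_inverseI[of _ "\<lambda>v. V *v v"]) (simp add: matrix_vector_mul_assoc V)
  have "{x' \<in> orbit S (U *v e). 0 < pair x' y \<and> pair x' y \<le> T} =
    (\<lambda>v. U *v v) ` {x' \<in> orbit (transpose U ** S ** U) e. 0 < pair x' y' \<and> pair x' y' \<le> T}" for T
    unfolding orbit_congr[OF U] by (auto simp: pair_mult y'_def)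
  then have "card {x' \<in> orbit S (U *v e). 0 < pair x' y \<and> pair x' y \<le> T} =
    card {x' \<in> orbit (transpose U ** S ** U) e. 0 < pair x' y' \<and> pair x' y' \<le> T}" for T
    using inj by (simp add: card_image inj_on_subset)
  then show "((\<lambda>T. real (card {x' \<in> orbit S (U *v e). 0 < pair x' y \<and> pair x' y \<le> T}) / T) \<longlongrightarrow> k) at_top"
    using lim by simp
qed

section \<open>Replacing d by w^2 d\<close>

lemma mat_mult_commute:
  fixes X :: "'a::comm_ring_1^3^3" shows "mat c ** X = X ** mat c"
  by (simp add: mat3_simps mult.commute)

text \<open>An isometry B of N' also preserves c N', which is the transform of N by J modulo q. Its
  conjugate by J is therefore an isometry of N, and it sends e1 to J x because J and K fix
  e1.\<close>

lemma local_stab_reaches_similitude: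
  assumes JK: "mcong q (J ** K) (mat 1)" and J: "J *v e1 = e1" "K *v e1 = e1"
    and sim: "mcong q (transpose J ** N ** J) (mat c ** N')"
    and cop: "coprime (det J) q" "coprime (det K) q"
    and x: "local_stab_reaches q N' x"
  shows "local_stab_reaches q N (J *v x)"
proof -
  obtain B where B: "coprime (det B) q" "mcong q (transpose B ** N' ** B) N'" "vcong q (B *v e1) x"
    using x unfolding local_stab_reaches_def by blast
  let ?C = "J ** B ** K"
  have JKN: "mcong q (transpose K ** (transpose J ** N ** J) ** K) N"
  proof -
    have "mcong q (transpose (J ** K) ** N ** (J ** K)) (transpose (mat 1) ** N ** mat 1)"
      by (intro mcong_mult mcong_transpose JK mcong_refl)
    then show ?thesis by (simp add: congr_mult)
  qed
  have "mcong q (transpose B ** (transpose J ** N ** J) ** B) (transpose B ** (mat c ** N') ** B)"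
    by (intro mcong_mult sim mcong_refl)
  also have "transpose B ** (mat c ** N') ** B = mat c ** (transpose B ** N' ** B)"
    by (metis mat_mult_commute matrix_mul_assoc)
  also have "mcong q \<dots> (mat c ** N')" by (intro mcong_mult mcong_refl B(2))
  also have "mcong q \<dots> (transpose J ** N ** J)" by (rule mcong_sym[OF sim])
  finally have "mcong q (transpose B ** (transpose J ** N ** J) ** B) (transpose J ** N ** J)" .
  then have "mcong q (transpose K ** (transpose B ** (transpose J ** N ** J) ** B) ** K) (transpose K ** (transpose J ** N ** J) ** K)"
    by (rule mcong_mult[OF mcong_mult[OF mcong_refl] mcong_refl])
  also note JKN
  finally have "mcong q (transpose ?C ** N ** ?C) N" by (simp only: congr_mult)
  moreover have "coprime (det ?C) q" using cop B(1) by (simp add: det_mul)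
  moreover have "vcong q (J *v (B *v e1)) (J *v x)" by (intro vcong_mult mcong_refl B(3))
  then have "vcong q (?C *v e1) (J *v x)" using J(2) by (simp flip: matrix_vector_mul_assoc)
  ultimately show ?thesis unfolding local_stab_reaches_def by blast
qed

text \<open>In w^2 d v'^2 only the product w v' matters, so passing to (u, v') with w v' = v
  reproduces the old point up to the factors 1, w, w^2 on its coordinates.\<close>

lemma conic_point_scale:
  assumes "fst z' = fst z" "[w * snd z' = snd z] (mod R)"
  shows "[conic_point m a (w^2 * d) z' $ 1 = conic_point m a d z $ 1] (mod R)"
    "[w * conic_point m a (w^2 * d) z' $ 2 = conic_point m a d z $ 2] (mod R)"
    "[w^2 * conic_point m a (w^2 * d) z' $ 3 = conic_point m a d z $ 3] (mod R)"
proof -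
  have "[a * (fst z)^2 - d * (w * snd z')^2 = a * (fst z)^2 - d * (snd z)^2] (mod R)"
    "[2 * m * fst z * (w * snd z') = 2 * m * fst z * snd z] (mod R)"
    "[2 * m * (w * snd z')^2 = 2 * m * (snd z)^2] (mod R)"
    by (intro cong_diff cong_mult cong_pow assms(2) cong_refl)+
  then show "[conic_point m a (w^2 * d) z' $ 1 = conic_point m a d z $ 1] (mod R)"
    "[w * conic_point m a (w^2 * d) z' $ 2 = conic_point m a d z $ 2] (mod R)"
    "[w^2 * conic_point m a (w^2 * d) z' $ 3 = conic_point m a d z $ 3] (mod R)"
    by (simp_all add: conic_point_def assms(1) power_mult_distrib mult_ac)
qed

lemma point_content_scale:
  assumes z: "fst z' = fst z" "[w * snd z' = snd z] (mod R)" and w: "coprime w R" and R: "2 * m * a dvd R"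
  shows "point_content m a (w^2 * d) z' = point_content m a d z"
proof -
  have iff: "(\<forall>i. k dvd conic_point m a (w^2 * d) z' $ i) \<longleftrightarrow> (\<forall>i. k dvd conic_point m a d z $ i)" if k: "k dvd 2 * m * a" for k
  proof -
    have kR: "k dvd R" using k R by (rule dvd_trans)
    have cop: "coprime k w" using w kR coprime_divisors[of k R w w] by (simp add: coprime_commute)
    have "k dvd conic_point m a (w^2 * d) z' $ 1 \<longleftrightarrow> k dvd conic_point m a d z $ 1"
      "k dvd w * conic_point m a (w^2 * d) z' $ 2 \<longleftrightarrow> k dvd conic_point m a d z $ 2"
      "k dvd w^2 * conic_point m a (w^2 * d) z' $ 3 \<longleftrightarrow> k dvd conic_point m a d z $ 3"
      by (rule cong_dvd_iff[OF cong_dvd_modulus[OF _ kR]], rule conic_point_scale[OF z])+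
    then show ?thesis using cop by (simp add: forall_3 coprime_dvd_mult_right_iff)
  qed
  show ?thesis
  proof (rule zdvd_antisym_nonneg)
    show "point_content m a (w^2 * d) z' dvd point_content m a d z" "point_content m a d z dvd point_content m a (w^2 * d) z'"
      unfolding dvd_point_content_iff using iff point_content_dvd by blast+
  qed (simp_all add: point_content_def)
qed

lemma local_stab_reaches_scale:
  assumes z: "fst z' = fst z" "[w * snd z' = snd z] (mod R)" and w: "coprime w R"
    and R: "R = q * (2 * m * a)" and pos: "m > 0" "a > 0"
  shows "local_stab_reaches q (nf m a (w^2 * d)) (primitive_point m a (w^2 * d) z') \<longleftrightarrow> local_stab_reaches q (nf m a d) (primitive_point m a d z)"
proof -
  have cop: "coprime w q" using w R by simp
  obtain v where v: "[w * v = 1] (mod q)" using cong_solve_coprime_int[OF cop] by blast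
  then have copv: "coprime v q" using cong_imp_coprime[OF cong_sym[OF v]] by simp
  (* modulo q, a similitude of factor w^2 from nf m a (w^2 * d) to nf m a d which fixes e1 *)
  define J :: imat3 where "J = vector [vector [1, 0, 0], vector [0, w, 0], vector [0, 0, w^2]]"
  define K :: imat3 where "K = vector [vector [1, 0, 0], vector [0, v, 0], vector [0, 0, v^2]]"
  have v2: "[w^2 * v^2 = 1] (mod q)" using cong_pow[OF v, of 2] by (simp add: power_mult_distrib)
  have JK: "mcong q (J ** K) (mat 1)" "mcong q (K ** J) (mat 1)"
    using v v2 by (auto simp: mcong_def J_def K_def mat3_simps mult.commute)
  have e: "J *v e1 = e1" "K *v e1 = e1" by (simp_all add: J_def K_def e1_def mat3_simps)
  have dets: "coprime (det J) q" "coprime (det K) q" using cop copv by (simp_all add: J_def K_def det_3)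
  have sim1: "mcong q (transpose J ** nf m a d ** J) (mat (w^2) ** nf m a (w^2 * d))"
  proof -
    have "transpose J ** nf m a d ** J = mat (w^2) ** nf m a (w^2 * d)"
      by (simp add: J_def nfc_def mat3_simps power2_eq_square mult_ac)
    then show ?thesis by simp
  qed
  have sim2: "mcong q (transpose K ** nf m a (w^2 * d) ** K) (mat (v^2) ** nf m a d)"
  proof -
    have "[(w^2 * v^2) * (v^2 * d) = 1 * (v^2 * d)] (mod q)" by (intro cong_mult v2 cong_refl)
    then have "[v^2 * (w^2 * d) * v^2 = v^2 * d] (mod q)" by (simp add: mult_ac)
    then show ?thesis
      unfolding mcong_def by (simp add: K_def nfc_def mat3_simps power2_eq_square mult_ac)
  qed
  have c: "point_content m a (w^2 * d) z' = point_content m a d z" by (rule point_content_scale[OF z w]) (simp add: R)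
  let ?c = "point_content m a d z"
  \<comment> \<open>Both points have the same content, a divisor of 2 m a; cancelling it turns
    congruences modulo R into congruences modulo q.\<close>
  have canc: "[x = y] (mod q)" if "[?c * x = ?c * y] (mod R)" for x y
  proof -
    have "[?c * x = ?c * y] (mod q * ?c)"
      using that unfolding R by (rule cong_dvd_modulus) (intro mult_dvd_mono dvd_refl point_content_dvd(2))
    then have "?c * q dvd ?c * (x - y)" by (simp add: cong_iff_dvd_diff algebra_simps)
    then show ?thesis using point_content_pos[OF pos, of d z] by (simp add: cong_iff_dvd_diff)
  qed
  have "[(J *v primitive_point m a (w^2 * d) z') $ i = primitive_point m a d z $ i] (mod q)" for i
  proof -
    note s = conic_point_scale[OF z, of m a d, unfolded conic_point_eq c]
    have "[primitive_point m a (w^2 * d) z' $ 1 = primitive_point m a d z $ 1] (mod q)"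
      "[w * primitive_point m a (w^2 * d) z' $ 2 = primitive_point m a d z $ 2] (mod q)"
      "[w^2 * primitive_point m a (w^2 * d) z' $ 3 = primitive_point m a d z $ 3] (mod q)"
      using s by (auto intro!: canc simp: mult_ac)
    then show ?thesis using exhaust_3[of i] by (auto simp: J_def mat3_simps)
  qed
  then have to: "vcong q (J *v primitive_point m a (w^2 * d) z') (primitive_point m a d z)" by (simp add: vcong_def)
  have "vcong q (K *v primitive_point m a d z) (K *v (J *v primitive_point m a (w^2 * d) z'))"
    by (intro vcong_mult mcong_refl vcong_sym[OF to])
  also have "vcong q (K *v (J *v primitive_point m a (w^2 * d) z')) (mat 1 *v primitive_point m a (w^2 * d) z')"
    unfolding matrix_vector_mul_assoc by (intro vcong_mult JK vcong_refl)
  finally have frm: "vcong q (K *v primitive_point m a d z) (primitive_point m a (w^2 * d) z')" by simp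
  show ?thesis
    using local_stab_reaches_similitude[OF JK(1) e sim1 dets] to
      local_stab_reaches_similitude[OF JK(2) e(2,1) sim2 dets(2,1)] frm local_stab_reaches_cong by blast
qed

text \<open>Multiplying the second coordinate by the inverse v of w modulo R matches the residues
  for d with those for w^2 d and keeps the contents. The remaining factor
  \<open>ellipse_density\<close> involves m and a only.\<close>

lemma kappa_scale:
  assumes pos: "m > 0" "a > 0" and w: "coprime w (residue_modulus m a)"
  shows "kappa m a (w^2 * d) = kappa m a d"
proof -
  define R where "R = residue_modulus m a"
  have R: "R > 0" "R = 2 * m^2 * (2 * m * a)" using residue_modulus_pos[OF pos] by (simp_all add: R_def residue_modulus_def)
  have wR: "coprime w R" using w by (simp add: R_def)
  obtain v where v: "[w * v = 1] (mod R)" using cong_solve_coprime_int[OF wR] by blast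
  define f where "f z = (fst z, (v * snd z) mod R)" for z :: "int \<times> int"
  define g where "g z = (fst z, (w * snd z) mod R)" for z :: "int \<times> int"
  have vw: "(w * (v * x mod R)) mod R = x mod R" "(v * (w * x mod R)) mod R = x mod R" for x
  proof -
    have "[w * v * x = 1 * x] (mod R)" by (intro cong_mult v cong_refl)
    then show "(w * (v * x mod R)) mod R = x mod R" "(v * (w * x mod R)) mod R = x mod R"
      by (simp_all add: cong_def mod_mult_right_eq mult_ac)
  qed
  have rel: "z \<in> residues m a d \<longleftrightarrow> z' \<in> residues m a (w^2 * d)"
    if z: "fst z' = fst z" "[w * snd z' = snd z] (mod R)" "snd z \<in> {0..<R}" "snd z' \<in> {0..<R}" for z z'
  proof -
    have "gcd (snd z) R = gcd (w * snd z') R" using z(2) by (metis cong_gcd_eq)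
    also have "\<dots> = gcd (snd z') R" using wR by (simp add: gcd_mult_left_left_cancel coprime_commute)
    finally have "gcd (snd z) R = gcd (snd z') R" .
    then show ?thesis
      using local_stab_reaches_scale[OF z(1,2) wR R(2) pos, of d] z
      unfolding residues_def R_def[symmetric] by (cases z; cases z') simp
  qed
  let ?h = "\<lambda>x. ellipse_density (residue_modulus m a) (16 * (of_int m)^2 * of_int a) * of_int x"
  have rng: "snd z \<in> {0..<R}" if "z \<in> residues m a d'" for z d' using that by (auto simp: residues_def R_def)
  have fr: "fst (f z) = fst z" "[w * snd (f z) = snd z] (mod R)" "snd (f z) \<in> {0..<R}" for z
    using R(1) by (simp_all add: f_def cong_def vw)
  have gr: "fst z = fst (g z)" "[w * snd z = snd (g z)] (mod R)" "snd (g z) \<in> {0..<R}" for z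
    using R(1) by (simp_all add: g_def cong_def)
  have "(\<Sum>z\<in>residues m a d. ?h (point_content m a d z)) = (\<Sum>z\<in>residues m a (w^2 * d). ?h (point_content m a (w^2 * d) z))"
  proof (rule sum.reindex_bij_witness[of _ g f])
    fix z assume z: "z \<in> residues m a d"
    show "g (f z) = z" using rng[OF z] by (simp add: f_def g_def vw prod_eq_iff)
    show "f z \<in> residues m a (w^2 * d)" using rel[OF fr(1,2) rng[OF z] fr(3)] z by simp
    show "?h (point_content m a (w^2 * d) (f z)) = ?h (point_content m a d z)"
      using point_content_scale[OF fr(1,2) wR, of m a d] R(2) by simp
  next
    fix z assume z: "z \<in> residues m a (w^2 * d)"
    show "f (g z) = z" using rng[OF z] by (simp add: f_def g_def vw prod_eq_iff)
    show "g z \<in> residues m a d" using rel[OF gr(1,2,3) rng[OF z]] z by simp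
  qed
  then show ?thesis by (simp add: kappa_def)
qed

text \<open>The form S' pointed at x has the same m and a as S. Its corner d' differs from some w^2
  d0 by a shear, an integral equivalence fixing e1, and \<open>kappa_scale\<close> accounts for
  w.\<close>

lemma genus_orbit_density:
  assumes S: "special S" and pos: "m > 0" "a > 0" and U0: "U0 \<in> GL3Z" "transpose U0 ** S ** U0 = nf m a d0"
    and S': "S' \<in> genus S" and x: "x \<in> cone S'"
  shows "orbit_density S' x (kappa m a d0)"
proof -
  have sym: "sym_mat S" "det S > 0" using S by (auto simp: special_def)
  have loc: "locally_equiv S S'" by (rule genus_locally_equiv[OF S'])
  have sp': "special S'" by (rule special_locally_equiv[OF S loc genus_sym_det[OF S' sym] x])
  obtain U m' a' d' where U: "U \<in> GL3Z" "U *v e1 = x" "m' > 0" "a' > 0" "transpose U ** S' ** U = nf m' a' d'"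
    using nf_exists[OF sp' x] by blast
  have s0: "special (nf m a d0)" using special_congr[OF S U0(1)] U0(2) by simp
  have s1: "special (nf m' a' d')" using special_congr[OF sp' U(1)] U(5) by simp
  have le: "locally_equiv (nf m a d0) (nf m' a' d')"
    using locally_equiv_trans[OF locally_equiv_sym[OF locally_equiv_GL3Z[OF U0(1), of S]]
        locally_equiv_trans[OF loc locally_equiv_GL3Z[OF U(1)]]] U0(2) U(5) by simp
  have "det (nf m a d0) = det (nf m' a' d')"
    using s0 s1 by (intro locally_equiv_det[OF le]) (auto simp: special_def)
  then have ma: "m' = m" "a' = a" using nf_unique[OF s0 s1 pos U(3,4) locally_equiv_Omega[OF le]] by auto
  have "2 * m dvd residue_modulus m a" by (simp add: residue_modulus_def power2_eq_square)
  then obtain w t where w: "coprime w (residue_modulus m a)" "m dvd a * t" "[d' = w^2 * d0 - a * t^2] (mod 2 * m)"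
    using nf_genus_global[OF s0 s1[unfolded ma] pos le[unfolded ma] residue_modulus_pos[OF pos]] by blast
  obtain r where r: "d' = w^2 * d0 - a * t^2 + 2 * m * r" using w(3) by (metis cong_iff_lin cong_sym)
  obtain W where W: "W \<in> GL3Z" "W *v e1 = e1" "transpose W ** nf m a (w^2 * d0) ** W = nf m a d'"
    using nf_shift[OF w(2), of "w^2 * d0" r] r by metis
  obtain V where V: "V \<in> GL3Z" "W ** V = mat 1" "V ** W = mat 1" using GL3Z_inverse[OF W(1)] by metis
  have "transpose V ** nf m a d' ** V = transpose (W ** V) ** nf m a (w^2 * d0) ** (W ** V)"
    by (simp only: congr_mult W(3))
  then have Vnf: "transpose V ** nf m a d' ** V = nf m a (w^2 * d0)" by (simp add: V)
  have Ve: "V *v e1 = e1" by (subst W(2)[symmetric]) (simp add: matrix_vector_mul_assoc V)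
  \<comment> \<open>The corner w^2 d0 again belongs to a special form, because that form is
    integrally equivalent to the one with d'.\<close>
  have "special (nf m a (w^2 * d0))" using special_congr[OF s1[unfolded ma] V(1)] Vnf by simp
  then have "orbit_density (nf m a (w^2 * d0)) e1 (kappa m a d0)"
    using orbit_density_nf[OF _ pos] kappa_scale[OF pos w(1)] by metis
  then have "orbit_density (nf m a d') e1 (kappa m a d0)"
    using orbit_density_congr[OF V(1), of "nf m a d'" e1] Vnf Ve by simp
  then show ?thesis using orbit_density_congr[OF U(1), of S' e1] U(2,5) ma by simp
qed

theorem theorem2:
  fixes S :: "int^3^3"
  assumes "special S"
  shows "\<exists>\<kappa>::real. \<kappa> > 0 \<and>
    (\<forall>S' \<in> genus S. \<forall>y :: real^3. qf (adj3 (real_mat S')) y = 4 * of_int (det S') \<longrightarrow>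
       (\<forall>x \<in> cone S'.
          (\<lambda>T::real. real (card {x' \<in> orbit S' x. 0 < pair x' y \<and> pair x' y \<le> T}))
            \<sim>[at_top] (\<lambda>T. \<kappa> * T)))"
proof -
  \<comment> \<open>An arbitrary isotropic vector of S supplies m, a, d0 and with them the constant;
    every pointed form in the genus is then compared with this one.\<close>
  obtain x0 where x0: "x0 \<in> cone S" using assms by (auto simp: special_def isotropic_def cone_def)
  obtain U0 m a d0 where U0: "U0 \<in> GL3Z" "U0 *v e1 = x0" "m > 0" "a > 0" "transpose U0 ** S ** U0 = nf m a d0"
    using nf_exists[OF assms x0] by blast
  define k where "k = kappa m a d0"
  have k: "k > 0" unfolding k_def by (rule kappa_pos[OF U0(3,4)])
  show ?thesis
  proof (intro exI[of _ k] conjI ballI allI impI k)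
    fix S' y x
    assume S': "S' \<in> genus S" and y: "qf (adj3 (real_mat S')) y = 4 * of_int (det S')" and x: "x \<in> cone S'"
    let ?c = "\<lambda>T. real (card {x' \<in> orbit S' x. 0 < pair x' y \<and> pair x' y \<le> T})"
    have "((\<lambda>T. ?c T / T) \<longlongrightarrow> k) at_top"
      using genus_orbit_density[OF assms U0(3,4,1,5) S' x] y unfolding orbit_density_def k_def by blast
    then have "((\<lambda>T. ?c T / T / k) \<longlongrightarrow> k / k) at_top" using k by (intro tendsto_divide tendsto_const) auto
    then have "((\<lambda>T. ?c T / (k * T)) \<longlongrightarrow> 1) at_top" using k by (simp add: mult.commute)
    then show "?c \<sim>[at_top] (\<lambda>T. k * T)" by (rule asymp_equivI')
  qed
qed

end
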